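(* Let $\omega\in\Omega$ be an infinite real orbit with $|B_\omega|>0$, let $S\subseteq\omega$ be a supportive interval, let $I_X\subseteq I(S)$, and let $V=V(\omega,S,I_X)$. Then $V^\sharp\simeq V(\omega,S,I(S)\setminus I_X)$ as $A$-modules. In particular, $V$ is pseudo-unitarizable if and only if $I(S)=\emptyset$, which is equivalent to $V$ being simple.
   Context: Setup. $R$ is a commutative ring with $1$; $*:R\to R$ is a ring automorphism of order $1$ or $2$; $\sigma:R\to R$ is a ring automorphism commuting with $*$; $t\in R$ satisfies $t^*=t$. The generalized Weyl algebra $A=R(\sigma,t)$ is the ring generated by $R\cup\{X,Y\}$ such that $R$ is a subring and $YX=t$, $XY=\sigma(t)$, $Xr=\sigma(r)X$, $Yr=\sigma^{-1}(r)Y$ for all $r\in R$. It is $\mathbb Z$-graded with $\deg X=1$, $\deg Y=-1$, $\deg r=0$ for $r\in R$. The map $*$ extends to an involution of $A$ (additive, $(ab)^*=b^*a^*$, $a^{**}=a$) with $X^*=Y$, $Y^*=X$. $\Omega$ is the set of orbits of $\sigma$ acting on $\mathrm{Max}(R)$. An orbit $\omega$ is real if $\mathfrak m^*=\mathfrak m$ for all $\mathfrak m\in\omega$. $B_\omega=\{\mathfrak m\in\omega:t\in\mathfrak m\}$ is the set of breaks. $\mathbb K_{\mathfrak m}=R/\mathfrak m$, and $r_{\mathfrak m}=r+\mathfrak m$ for $r\in R$. $R_\omega=\bigoplus_{\mathfrak m\in\omega}R/\mathfrak m$; $\sigma$ induces isomorphisms $R/\mathfrak m\to R/\sigma(\mathfrak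 m)$ and an additive map $\sigma:R_\omega\to R_\omega$. A weight module is an $A$-module $V=\bigoplus_{\mathfrak m\in\mathrm{Max}(R)}V_{\mathfrak m}$ with $V_{\mathfrak m}=\{v:\mathfrak m v=0\}$; $\mathrm{Supp}(V)=\{\mathfrak m:V_{\mathfrak m}\ne0\}$. For a weight module $V$ with $\mathrm{Supp}(V)\subseteq\omega$: an admissible form on $V$ is a map $F:V\times V\to R_\omega$, additive in each argument, with $F(rv,w)=rF(v,w)$ for $r\in R$ and $F(av,w)=\sigma^{\deg a}(F(v,a^*w))$ for homogeneous $a\in A$. It is non-degenerate if for any nonzero $v$ there are $w_1,w_2$ with $F(w_1,v)\ne0\ne F(v,w_2)$. $V$ is pseudo-unitarizable if it has a non-degenerate admissible form. The finitistic dual $V^\sharp$ is the set of additive maps $\varphi:V\to R_\omega$ with $\varphi(rv)=r^*\varphi(v)$ and $\varphi(V_{\mathfrak m})=0$ for all but finitely many $\mathfrak m\in\omega$, an $A$-module via $(r\varphi)(v)=\varphi(r^*v)$, $(X\varphi)(v)=\sigma(\varphi(Yv))$, $(Y\varphi)(v)=\sigma^{-1}(\varphi(Xv))$. An infinite orbit $\omega$ is totally ordered by $\mathfrak m<\mathfrak n$ iff $\mathfrak n=\sigma^k(\mathfrak m)$ for some $k>0$. A nonempty interval $S\subseteq\omega$ is supportive if: whenever $S$ has a minimal element $\mathfrak n_0$, then $\sigma^{-1}(\mathfrak n_0)\in B_\omega$; and whenever $S$ has a maximal element $\mathfrak n_1$, then $\mathfrak n_1\in B_\omega$. The set of inner breaks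 is $I(S)=\{\mathfrak m\in S\cap B_\omega:\sigma(\mathfrak m)\in S\}$. For $I_X\subseteq I(S)$, $V(\omega,S,I_X)=\bigoplus_{\mathfrak m\in S}\mathbb K_{\mathfrak m}$ with the natural $R$-action and, for $v\in\mathbb K_{\mathfrak m}$: $Xv=\sigma(t_{\mathfrak m}v)$ if $\mathfrak m\notin B_\omega$, $Xv=\sigma(v)$ if $\mathfrak m\in I_X$, $Xv=0$ otherwise; $Yv=\sigma^{-1}(v)$ if $\sigma^{-1}(\mathfrak m)\notin B_\omega$ or $\sigma^{-1}(\mathfrak m)\in I(S)\setminus I_X$, and $Yv=0$ otherwise. *)

theory Defs
  imports "HOL-Library.Poly_Mapping" "HOL-Algebra.Algebra"
begin

section \<open>The datum $(R, *, \sigma, t)$\<close>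

text \<open>The datum is the ring record of $R$ extended by $*$, $\sigma$ and $t$; thus
  \<open>D\<close> itself is used as the ring $R$.\<close>

record 'a gwa_datum = "'a ring" +
  bar :: "'a \<Rightarrow> 'a"
  sig :: "'a \<Rightarrow> 'a"
  telt :: 'a

locale gwa_setup = cring D for D :: "'a gwa_datum" (structure) +
  assumes bar_iso: "bar D \<in> ring_iso D D"
    and bar_bar: "r \<in> carrier D \<Longrightarrow> bar D (bar D r) = r"
    and sig_iso: "sig D \<in> ring_iso D D"
    and sig_bar: "r \<in> carrier D \<Longrightarrow> sig D (bar D r) = bar D (sig D r)"
    and telt_closed: "telt D \<in> carrier D"
    and bar_telt: "bar D (telt D) = telt D"

text \<open>\<open>sigpow D k\<close> is $\sigma^k$ on $R$. The induced actions on ideals and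
  on cosets, $R/\mathfrak m \to R/\sigma^k(\mathfrak m)$, are direct images.\<close>

definition sigpow :: "'a gwa_datum \<Rightarrow> int \<Rightarrow> 'a \<Rightarrow> 'a" where
  "sigpow D k = (if 0 \<le> k then sig D ^^ nat k
                 else inv_into (carrier D) (sig D) ^^ nat (- k))"

definition shift :: "'a gwa_datum \<Rightarrow> int \<Rightarrow> 'a set \<Rightarrow> 'a set" where
  "shift D k U = sigpow D k ` U"


section \<open>The generalized Weyl algebra\<close>

text \<open>Words form a monoid under concatenation, which makes
  \<open>'g list \<Rightarrow>\<^sub>0 int\<close> (with convolution) the free ring on the type \<open>'g\<close>.\<close>

instantiation list :: (type) monoid_add
begin

definition zero_list :: "'a list" where "zero_list = []"

definition plus_list :: "'a list \<Rightarrow> 'a list \<Rightarrow> 'a list" where "plus_list = (@)"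

instance
  by standard (auto simp: zero_list_def plus_list_def)

end

datatype 'a gen = Coef 'a | GX | GY

type_synonym 'a free = "'a gen list \<Rightarrow>\<^sub>0 int"

text \<open>Only those \<open>Coef r\<close> with $r \in R$ are generators.\<close>

definition free_words :: "'a gwa_datum \<Rightarrow> 'a gen list set" where
  "free_words D = lists (Coef ` carrier D \<union> {GX, GY})"

definition free_ring :: "'a gwa_datum \<Rightarrow> 'a free ring" where
  "free_ring D = \<lparr>carrier = {p. Poly_Mapping.keys p \<subseteq> free_words D},
     monoid.mult = (*), one = 1, ring.zero = 0, add = (+)\<rparr>"

abbreviation word :: "'a gen list \<Rightarrow> 'a free" where
  "word w \<equiv> Poly_Mapping.single w 1"

text \<open>The first three families make $R \to A$ a ring homomorphism.\<close>

definition gwa_relations :: "'a gwa_datum \<Rightarrow> 'a free set" where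
  "gwa_relations D =
     {word [Coef (r \<oplus>\<^bsub>D\<^esub> s)] - (word [Coef r] + word [Coef s]) | r s.
        r \<in> carrier D \<and> s \<in> carrier D}
   \<union> {word [Coef (r \<otimes>\<^bsub>D\<^esub> s)] - word [Coef r, Coef s] | r s.
        r \<in> carrier D \<and> s \<in> carrier D}
   \<union> {word [Coef \<one>\<^bsub>D\<^esub>] - word []}
   \<union> {word [GY, GX] - word [Coef (telt D)], word [GX, GY] - word [Coef (sig D (telt D))]}
   \<union> {word [GX, Coef r] - word [Coef (sig D r), GX] | r. r \<in> carrier D}
   \<union> {word [GY, Coef r] - word [Coef (sigpow D (-1) r), GY] | r. r \<in> carrier D}"

definition gwa_ideal :: "'a gwa_datum \<Rightarrow> 'a free set" where
  "gwa_ideal D = Idl\<^bsub>free_ring D\<^esub> (gwa_relations D)"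

definition gwa :: "'a gwa_datum \<Rightarrow> 'a free set ring" where
  "gwa D = free_ring D Quot gwa_ideal D"

definition gwa_class :: "'a gwa_datum \<Rightarrow> 'a free \<Rightarrow> 'a free set" where
  "gwa_class D p = gwa_ideal D +>\<^bsub>free_ring D\<^esub> p"

abbreviation gwa_coef :: "'a gwa_datum \<Rightarrow> 'a \<Rightarrow> 'a free set" where
  "gwa_coef D r \<equiv> gwa_class D (word [Coef r])"

abbreviation gwa_X :: "'a gwa_datum \<Rightarrow> 'a free set" where
  "gwa_X D \<equiv> gwa_class D (word [GX])"

abbreviation gwa_Y :: "'a gwa_datum \<Rightarrow> 'a free set" where
  "gwa_Y D \<equiv> gwa_class D (word [GY])"

fun gen_deg :: "'a gen \<Rightarrow> int" where
  "gen_deg (Coef r) = 0"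
| "gen_deg GX = 1"
| "gen_deg GY = - 1"

definition gwa_component :: "'a gwa_datum \<Rightarrow> int \<Rightarrow> 'a free set set" where
  "gwa_component D n = gwa_class D `
     {p \<in> carrier (free_ring D). \<forall>w \<in> Poly_Mapping.keys p. sum_list (map gen_deg w) = n}"

fun gen_star :: "'a gwa_datum \<Rightarrow> 'a gen \<Rightarrow> 'a gen" where
  "gen_star D (Coef r) = Coef (bar D r)"
| "gen_star D GX = GY"
| "gen_star D GY = GX"

definition free_star :: "'a gwa_datum \<Rightarrow> 'a free \<Rightarrow> 'a free" where
  "free_star D p = (\<Sum>w \<in> Poly_Mapping.keys p.
     Poly_Mapping.single (rev (map (gen_star D) w)) (Poly_Mapping.lookup p w))"

text \<open>The anti-automorphism of the free ring maps the defining ideal onto itself, so its direct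
  image on cosets is the induced involution of $A$.\<close>

definition gwa_star :: "'a gwa_datum \<Rightarrow> 'a free set \<Rightarrow> 'a free set" where
  "gwa_star D a = free_star D ` a"


section \<open>Left modules\<close>

text \<open>The library locale \<open>module\<close> requires a commutative ring of scalars.\<close>

locale left_module = A?: ring A + M?: abelian_group M
  for A :: "('a, 'm) ring_scheme" (structure) and M :: "('a, 'b, 'n) module_scheme" (structure) +
  assumes smult_closed:
      "\<lbrakk>a \<in> carrier A; x \<in> carrier M\<rbrakk> \<Longrightarrow> a \<odot>\<^bsub>M\<^esub> x \<in> carrier M"
    and smult_l_distr:
      "\<lbrakk>a \<in> carrier A; b \<in> carrier A; x \<in> carrier M\<rbrakk> \<Longrightarrow>
       (a \<oplus>\<^bsub>A\<^esub> b) \<odot>\<^bsub>M\<^esub> x = a \<odot>\<^bsub>M\<^esub> x \<oplus>\<^bsub>M\<^esub> b \<odot>\<^bsub>M\<^esub> x"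
    and smult_r_distr:
      "\<lbrakk>a \<in> carrier A; x \<in> carrier M; y \<in> carrier M\<rbrakk> \<Longrightarrow>
       a \<odot>\<^bsub>M\<^esub> (x \<oplus>\<^bsub>M\<^esub> y) = a \<odot>\<^bsub>M\<^esub> x \<oplus>\<^bsub>M\<^esub> a \<odot>\<^bsub>M\<^esub> y"
    and smult_assoc:
      "\<lbrakk>a \<in> carrier A; b \<in> carrier A; x \<in> carrier M\<rbrakk> \<Longrightarrow>
       (a \<otimes>\<^bsub>A\<^esub> b) \<odot>\<^bsub>M\<^esub> x = a \<odot>\<^bsub>M\<^esub> (b \<odot>\<^bsub>M\<^esub> x)"
    and smult_one: "x \<in> carrier M \<Longrightarrow> \<one>\<^bsub>A\<^esub> \<odot>\<^bsub>M\<^esub> x = x"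

definition left_modules_iso ::
  "('a, 'm) ring_scheme \<Rightarrow> ('a, 'b, 'n) module_scheme \<Rightarrow> ('a, 'c, 'k) module_scheme \<Rightarrow> bool" where
  "left_modules_iso A M N \<longleftrightarrow> left_module A M \<and> left_module A N \<and>
     (\<exists>h. bij_betw h (carrier M) (carrier N)
        \<and> (\<forall>x \<in> carrier M. \<forall>y \<in> carrier M. h (x \<oplus>\<^bsub>M\<^esub> y) = h x \<oplus>\<^bsub>N\<^esub> h y)
        \<and> (\<forall>a \<in> carrier A. \<forall>x \<in> carrier M. h (a \<odot>\<^bsub>M\<^esub> x) = a \<odot>\<^bsub>N\<^esub> h x))"

definition simple_left_module :: "('a, 'm) ring_scheme \<Rightarrow> ('a, 'b, 'n) module_scheme \<Rightarrow> bool" where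
  "simple_left_module A M \<longleftrightarrow> left_module A M \<and> carrier M \<noteq> {\<zero>\<^bsub>M\<^esub>} \<and>
     (\<forall>H. submodule H A M \<longrightarrow> H = {\<zero>\<^bsub>M\<^esub>} \<or> H = carrier M)"

text \<open>An $R$-module \<open>M\<close> with operators \<open>x\<close> and \<open>y\<close> for $X$ and $Y$
  as an $A$-module: words act by composition, elements of the free ring by integer linear
  combinations. When \<open>x\<close> and \<open>y\<close> satisfy the relations of $A$,
  the action of a coset is that of any representative.\<close>

fun gen_action :: "('a, 'v, 'n) module_scheme \<Rightarrow> ('v \<Rightarrow> 'v) \<Rightarrow> ('v \<Rightarrow> 'v) \<Rightarrow> 'a gen \<Rightarrow> 'v \<Rightarrow> 'v" where
  "gen_action M x y (Coef r) = smult M r"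
| "gen_action M x y GX = x"
| "gen_action M x y GY = y"

definition free_action ::
  "('a, 'v, 'n) module_scheme \<Rightarrow> ('v \<Rightarrow> 'v) \<Rightarrow> ('v \<Rightarrow> 'v) \<Rightarrow> 'a free \<Rightarrow> 'v \<Rightarrow> 'v" where
  "free_action M x y p v = (\<Oplus>\<^bsub>M\<^esub>w \<in> Poly_Mapping.keys p.
     add_pow M (Poly_Mapping.lookup p w) (foldr (gen_action M x y) w v))"

definition gwa_module ::
  "('a, 'v) module \<Rightarrow> ('v \<Rightarrow> 'v) \<Rightarrow> ('v \<Rightarrow> 'v) \<Rightarrow> ('a free set, 'v) module" where
  "gwa_module M x y = \<lparr>carrier = carrier M, monoid.mult = monoid.mult M, one = one M, ring.zero = ring.zero M, add = add M,
     smult = (\<lambda>a v. free_action M x y (SOME p. p \<in> a) v)\<rparr>"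


section \<open>Maximal ideals, orbits and $R_\omega$\<close>

definition Max_ideals :: "'a gwa_datum \<Rightarrow> 'a set set" where
  "Max_ideals D = {m. maximalideal m D}"

definition gwa_orbits :: "'a gwa_datum \<Rightarrow> 'a set set set" where
  "gwa_orbits D = {range (\<lambda>k. shift D k m) | m. m \<in> Max_ideals D}"

definition real_orbit :: "'a gwa_datum \<Rightarrow> 'a set set \<Rightarrow> bool" where
  "real_orbit D \<omega> \<longleftrightarrow> (\<forall>m \<in> \<omega>. bar D ` m = m)"

definition breaks :: "'a gwa_datum \<Rightarrow> 'a set set \<Rightarrow> 'a set set" where
  "breaks D \<omega> = {m \<in> \<omega>. telt D \<in> m}"

text \<open>$\bigoplus_{\mathfrak m \in S} R/\mathfrak m$ as an $R$-module.
  The product operations of the module record play no role.\<close>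

definition res_sum :: "'a gwa_datum \<Rightarrow> 'a set set \<Rightarrow> ('a, 'a set \<Rightarrow> 'a set) module" where
  "res_sum D S =
     (let G = sum_group S (\<lambda>m. add_monoid (D Quot m)) in
      \<lparr>carrier = carrier G, monoid.mult = undefined, one = undefined,
       ring.zero = \<one>\<^bsub>G\<^esub>, add = (\<otimes>\<^bsub>G\<^esub>),
       smult = (\<lambda>r f. \<lambda>m\<in>S. (m +>\<^bsub>D\<^esub> r) \<otimes>\<^bsub>D Quot m\<^esub> f m)\<rparr>)"

definition res_sig ::
  "'a gwa_datum \<Rightarrow> 'a set set \<Rightarrow> int \<Rightarrow> ('a set \<Rightarrow> 'a set) \<Rightarrow> ('a set \<Rightarrow> 'a set)" where
  "res_sig D \<omega> k f = (\<lambda>n\<in>\<omega>. shift D k (f (shift D (- k) n)))"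


section \<open>Weight modules, admissible forms and the finitistic dual\<close>

definition weight_space :: "'a gwa_datum \<Rightarrow> ('a free set, 'v) module \<Rightarrow> 'a set \<Rightarrow> 'v set" where
  "weight_space D V m = {v \<in> carrier V. \<forall>r \<in> m. gwa_coef D r \<odot>\<^bsub>V\<^esub> v = \<zero>\<^bsub>V\<^esub>}"

definition weight_module :: "'a gwa_datum \<Rightarrow> ('a free set, 'v) module \<Rightarrow> bool" where
  "weight_module D V \<longleftrightarrow> left_module (gwa D) V \<and>
     (\<forall>v \<in> carrier V. \<exists>!f. f \<in> (\<Pi>\<^sub>E m \<in> Max_ideals D. weight_space D V m)
        \<and> finite {m \<in> Max_ideals D. f m \<noteq> \<zero>\<^bsub>V\<^esub>}
        \<and> v = (\<Oplus>\<^bsub>V\<^esub>m \<in> {m \<in> Max_ideals D. f m \<noteq> \<zero>\<^bsub>V\<^esub>}. f m))"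

definition Supp :: "'a gwa_datum \<Rightarrow> ('a free set, 'v) module \<Rightarrow> 'a set set" where
  "Supp D V = {m \<in> Max_ideals D. weight_space D V m \<noteq> {\<zero>\<^bsub>V\<^esub>}}"

definition admissible_form ::
  "'a gwa_datum \<Rightarrow> 'a set set \<Rightarrow> ('a free set, 'v) module \<Rightarrow> ('v \<Rightarrow> 'v \<Rightarrow> 'a set \<Rightarrow> 'a set) \<Rightarrow> bool" where
  "admissible_form D \<omega> V F \<longleftrightarrow>
     (\<forall>v \<in> carrier V. \<forall>w \<in> carrier V. F v w \<in> carrier (res_sum D \<omega>))
   \<and> (\<forall>u \<in> carrier V. \<forall>v \<in> carrier V. \<forall>w \<in> carrier V.
        F (u \<oplus>\<^bsub>V\<^esub> v) w = F u w \<oplus>\<^bsub>res_sum D \<omega>\<^esub> F v w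
      \<and> F u (v \<oplus>\<^bsub>V\<^esub> w) = F u v \<oplus>\<^bsub>res_sum D \<omega>\<^esub> F u w)
   \<and> (\<forall>r \<in> carrier D. \<forall>v \<in> carrier V. \<forall>w \<in> carrier V.
        F (gwa_coef D r \<odot>\<^bsub>V\<^esub> v) w = r \<odot>\<^bsub>res_sum D \<omega>\<^esub> F v w)
   \<and> (\<forall>n. \<forall>a \<in> gwa_component D n. \<forall>v \<in> carrier V. \<forall>w \<in> carrier V.
        F (a \<odot>\<^bsub>V\<^esub> v) w = res_sig D \<omega> n (F v (gwa_star D a \<odot>\<^bsub>V\<^esub> w)))"

definition nondegenerate_form ::
  "'a gwa_datum \<Rightarrow> 'a set set \<Rightarrow> ('a free set, 'v) module \<Rightarrow> ('v \<Rightarrow> 'v \<Rightarrow> 'a set \<Rightarrow> 'a set) \<Rightarrow> bool" where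
  "nondegenerate_form D \<omega> V F \<longleftrightarrow>
     (\<forall>v \<in> carrier V. v \<noteq> \<zero>\<^bsub>V\<^esub> \<longrightarrow>
        (\<exists>w1 \<in> carrier V. \<exists>w2 \<in> carrier V.
           F w1 v \<noteq> \<zero>\<^bsub>res_sum D \<omega>\<^esub> \<and> F v w2 \<noteq> \<zero>\<^bsub>res_sum D \<omega>\<^esub>))"

definition pseudo_unitarizable ::
  "'a gwa_datum \<Rightarrow> 'a set set \<Rightarrow> ('a free set, 'v) module \<Rightarrow> bool" where
  "pseudo_unitarizable D \<omega> V \<longleftrightarrow> weight_module D V \<and> Supp D V \<subseteq> \<omega> \<and>
     (\<exists>F. admissible_form D \<omega> V F \<and> nondegenerate_form D \<omega> V F)"

text \<open>The $R$-module underlying the finitistic dual. Maps on \<open>V\<close> are extensional, i.e.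
  \<open>undefined\<close> outside the carrier.\<close>

definition fdual_res ::
  "'a gwa_datum \<Rightarrow> 'a set set \<Rightarrow> ('a free set, 'v) module \<Rightarrow> ('a, 'v \<Rightarrow> 'a set \<Rightarrow> 'a set) module" where
  "fdual_res D \<omega> V =
     \<lparr>carrier = {\<phi> \<in> carrier V \<rightarrow>\<^sub>E carrier (res_sum D \<omega>).
         (\<forall>v \<in> carrier V. \<forall>w \<in> carrier V.
            \<phi> (v \<oplus>\<^bsub>V\<^esub> w) = \<phi> v \<oplus>\<^bsub>res_sum D \<omega>\<^esub> \<phi> w)
       \<and> (\<forall>r \<in> carrier D. \<forall>v \<in> carrier V.
            \<phi> (gwa_coef D r \<odot>\<^bsub>V\<^esub> v) = bar D r \<odot>\<^bsub>res_sum D \<omega>\<^esub> \<phi> v)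
       \<and> finite {m \<in> \<omega>. \<exists>v \<in> weight_space D V m. \<phi> v \<noteq> \<zero>\<^bsub>res_sum D \<omega>\<^esub>}},
      monoid.mult = undefined, one = undefined,
      ring.zero = (\<lambda>v\<in>carrier V. \<zero>\<^bsub>res_sum D \<omega>\<^esub>),
      add = (\<lambda>\<phi> \<psi>. \<lambda>v\<in>carrier V. \<phi> v \<oplus>\<^bsub>res_sum D \<omega>\<^esub> \<psi> v),
      smult = (\<lambda>r \<phi>. \<lambda>v\<in>carrier V. \<phi> (gwa_coef D (bar D r) \<odot>\<^bsub>V\<^esub> v))\<rparr>"

definition fdual ::
  "'a gwa_datum \<Rightarrow> 'a set set \<Rightarrow> ('a free set, 'v) module
     \<Rightarrow> ('a free set, 'v \<Rightarrow> 'a set \<Rightarrow> 'a set) module" where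
  "fdual D \<omega> V = gwa_module (fdual_res D \<omega> V)
     (\<lambda>\<phi>. \<lambda>v\<in>carrier V. res_sig D \<omega> 1 (\<phi> (gwa_Y D \<odot>\<^bsub>V\<^esub> v)))
     (\<lambda>\<phi>. \<lambda>v\<in>carrier V. res_sig D \<omega> (- 1) (\<phi> (gwa_X D \<odot>\<^bsub>V\<^esub> v)))"


section \<open>The modules $V(\omega, S, I_X)$\<close>

definition orbit_less :: "'a gwa_datum \<Rightarrow> 'a set \<Rightarrow> 'a set \<Rightarrow> bool" where
  "orbit_less D m n \<longleftrightarrow> (\<exists>k>0. n = shift D k m)"

definition orbit_interval :: "'a gwa_datum \<Rightarrow> 'a set set \<Rightarrow> 'a set set \<Rightarrow> bool" where
  "orbit_interval D \<omega> S \<longleftrightarrow> S \<subseteq> \<omega> \<and>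
     (\<forall>a \<in> S. \<forall>b \<in> S. \<forall>c \<in> \<omega>. orbit_less D a c \<and> orbit_less D c b \<longrightarrow> c \<in> S)"

definition supportive :: "'a gwa_datum \<Rightarrow> 'a set set \<Rightarrow> 'a set set \<Rightarrow> bool" where
  "supportive D \<omega> S \<longleftrightarrow> orbit_interval D \<omega> S \<and> S \<noteq> {}
   \<and> (\<forall>n0 \<in> S. (\<forall>m \<in> S. \<not> orbit_less D m n0) \<longrightarrow> shift D (- 1) n0 \<in> breaks D \<omega>)
   \<and> (\<forall>n1 \<in> S. (\<forall>m \<in> S. \<not> orbit_less D n1 m) \<longrightarrow> n1 \<in> breaks D \<omega>)"

definition inner_breaks :: "'a gwa_datum \<Rightarrow> 'a set set \<Rightarrow> 'a set set \<Rightarrow> 'a set set" where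
  "inner_breaks D \<omega> S = {m \<in> S \<inter> breaks D \<omega>. shift D 1 m \<in> S}"

text \<open>The \<open>n\<close>-components of $Xf$ and $Yf$ come from the components
  $f_{\sigma^{-1}(n)}$ and $f_{\sigma(n)}$. For supportive \<open>S\<close>, no nonzero component is
  mapped outside of \<open>S\<close>.\<close>

definition V_X ::
  "'a gwa_datum \<Rightarrow> 'a set set \<Rightarrow> 'a set set \<Rightarrow> 'a set set
     \<Rightarrow> ('a set \<Rightarrow> 'a set) \<Rightarrow> ('a set \<Rightarrow> 'a set)" where
  "V_X D \<omega> S IX f = (\<lambda>n\<in>S. let m = shift D (- 1) n in
     if m \<in> S \<and> m \<notin> breaks D \<omega>
       then shift D 1 ((m +>\<^bsub>D\<^esub> telt D) \<otimes>\<^bsub>D Quot m\<^esub> f m)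
     else if m \<in> S \<and> m \<in> IX then shift D 1 (f m)
     else \<zero>\<^bsub>D Quot n\<^esub>)"

definition V_Y ::
  "'a gwa_datum \<Rightarrow> 'a set set \<Rightarrow> 'a set set \<Rightarrow> 'a set set
     \<Rightarrow> ('a set \<Rightarrow> 'a set) \<Rightarrow> ('a set \<Rightarrow> 'a set)" where
  "V_Y D \<omega> S IX f = (\<lambda>n\<in>S. let m = shift D 1 n in
     if m \<in> S \<and> (n \<notin> breaks D \<omega> \<or> n \<in> inner_breaks D \<omega> S - IX)
       then shift D (- 1) (f m)
     else \<zero>\<^bsub>D Quot n\<^esub>)"

definition V_mod ::
  "'a gwa_datum \<Rightarrow> 'a set set \<Rightarrow> 'a set set \<Rightarrow> 'a set set
     \<Rightarrow> ('a free set, 'a set \<Rightarrow> 'a set) module" where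
  "V_mod D \<omega> S IX = gwa_module (res_sum D S) (V_X D \<omega> S IX) (V_Y D \<omega> S IX)"

end

theory Submission
  imports Defs
begin

text \<open>
  On a real orbit a semilinear map $V \to R_\omega$ preserves weights, so it is determined by its
  values on the generators of the one-dimensional weight spaces $\mathbb K_{\mathfrak m}$.
  Hence $V^\sharp$ is again $\bigoplus_{\mathfrak m \in S} \mathbb K_{\mathfrak m}$, with the
  roles of $X$ and $Y$ at inner breaks interchanged; the isomorphism is
  $f \mapsto \bigl(v \mapsto (d_{\mathfrak m} f_{\mathfrak m} v_{\mathfrak m}^*)_{\mathfrak m}\bigr)$,
  where the scalars $d_{\mathfrak m} \neq 0$ solve
  $\sigma(d_{\mathfrak m}) = d_{\sigma(\mathfrak m)} \sigma(t)$ off the breaks and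
  $\sigma(d_{\mathfrak m}) = d_{\sigma(\mathfrak m)}$ at the breaks. They exist because the orbit is a
  copy of $\mathbb Z$. Without inner breaks this pairing is itself a non-degenerate admissible form. At an
  inner break $\mathfrak m$, one of $X$ on $V_{\mathfrak m}$ and $Y$ on $V_{\sigma(\mathfrak m)}$ is
  zero and the other is not: the image of the other one lies in the radical of every admissible
  form, and the part of $V$ on its side of the break is a proper submodule.
\<close>

section \<open>Powers of $\sigma$\<close>

text \<open>The algebra is a quotient of a free ring, and its elements act through an arbitrarily
  chosen representative of a coset. Every statement about the action must therefore be shown blind
  to that choice: the elements of the free ring acting as zero form an ideal, and so do those whose
  star acts as zero, and both ideals contain the defining relations. After that only the letters
  \<open>Coef r\<close>, \<open>GX\<close> and \<open>GY\<close> need checking. Weight preservation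
  comes from separation: given finitely many ideals of \<omega> and another one n, some r in R lies
  in all of them but not in n. Multiplication by r kills a vector supported on the former, while r,
  and on a real orbit also its conjugate, is invertible in R/n. The same r cuts a single component
  out of a vector, which is how submodules of V are controlled. The recursion for the scalars runs
  along the arrows from m to \<sigma>(m). Off the breaks \<sigma>(t) is invertible in R/\<sigma>(m),
  so the recursion can be solved in both directions. On a finite orbit going round once would
  constrain the starting value; on an infinite orbit nothing has to close up.\<close>

context gwa_setup
begin

abbreviation "isig \<equiv> inv_into (carrier D) (sig D)"

lemma isig_iso: "isig \<in> ring_iso D D"
  by (rule ring_iso_set_sym[OF ring_axioms sig_iso])

lemma sig_isig: "r \<in> carrier D \<Longrightarrow> sig D (isig r) = r"
  using sig_iso by (simp add: ring_iso_def bij_betw_def f_inv_into_f)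

lemma isig_sig: "r \<in> carrier D \<Longrightarrow> isig (sig D r) = r"
  using sig_iso by (simp add: ring_iso_def bij_betw_def)

lemma funpow_ring_iso: "h \<in> ring_iso D D \<Longrightarrow> h ^^ n \<in> ring_iso D D"
  by (induction n) (simp_all add: ring_iso_set_refl ring_iso_set_trans id_def[symmetric] del: funpow.simps(2) add: funpow_Suc_right)

lemma sigpow_iso: "sigpow D k \<in> ring_iso D D"
  by (simp add: sigpow_def funpow_ring_iso sig_iso isig_iso)

lemma sigpow_hom: "sigpow D k \<in> ring_hom D D"
  using sigpow_iso by (simp add: ring_iso_def)

lemma sigpow_closed: "r \<in> carrier D \<Longrightarrow> sigpow D k r \<in> carrier D"
  using sigpow_hom by (rule ring_hom_closed)

lemma sigpow_0: "sigpow D 0 r = r"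
  by (simp add: sigpow_def)

lemma sigpow_1: "sigpow D 1 = sig D"
  by (simp add: sigpow_def)

lemma sig_closed: "r \<in> carrier D \<Longrightarrow> sig D r \<in> carrier D"
  using sigpow_closed[of r 1] by (simp add: sigpow_1)

lemma sigpow_m1: "sigpow D (- 1) = isig"
  by (simp add: sigpow_def)

text \<open>This is where the two branches of \<open>sigpow\<close> meet. All other laws of the
  powers follow from it by induction over the integers.\<close>

lemma sigpow_succ: "r \<in> carrier D \<Longrightarrow> sigpow D (k + 1) r = sig D (sigpow D k r)"
proof (cases "0 \<le> k")
  case True
  then show ?thesis by (simp add: sigpow_def nat_add_distrib)
next
  case False
  assume r: "r \<in> carrier D"
  define n where "n = nat (- k) - 1"
  have k: "k = - int (Suc n)" using False by (simp add: n_def)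
  have cl: "(isig ^^ n) r \<in> carrier D"
    using funpow_ring_iso[OF isig_iso, of n] r ring_hom_closed by (auto simp: ring_iso_def)
  have "sigpow D k r = isig ((isig ^^ n) r)" by (simp add: sigpow_def k nat_add_distrib)
  moreover have "sigpow D (k + 1) r = (isig ^^ n) r"
    by (cases n) (simp_all add: sigpow_def k nat_add_distrib)
  ultimately show ?thesis using cl by (simp add: sig_isig)
qed

lemma sigpow_add: "r \<in> carrier D \<Longrightarrow> sigpow D (j + k) r = sigpow D j (sigpow D k r)"
proof (induction j rule: int_induct[where k = 0])
  case base
  then show ?case by (simp add: sigpow_0)
next
  case (step1 j)
  have "sigpow D (j + 1 + k) r = sigpow D (j + k + 1) r" by (simp add: algebra_simps)
  then show ?case using step1 by (simp add: sigpow_succ sigpow_closed)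
next
  case (step2 j)
  \<comment> \<open>Downward steps: \<sigma> is injective on R, so both sides may be compared after
    applying it, where the upward rule is available.\<close>
  let ?a = "sigpow D (j - 1 + k) r" and ?b = "sigpow D (j - 1) (sigpow D k r)"
  have "sig D ?a = sig D ?b"
    using step2 sigpow_succ[of r "j - 1 + k"] sigpow_succ[of "sigpow D k r" "j - 1"]
    by (simp add: sigpow_closed algebra_simps)
  then have "isig (sig D ?a) = isig (sig D ?b)" by simp
  then show ?case using step2.prems by (simp add: isig_sig sigpow_closed)
qed

lemma bar_hom: "bar D \<in> ring_hom D D"
  using bar_iso by (simp add: ring_iso_def)

lemma bar_closed: "r \<in> carrier D \<Longrightarrow> bar D r \<in> carrier D"
  using bar_hom by (rule ring_hom_closed)

lemma sigpow_bar: "r \<in> carrier D \<Longrightarrow> sigpow D k (bar D r) = bar D (sigpow D k r)"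
proof (induction k rule: int_induct[where k = 0])
  case base
  then show ?case by (simp add: sigpow_0)
next
  case (step1 j)
  then show ?case by (simp add: sigpow_succ sigpow_closed bar_closed sig_bar)
next
  case (step2 j)
  let ?a = "sigpow D (j - 1) (bar D r)" and ?b = "bar D (sigpow D (j - 1) r)"
  have "sig D ?a = sig D ?b"
    using step2 sigpow_succ[of r "j - 1"] sigpow_succ[of "bar D r" "j - 1"]
    by (simp add: sigpow_closed bar_closed sig_bar)
  then have "isig (sig D ?a) = isig (sig D ?b)" by simp
  then show ?case using step2.prems by (simp add: isig_sig sigpow_closed bar_closed)
qed

end

section \<open>The free ring and its quotient\<close>

lemma free_words_simps:
  "[] \<in> free_words D" "0 \<in> free_words D"
  "g # w \<in> free_words D \<longleftrightarrow> g \<in> Coef ` carrier D \<union> {GX, GY} \<and> w \<in> free_words D"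
  "v + w \<in> free_words D \<longleftrightarrow> v \<in> free_words D \<and> w \<in> free_words D"
  by (auto simp: free_words_def zero_list_def plus_list_def)

lemma free_ring_simps:
  "p \<in> carrier (free_ring D) \<longleftrightarrow> Poly_Mapping.keys p \<subseteq> free_words D"
  "\<zero>\<^bsub>free_ring D\<^esub> = 0" "\<one>\<^bsub>free_ring D\<^esub> = 1"
  "p \<oplus>\<^bsub>free_ring D\<^esub> q = p + q" "p \<otimes>\<^bsub>free_ring D\<^esub> q = p * q"
  by (simp_all add: free_ring_def)

lemma free_ring_closed:
  assumes "p \<in> carrier (free_ring D)" "q \<in> carrier (free_ring D)"
  shows "p + q \<in> carrier (free_ring D)" "p - q \<in> carrier (free_ring D)"
    "- p \<in> carrier (free_ring D)" "p * q \<in> carrier (free_ring D)"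
proof -
  note p = assms(1)[unfolded free_ring_simps(1)] and q = assms(2)[unfolded free_ring_simps(1)]
  show "p + q \<in> carrier (free_ring D)" "p - q \<in> carrier (free_ring D)"
    "- p \<in> carrier (free_ring D)"
    using p q keys_add[of p q] keys_diff[of p q] unfolding free_ring_simps(1) by auto
  show "p * q \<in> carrier (free_ring D)"
    using p q keys_mult[of p q] unfolding free_ring_simps(1) by (auto simp: free_words_simps(4) subset_iff)
qed

lemma word_in_free_ring: "word w \<in> carrier (free_ring D) \<longleftrightarrow> w \<in> free_words D"
  by (simp add: free_ring_simps)

lemma zero_in_free_ring: "0 \<in> carrier (free_ring D)"
  by (simp add: free_ring_simps)

lemma free_ring_is_ring: "ring (free_ring D)"
proof (rule ringI)
  show "abelian_group (free_ring D)"
  proof (rule abelian_groupI)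
    show "\<exists>q\<in>carrier (free_ring D). q \<oplus>\<^bsub>free_ring D\<^esub> p = \<zero>\<^bsub>free_ring D\<^esub>"
      if "p \<in> carrier (free_ring D)" for p
      using that by (intro bexI[of _ "- p"]) (simp_all add: free_ring_simps)
  qed (auto simp: free_ring_simps(2-) zero_in_free_ring add_ac intro: free_ring_closed)
  show "Group.monoid (free_ring D)"
    by (rule monoidI)
      (auto simp: free_ring_simps(2-) mult.assoc intro: free_ring_closed,
       simp add: free_ring_simps free_words_simps)
qed (simp_all add: free_ring_simps(2-) algebra_simps)

lemma free_ring_minus:
  assumes "p \<in> carrier (free_ring D)"
  shows "\<ominus>\<^bsub>free_ring D\<^esub> p = - p"
proof -
  interpret F: ring "free_ring D" by (rule free_ring_is_ring)
  show ?thesis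
    by (rule F.minus_equality) (use assms in \<open>simp_all add: free_ring_simps\<close>)
qed

lemma word_mult: "word v * word w = word (v + w)"
  by (simp add: mult_single)

text \<open>Elements are integer combinations of words. Closure under differences covers negative
  coefficients as well, so scalar multiples never have to be treated.\<close>

lemma free_ring_induct [consumes 1, case_names zero word diff]:
  assumes p: "p \<in> carrier (free_ring D)" and "P 0" and "\<And>w. w \<in> free_words D \<Longrightarrow> P (word w)"
    and "\<And>p q. \<lbrakk>p \<in> carrier (free_ring D); q \<in> carrier (free_ring D); P p; P q\<rbrakk> \<Longrightarrow> P (p - q)"
  shows "P p"
proof -
  have "p \<in> carrier (free_ring D) \<and> P p"
  proof (rule frag_induction[where S = "free_words D"])
    show "Poly_Mapping.keys p \<subseteq> free_words D"
      using p by (simp add: free_ring_simps)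
  qed (use assms in \<open>auto simp: word_in_free_ring zero_in_free_ring intro: free_ring_closed\<close>)
  then show ?thesis by simp
qed

lemma ideal_free_ringI:
  assumes "I \<subseteq> carrier (free_ring D)" "0 \<in> I"
    and "\<And>p q. \<lbrakk>p \<in> I; q \<in> I\<rbrakk> \<Longrightarrow> p - q \<in> I"
    and "\<And>p q. \<lbrakk>p \<in> I; q \<in> carrier (free_ring D)\<rbrakk> \<Longrightarrow> q * p \<in> I \<and> p * q \<in> I"
  shows "ideal I (free_ring D)"
proof (rule idealI[OF free_ring_is_ring])
  interpret F: ring "free_ring D" by (rule free_ring_is_ring)
  have neg: "- p \<in> I" if "p \<in> I" for p
    using assms(3)[OF assms(2) that] by simp
  have add: "p + q \<in> I" if "p \<in> I" "q \<in> I" for p q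
    using assms(3)[OF that(1) neg[OF that(2)]] by simp
  show "subgroup I (add_monoid (free_ring D))"
  proof (rule F.add.subgroupI)
    show "\<ominus>\<^bsub>free_ring D\<^esub> p \<in> I" if "p \<in> I" for p
      using that assms(1) neg by (simp add: free_ring_minus subset_iff)
  qed (use assms add in \<open>auto simp: free_ring_simps(4)\<close>)
qed (use assms(4) in \<open>auto simp: free_ring_simps(5)\<close>)

lemma gwa_relations_closed:
  assumes "gwa_setup D"
  shows "gwa_relations D \<subseteq> carrier (free_ring D)"
proof -
  interpret gwa_setup D by fact
  show ?thesis
    unfolding gwa_relations_def
    by (auto simp: word_in_free_ring free_words_simps sigpow_closed sig_closed telt_closed
        intro!: free_ring_closed imageI)
qed

lemma gwa_ideal_is_ideal:
  assumes "gwa_setup D"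
  shows "ideal (gwa_ideal D) (free_ring D)"
  unfolding gwa_ideal_def
  by (rule ring.genideal_ideal[OF free_ring_is_ring gwa_relations_closed[OF assms]])

lemma gwa_ideal_minimal:
  assumes "ideal I (free_ring D)" "gwa_relations D \<subseteq> I"
  shows "gwa_ideal D \<subseteq> I"
  unfolding gwa_ideal_def by (rule ring.genideal_minimal[OF free_ring_is_ring assms])

lemma gwa_class_mem_iff:
  "q \<in> gwa_class D p \<longleftrightarrow> q - p \<in> gwa_ideal D"
proof -
  have "q \<in> gwa_class D p \<longleftrightarrow> (\<exists>i\<in>gwa_ideal D. q = i + p)"
    by (simp add: gwa_class_def a_r_coset_def r_coset_def free_ring_simps)
  then show ?thesis by (metis add_diff_cancel diff_add_cancel)
qed

lemma gwa_simps:
  assumes "gwa_setup D" "p \<in> carrier (free_ring D)" "q \<in> carrier (free_ring D)"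
  shows "gwa_class D p \<oplus>\<^bsub>gwa D\<^esub> gwa_class D q = gwa_class D (p + q)"
    "gwa_class D p \<otimes>\<^bsub>gwa D\<^esub> gwa_class D q = gwa_class D (p * q)"
  using ideal.a_rcos_sum[OF gwa_ideal_is_ideal[OF assms(1)] assms(2,3)]
    ideal.rcoset_mult_add[OF gwa_ideal_is_ideal[OF assms(1)] assms(2,3)]
  by (simp_all add: gwa_def gwa_class_def FactRing_def free_ring_simps)

lemma gwa_one: "\<one>\<^bsub>gwa D\<^esub> = gwa_class D 1"
  by (simp add: gwa_def gwa_class_def FactRing_def free_ring_simps)

lemma carrier_gwa: "carrier (gwa D) = gwa_class D ` carrier (free_ring D)"
  by (auto simp: gwa_def gwa_class_def FactRing_def A_RCOSETS_def')

lemma gwa_is_ring: "gwa_setup D \<Longrightarrow> ring (gwa D)"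
  unfolding gwa_def by (rule ideal.quotient_is_ring[OF gwa_ideal_is_ideal])

text \<open>\<open>gwa_module\<close> lets a coset act through a representative picked by Hilbert
  choice. These two facts are all that is known about it.\<close>

lemma some_class_rep:
  assumes "gwa_setup D" "p \<in> carrier (free_ring D)"
  shows "(SOME q. q \<in> gwa_class D p) \<in> carrier (free_ring D)"
    "(SOME q. q \<in> gwa_class D p) - p \<in> gwa_ideal D"
proof -
  interpret I: ideal "gwa_ideal D" "free_ring D" by (rule gwa_ideal_is_ideal[OF assms(1)])
  have "p \<in> gwa_class D p"
    using additive_subgroup.zero_closed[OF I.is_additive_subgroup]
    by (simp add: gwa_class_mem_iff free_ring_simps(2))
  then show *: "(SOME q. q \<in> gwa_class D p) - p \<in> gwa_ideal D"
    by (metis gwa_class_mem_iff someI)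
  show "(SOME q. q \<in> gwa_class D p) \<in> carrier (free_ring D)"
    using free_ring_closed(1)[OF I.a_Hcarr[OF *] assms(2)] by simp
qed

section \<open>The involution on the free ring\<close>

lemma free_star_eq_frag_extend:
  "free_star D p = frag_extend (\<lambda>w. word (rev (map (gen_star D) w))) p"
proof -
  have "Poly_Mapping.single a c = frag_cmul c (word a)" for a :: "'a gen list" and c
    by (rule poly_mapping_eqI) (simp add: lookup_single when_def del: lookup_frag_of)
  then show ?thesis unfolding free_star_def frag_extend_def by (intro sum.cong refl)
qed

lemma free_star_word: "free_star D (word w) = word (rev (map (gen_star D) w))"
  by (simp add: free_star_eq_frag_extend)

lemma free_star_diff: "free_star D (p - q) = free_star D p - free_star D q"
  by (simp add: free_star_eq_frag_extend frag_extend_diff)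

lemma free_star_add: "free_star D (p + q) = free_star D p + free_star D q"
  by (simp add: free_star_eq_frag_extend frag_extend_add)

lemma free_star_zero: "free_star D 0 = 0"
  by (simp add: free_star_eq_frag_extend)

text \<open>Reversal of words reverses concatenation. Both sides are biadditive, so the claim
  reduces to words, first in the right factor and then in the left one.\<close>

lemma free_star_mult: "free_star D (p * q) = free_star D q * free_star D p"
proof -
  have w: "free_star D (word w * q) = free_star D q * free_star D (word w)" for w q
    by (induction q rule: frag_induction[OF subset_UNIV])
      (simp_all add: free_star_zero word_mult free_star_word free_star_diff algebra_simps,
       simp add: plus_list_def)
  show ?thesis
    by (induction p rule: frag_induction[OF subset_UNIV])
      (simp_all add: free_star_zero w free_star_diff algebra_simps)
qed

lemma free_star_closed:
  assumes "gwa_setup D" "p \<in> carrier (free_ring D)"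
  shows "free_star D p \<in> carrier (free_ring D)"
  using assms(2)
proof (induction rule: free_ring_induct)
  case (word w)
  interpret gwa_setup D by fact
  have "g \<in> Coef ` carrier D \<union> {GX, GY} \<Longrightarrow> gen_star D g \<in> Coef ` carrier D \<union> {GX, GY}" for g
    by (auto simp: bar_closed)
  then have "rev (map (gen_star D) w) \<in> free_words D"
    using word by (auto simp: free_words_def in_lists_conv_set)
  then show ?case by (simp add: free_star_word word_in_free_ring)
qed (simp_all add: free_star_zero free_star_diff zero_in_free_ring free_ring_closed)

section \<open>Representations of the generalized Weyl algebra\<close>

text \<open>The assumptions are the relations of the algebra read as identities between operators.
  The relations among the \<open>Coef\<close> letters are already contained in the module axioms
  over R.\<close>

locale gwa_rep = gwa_setup D + Mod: module D M for D :: "'a gwa_datum" and M :: "('a, 'v) module" +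
  fixes x y :: "'v \<Rightarrow> 'v"
  assumes x_closed: "v \<in> carrier M \<Longrightarrow> x v \<in> carrier M"
    and y_closed: "v \<in> carrier M \<Longrightarrow> y v \<in> carrier M"
    and x_add: "\<lbrakk>v \<in> carrier M; w \<in> carrier M\<rbrakk> \<Longrightarrow> x (v \<oplus>\<^bsub>M\<^esub> w) = x v \<oplus>\<^bsub>M\<^esub> x w"
    and y_add: "\<lbrakk>v \<in> carrier M; w \<in> carrier M\<rbrakk> \<Longrightarrow> y (v \<oplus>\<^bsub>M\<^esub> w) = y v \<oplus>\<^bsub>M\<^esub> y w"
    and yx: "v \<in> carrier M \<Longrightarrow> y (x v) = telt D \<odot>\<^bsub>M\<^esub> v"
    and xy: "v \<in> carrier M \<Longrightarrow> x (y v) = sig D (telt D) \<odot>\<^bsub>M\<^esub> v"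
    and x_smult: "\<lbrakk>r \<in> carrier D; v \<in> carrier M\<rbrakk> \<Longrightarrow> x (r \<odot>\<^bsub>M\<^esub> v) = sig D r \<odot>\<^bsub>M\<^esub> x v"
    and y_smult: "\<lbrakk>r \<in> carrier D; v \<in> carrier M\<rbrakk> \<Longrightarrow> y (r \<odot>\<^bsub>M\<^esub> v) = sigpow D (- 1) r \<odot>\<^bsub>M\<^esub> y v"
begin

abbreviation "act \<equiv> free_action M x y"
abbreviation "wact \<equiv> foldr (gen_action M x y)"

lemma wact_closed: "\<lbrakk>w \<in> free_words D; v \<in> carrier M\<rbrakk> \<Longrightarrow> wact w v \<in> carrier M"
  by (induction w) (auto simp: free_words_simps x_closed y_closed)

lemma wact_add: "\<lbrakk>w \<in> free_words D; u \<in> carrier M; v \<in> carrier M\<rbrakk> \<Longrightarrow>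
    wact w (u \<oplus>\<^bsub>M\<^esub> v) = wact w u \<oplus>\<^bsub>M\<^esub> wact w v"
  by (induction w) (auto simp: free_words_simps x_add y_add Mod.smult_r_distr wact_closed)

lemma act_closed: "\<lbrakk>p \<in> carrier (free_ring D); v \<in> carrier M\<rbrakk> \<Longrightarrow> act p v \<in> carrier M"
  unfolding free_action_def
  by (rule Mod.M.finsum_closed) (auto simp: free_ring_simps intro!:  wact_closed)

text \<open>Words with coefficient 0 contribute nothing. This allows \<open>p\<close>,
  \<open>q\<close> and \<open>p + q\<close> to be summed over one common index set, although
  cancellation may shrink the support of \<open>p + q\<close>.\<close>

lemma act_superset:
  assumes "p \<in> carrier (free_ring D)" "v \<in> carrier M"
    and "finite K" "Poly_Mapping.keys p \<subseteq> K" "K \<subseteq> free_words D"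
  shows "act p v = (\<Oplus>\<^bsub>M\<^esub>w\<in>K. add_pow M (Poly_Mapping.lookup p w) (wact w v))"
  unfolding free_action_def
proof (rule Mod.M.add.finprod_mono_neutral_cong_left[OF assms(3,4)])
  show "add_pow M (Poly_Mapping.lookup p w) (wact w v) = \<zero>\<^bsub>M\<^esub>" if "w \<in> K - Poly_Mapping.keys p" for w
    using that by (simp add: in_keys_iff add_pow_def)
qed (use assms in \<open>auto intro!:  wact_closed\<close>)

lemma act_word: "\<lbrakk>w \<in> free_words D; v \<in> carrier M\<rbrakk> \<Longrightarrow> act (word w) v = wact w v"
  by (simp add: free_action_def wact_closed)

lemma act_zero: "act 0 v = \<zero>\<^bsub>M\<^esub>"
  by (simp add: free_action_def)

lemma act_add:
  assumes p: "p \<in> carrier (free_ring D)" and q: "q \<in> carrier (free_ring D)" and v: "v \<in> carrier M"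
  shows "act (p + q) v = act p v \<oplus>\<^bsub>M\<^esub> act q v"
proof -
  let ?K = "Poly_Mapping.keys p \<union> Poly_Mapping.keys q"
  have K: "finite ?K" "?K \<subseteq> free_words D"
    using p q by (auto simp: free_ring_simps)
  note cl = wact_closed[OF subsetD[OF K(2)] v]
  have "act (p + q) v = (\<Oplus>\<^bsub>M\<^esub>w\<in>?K. add_pow M (Poly_Mapping.lookup (p + q) w) (wact w v))"
    by (rule act_superset) (use K v p q keys_add[of p q] in \<open>auto intro: free_ring_closed\<close>)
  also have "\<dots> = (\<Oplus>\<^bsub>M\<^esub>w\<in>?K. add_pow M (Poly_Mapping.lookup p w) (wact w v) \<oplus>\<^bsub>M\<^esub>
      add_pow M (Poly_Mapping.lookup q w) (wact w v))"
    by (rule Mod.M.finsum_cong')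
      (auto simp: lookup_add Mod.M.add.int_pow_mult cl intro!: Mod.M.a_closed cl)
  also have "\<dots> = act p v \<oplus>\<^bsub>M\<^esub> act q v"
    using K p q v
    by (subst Mod.M.finsum_addf)
      (auto simp: act_superset[of _ v ?K] intro!:  cl)
  finally show ?thesis .
qed

lemma act_diff:
  assumes p: "p \<in> carrier (free_ring D)" and q: "q \<in> carrier (free_ring D)" and v: "v \<in> carrier M"
  shows "act (p - q) v = act p v \<ominus>\<^bsub>M\<^esub> act q v"
  using act_add[OF free_ring_closed(2)[OF p q] q v] act_closed[OF _ v] p q
  by (simp add: free_ring_closed Mod.M.minus_eq Mod.M.add.m_assoc Mod.M.r_neg)

lemma act_vadd:
  assumes "p \<in> carrier (free_ring D)" and u: "u \<in> carrier M" and v: "v \<in> carrier M"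
  shows "act p (u \<oplus>\<^bsub>M\<^esub> v) = act p u \<oplus>\<^bsub>M\<^esub> act p v"
  using assms(1)
proof (induction rule: free_ring_induct)
  case (diff p q)
  have "a \<oplus>\<^bsub>M\<^esub> b \<ominus>\<^bsub>M\<^esub> (c \<oplus>\<^bsub>M\<^esub> d) = (a \<ominus>\<^bsub>M\<^esub> c) \<oplus>\<^bsub>M\<^esub> (b \<ominus>\<^bsub>M\<^esub> d)"
    if "a \<in> carrier M" "b \<in> carrier M" "c \<in> carrier M" "d \<in> carrier M" for a b c d
    using that by (simp add: Mod.M.minus_eq Mod.M.minus_add Mod.M.add.m_ac)
  then show ?case using diff u v by (simp add: act_diff act_closed)
qed (use u v in \<open>simp_all add: act_zero act_word wact_add\<close>)

lemma act_vzero: "p \<in> carrier (free_ring D) \<Longrightarrow> act p \<zero>\<^bsub>M\<^esub> = \<zero>\<^bsub>M\<^esub>"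
  using act_vadd[of p "\<zero>\<^bsub>M\<^esub>" "\<zero>\<^bsub>M\<^esub>"] act_closed[of p "\<zero>\<^bsub>M\<^esub>"]
  by (metis Mod.M.add.l_cancel_one' Mod.M.l_zero Mod.M.zero_closed)

lemma act_vdiff:
  assumes p: "p \<in> carrier (free_ring D)" and u: "u \<in> carrier M" and v: "v \<in> carrier M"
  shows "act p (u \<ominus>\<^bsub>M\<^esub> v) = act p u \<ominus>\<^bsub>M\<^esub> act p v"
  using act_vadd[OF p Mod.M.minus_closed[OF u v] v] act_closed[OF p] u v
  by (simp add: Mod.M.minus_eq Mod.M.add.m_assoc Mod.M.l_neg Mod.M.r_neg)

text \<open>For two words, \<open>foldr\<close> turns concatenation into composition. The right
  factor is extended linearly first, the left one afterwards.\<close>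

lemma act_mult:
  assumes p: "p \<in> carrier (free_ring D)" and q: "q \<in> carrier (free_ring D)" and v: "v \<in> carrier M"
  shows "act (p * q) v = act p (act q v)"
proof -
  have w: "act (word w * q) v = act (word w) (act q v)" if w: "w \<in> free_words D" for w
    using q
  proof (induction rule: free_ring_induct)
    case zero
    then show ?case using w by (simp add: act_zero act_vzero word_in_free_ring)
  next
    case (word u)
    then have "w @ u \<in> free_words D"
      using w free_words_simps(4)[of w u D] by (simp add: plus_list_def)
    then show ?case using word w v by (simp add: word_mult act_word wact_closed plus_list_def)
  next
    case (diff p q)
    then show ?case using w v
      by (simp add: right_diff_distrib act_diff free_ring_closed word_in_free_ring act_vdiff act_closed)
  qed
  show ?thesis using p
  proof (induction rule: free_ring_induct)
    case (diff p' q')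
    then show ?case using q v
      by (simp add: left_diff_distrib act_diff free_ring_closed act_closed)
  qed (use w in \<open>simp_all add: act_zero\<close>)
qed

lemma act_one: "v \<in> carrier M \<Longrightarrow> act 1 v = v"
  using act_word[of 0 v] by (simp add: free_words_simps) (simp add: zero_list_def)

lemma act_relations:
  assumes "p \<in> gwa_relations D" "v \<in> carrier M"
  shows "act p v = \<zero>\<^bsub>M\<^esub>"
proof -
  have z: "act (a - b) v = \<zero>\<^bsub>M\<^esub>"
    if "a \<in> carrier (free_ring D)" "b \<in> carrier (free_ring D)" "act a v = act b v" for a b
    using act_diff[OF that(1,2) assms(2)] that(3) act_closed[OF that(2) assms(2)]
    by (simp add: Mod.M.minus_eq Mod.M.r_neg)
  show ?thesis
    using assms unfolding gwa_relations_def
    by (auto intro!: z free_ring_closed imageI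
        simp: word_in_free_ring free_words_simps sig_closed sigpow_closed telt_closed act_word act_add
          Mod.smult_l_distr Mod.smult_assoc1 yx xy x_smult y_smult)
qed

text \<open>The elements that act as zero form a two-sided ideal containing the relations, hence
  containing the ideal they generate. So the action descends to cosets.\<close>

lemma act_gwa_ideal:
  assumes "p \<in> gwa_ideal D" "v \<in> carrier M"
  shows "act p v = \<zero>\<^bsub>M\<^esub>"
proof -
  let ?I = "{p \<in> carrier (free_ring D). \<forall>v\<in>carrier M. act p v = \<zero>\<^bsub>M\<^esub>}"
  have "ideal ?I (free_ring D)"
    by (rule ideal_free_ringI)
      (auto simp: free_ring_closed zero_in_free_ring act_zero act_diff act_mult act_vzero act_closed
        Mod.M.minus_eq)
  then have "gwa_ideal D \<subseteq> ?I"
    by (rule gwa_ideal_minimal)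
      (use gwa_relations_closed[OF gwa_setup_axioms] act_relations in auto)
  then show ?thesis using assms by auto
qed

text \<open>The star maps the relations YX = t and XY = \<sigma>(t) to themselves, since t is fixed
  and bar commutes with \<sigma>. It exchanges the commutation rules of X and Y: Xr = \<sigma>(r)X
  becomes the rule for Y at the conjugate of \<sigma>(r). The product relation reverses its factors,
  which is harmless because R is commutative.\<close>

lemma act_star_relations:
  assumes "p \<in> gwa_relations D" "v \<in> carrier M"
  shows "act (free_star D p) v = \<zero>\<^bsub>M\<^esub>"
proof -
  have z: "act (a - b) v = \<zero>\<^bsub>M\<^esub>"
    if "a \<in> carrier (free_ring D)" "b \<in> carrier (free_ring D)" "act a v = act b v" for a b
    using act_diff[OF that(1,2) assms(2)] that(3) act_closed[OF that(2) assms(2)]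
    by (simp add: Mod.M.minus_eq Mod.M.r_neg)
  have s: "sigpow D (- 1) (bar D (sig D r)) = bar D r"
      "sig D (bar D (sigpow D (- 1) r)) = bar D r" if "r \<in> carrier D" for r
    using that by (simp_all add: sigpow_bar sig_bar sigpow_closed sig_closed)
      (simp_all add: sigpow_m1 isig_sig sig_isig)
  have s': "sigpow D (- 1) (sig D a) = a" if "a \<in> carrier D" for a
    using that by (simp add: sigpow_m1 isig_sig)
  show ?thesis
    using assms unfolding gwa_relations_def
    by (auto intro!: z free_ring_closed imageI
        simp: word_in_free_ring free_words_simps sig_closed sigpow_closed telt_closed bar_closed s'
          act_word act_add free_star_diff free_star_add free_star_word bar_telt s
          ring_hom_add[OF bar_hom] ring_hom_mult[OF bar_hom] ring_hom_one[OF bar_hom]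
          x_closed y_closed Mod.smult_l_distr yx xy x_smult y_smult m_comm sig_bar[symmetric]
          Mod.smult_assoc1[symmetric])
qed

text \<open>\<open>gwa_star\<close> is a direct image of a coset, of which again a representative is
  chosen. Two such representatives differ by the star of an element of the ideal. It is enough that
  this star acts as zero; whether it lies in the ideal never has to be decided.\<close>

lemma act_star_gwa_ideal:
  assumes "p \<in> gwa_ideal D" "v \<in> carrier M"
  shows "act (free_star D p) v = \<zero>\<^bsub>M\<^esub>"
proof -
  let ?I = "{p \<in> carrier (free_ring D). \<forall>v\<in>carrier M. act (free_star D p) v = \<zero>\<^bsub>M\<^esub>}"
  note cl = free_star_closed[OF gwa_setup_axioms]
  have "ideal ?I (free_ring D)"
    by (rule ideal_free_ringI)
      (auto simp: free_ring_closed cl zero_in_free_ring free_star_zero free_star_diff free_star_mult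
        act_zero act_diff act_mult act_vzero act_closed Mod.M.minus_eq)
  then have "gwa_ideal D \<subseteq> ?I"
    by (rule gwa_ideal_minimal)
      (use gwa_relations_closed[OF gwa_setup_axioms] act_star_relations in auto)
  then show ?thesis using assms by auto
qed

lemma gwa_module_smult:
  assumes "p \<in> carrier (free_ring D)" "v \<in> carrier M"
  shows "gwa_class D p \<odot>\<^bsub>gwa_module M x y\<^esub> v = act p v"
proof -
  let ?q = "SOME q. q \<in> gwa_class D p"
  note q = some_class_rep[OF gwa_setup_axioms assms(1)]
  have "act (?q - p + p) v = act p v"
    using q assms by (subst act_add) (auto simp: free_ring_closed act_gwa_ideal act_closed)
  then show ?thesis by (simp add: gwa_module_def)
qed

lemma gwa_module_star_smult:
  assumes "p \<in> carrier (free_ring D)" "v \<in> carrier M"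
  shows "gwa_star D (gwa_class D p) \<odot>\<^bsub>gwa_module M x y\<^esub> v = act (free_star D p) v"
proof -
  interpret I: ideal "gwa_ideal D" "free_ring D" by (rule gwa_ideal_is_ideal[OF gwa_setup_axioms])
  let ?q = "SOME q. q \<in> gwa_star D (gwa_class D p)"
  have "p \<in> gwa_class D p"
    using additive_subgroup.zero_closed[OF I.is_additive_subgroup]
    by (simp add: gwa_class_mem_iff free_ring_simps(2))
  then have "?q \<in> gwa_star D (gwa_class D p)"
    unfolding gwa_star_def by (meson imageI someI)
  then obtain p' where p': "?q = free_star D p'" "p' - p \<in> gwa_ideal D"
    by (auto simp: gwa_star_def gwa_class_mem_iff)
  have "?q = free_star D (p' - p) + free_star D p"
    by (simp add: p' free_star_diff)
  then have "act ?q v = act (free_star D p) v"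
    using p'(2) assms I.a_Hcarr[OF p'(2)] free_star_closed[OF gwa_setup_axioms]
    by (simp add: act_add act_star_gwa_ideal act_closed)
  then show ?thesis by (simp add: gwa_module_def)
qed

lemma gwa_module_simps:
  "carrier (gwa_module M x y) = carrier M" "\<zero>\<^bsub>gwa_module M x y\<^esub> = \<zero>\<^bsub>M\<^esub>"
  "v \<oplus>\<^bsub>gwa_module M x y\<^esub> w = v \<oplus>\<^bsub>M\<^esub> w"
  by (simp_all add: gwa_module_def)

lemma gwa_module_gens:
  assumes "v \<in> carrier M"
  shows "r \<in> carrier D \<Longrightarrow> gwa_coef D r \<odot>\<^bsub>gwa_module M x y\<^esub> v = r \<odot>\<^bsub>M\<^esub> v"
    "gwa_X D \<odot>\<^bsub>gwa_module M x y\<^esub> v = x v" "gwa_Y D \<odot>\<^bsub>gwa_module M x y\<^esub> v = y v"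
  using assms by (simp_all add: gwa_module_smult word_in_free_ring free_words_simps act_word)

lemma left_module_gwa_module: "left_module (gwa D) (gwa_module M x y)"
proof -
  interpret A: ring "gwa D" by (rule gwa_is_ring[OF gwa_setup_axioms])
  have one: "1 \<in> carrier (free_ring D)"
    by (simp add: free_ring_simps free_words_simps)
  have "abelian_group (gwa_module M x y)"
  proof (rule abelian_groupI)
    show "\<exists>w\<in>carrier (gwa_module M x y). w \<oplus>\<^bsub>gwa_module M x y\<^esub> v = \<zero>\<^bsub>gwa_module M x y\<^esub>"
      if "v \<in> carrier (gwa_module M x y)" for v
      using that by (intro bexI[of _ "\<ominus>\<^bsub>M\<^esub> v"]) (simp_all add: gwa_module_simps Mod.M.l_neg)
  qed (auto simp: gwa_module_simps Mod.M.add.m_ac)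
  then show ?thesis
    by (intro left_module.intro A.ring_axioms left_module_axioms.intro)
      (auto simp: carrier_gwa gwa_module_simps gwa_module_smult act_closed gwa_simps[OF gwa_setup_axioms]
        act_add act_vadd act_mult free_ring_closed gwa_one one act_one)
qed

lemma submodule_gwa_module:
  assumes H: "H \<subseteq> carrier M" "\<zero>\<^bsub>M\<^esub> \<in> H" "\<And>v w. \<lbrakk>v \<in> H; w \<in> H\<rbrakk> \<Longrightarrow> v \<oplus>\<^bsub>M\<^esub> w \<in> H"
    and Hr: "\<And>r v. \<lbrakk>r \<in> carrier D; v \<in> H\<rbrakk> \<Longrightarrow> r \<odot>\<^bsub>M\<^esub> v \<in> H"
    and Hx: "\<And>v. v \<in> H \<Longrightarrow> x v \<in> H" and Hy: "\<And>v. v \<in> H \<Longrightarrow> y v \<in> H"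
  shows "submodule H (gwa D) (gwa_module M x y)"
proof (rule submodule.intro)
  \<comment> \<open>Negatives come from the action of -1 in R, so closure under sums and under R
    already gives a subgroup.\<close>
  have neg: "\<ominus>\<^bsub>M\<^esub> v \<in> H" if "v \<in> H" for v
    using Hr[of "\<ominus>\<^bsub>D\<^esub> \<one>\<^bsub>D\<^esub>" v] that H(1) Mod.smult_l_minus[of "\<one>\<^bsub>D\<^esub>" v] by auto
  have "subgroup H (add_monoid M)"
    by (rule Mod.M.add.subgroupI) (use H neg in \<open>auto simp: a_inv_def\<close>)
  then show "subgroup H (add_monoid (gwa_module M x y))"
    by (simp add: gwa_module_def subgroup_def m_inv_def)
  have w: "wact w v \<in> H" if "w \<in> free_words D" "v \<in> H" for w v
    using that by (induction w) (auto simp: free_words_simps Hr Hx Hy)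
  have "act p v \<in> H" if "p \<in> carrier (free_ring D)" "v \<in> H" for p v
    using that(1)
  proof (induction rule: free_ring_induct)
    case (diff p q)
    then show ?case using that(2) H neg by (auto simp: act_diff Mod.M.minus_eq subset_iff)
  qed (use that(2) H w in \<open>auto simp: act_zero act_word\<close>)
  then show "submodule_axioms H (gwa D) (gwa_module M x y)"
    using H(1) by unfold_locales (auto simp: carrier_gwa gwa_module_smult subset_iff)
qed

end

text \<open>Transport of structure along a bijection \<open>g\<close>: no closure property of the target's
  operations is assumed, since they are read off from those of the source.\<close>

lemma gwa_rep_transport:
  fixes N :: "('a, 'w) module"
  assumes rep: "gwa_rep D M x y" and bij: "bij_betw g (carrier M) (carrier N)"
    and gz: "g \<zero>\<^bsub>M\<^esub> = \<zero>\<^bsub>N\<^esub>"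
    and gadd: "\<And>v w. \<lbrakk>v \<in> carrier M; w \<in> carrier M\<rbrakk> \<Longrightarrow> g (v \<oplus>\<^bsub>M\<^esub> w) = g v \<oplus>\<^bsub>N\<^esub> g w"
    and gsm: "\<And>r v. \<lbrakk>r \<in> carrier D; v \<in> carrier M\<rbrakk> \<Longrightarrow> g (r \<odot>\<^bsub>M\<^esub> v) = r \<odot>\<^bsub>N\<^esub> g v"
    and gx: "\<And>v. v \<in> carrier M \<Longrightarrow> g (x v) = x' (g v)"
    and gy: "\<And>v. v \<in> carrier M \<Longrightarrow> g (y v) = y' (g v)"
  shows "gwa_rep D N x' y'"
    and "left_modules_iso (gwa D) (gwa_module N x' y') (gwa_module M x y)"
proof -
  interpret gwa_rep D M x y by (rule rep)
  have N: "carrier N = g ` carrier M" using bij by (simp add: bij_betw_def)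
  \<comment> \<open>Every element of the target is some \<open>g v\<close>. Read from right to left,
    the compatibilities turn an identity in the target into the image of one in the source.\<close>
  note pull = gadd[symmetric] gsm[symmetric] gx[symmetric] gy[symmetric] gz[symmetric]
  show rep': "gwa_rep D N x' y'"
  proof (intro gwa_rep.intro gwa_setup_axioms moduleI gwa_rep_axioms.intro is_cring)
    show "abelian_group N"
    proof (rule abelian_groupI)
      show "\<exists>w\<in>carrier N. w \<oplus>\<^bsub>N\<^esub> u = \<zero>\<^bsub>N\<^esub>" if "u \<in> carrier N" for u
      proof -
        from that obtain v where v: "v \<in> carrier M" "u = g v" by (auto simp: N)
        show ?thesis
          by (rule bexI[of _ "g (\<ominus>\<^bsub>M\<^esub> v)"]) (use v in \<open>simp_all add: N pull Mod.M.l_neg\<close>)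
      qed
    qed (auto simp: N pull Mod.M.add.m_ac)
  qed (auto simp: N pull x_closed y_closed Mod.smult_l_distr Mod.smult_r_distr Mod.smult_assoc1 x_add y_add
      yx xy x_smult y_smult telt_closed sig_closed sigpow_closed)
  interpret N: gwa_rep D N x' y' by (rule rep')
  have w: "g (wact w v) = N.wact w (g v) \<and> wact w v \<in> carrier M"
    if "w \<in> free_words D" "v \<in> carrier M" for w v
    using that
    by (induction w) (auto simp: free_words_simps gsm gx gy x_closed y_closed)
  have act: "g (act p v) = N.act p (g v)" if p: "p \<in> carrier (free_ring D)" and v: "v \<in> carrier M" for p v
    using p
  proof (induction rule: free_ring_induct)
    case (diff p q)
    have gm: "g (a \<ominus>\<^bsub>M\<^esub> b) = g a \<ominus>\<^bsub>N\<^esub> g b" if "a \<in> carrier M" "b \<in> carrier M" for a b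
    proof -
      have "g (a \<ominus>\<^bsub>M\<^esub> b) \<oplus>\<^bsub>N\<^esub> g b = g a"
        using that by (simp add: pull Mod.M.minus_eq Mod.M.add.m_assoc Mod.M.l_neg Mod.M.r_neg)
      moreover have "g (a \<ominus>\<^bsub>M\<^esub> b) \<in> carrier N" "g a \<in> carrier N" "g b \<in> carrier N"
        using that by (auto simp: N)
      ultimately show ?thesis
        by (metis N.Mod.M.add.inv_solve_right' N.Mod.M.minus_eq)
    qed
    show ?case using diff v
      by (simp add: act_diff N.act_diff gm act_closed N)
  qed (use v w in \<open>simp_all add: act_zero N.act_zero gz act_word N.act_word N\<close>)
  define h where "h = inv_into (carrier M) g"
  have h: "bij_betw h (carrier N) (carrier M)"
    unfolding h_def by (rule bij_betw_inv_into[OF bij])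
  have hg: "h (g v) = v" if "v \<in> carrier M" for v
    unfolding h_def using bij that by (simp add: bij_betw_def)
  show "left_modules_iso (gwa D) (gwa_module N x' y') (gwa_module M x y)"
    unfolding left_modules_iso_def
  proof (intro conjI left_module_gwa_module N.left_module_gwa_module exI[of _ h])
    show "bij_betw h (carrier (gwa_module N x' y')) (carrier (gwa_module M x y))"
      by (simp add: h gwa_module_simps N.gwa_module_simps)
  qed (auto simp: gwa_module_simps N.gwa_module_simps N pull hg carrier_gwa
      gwa_module_smult N.gwa_module_smult act[symmetric] act_closed)
qed

section \<open>Residue fields along a real orbit\<close>

context gwa_setup
begin

lemma sigpow_neg_cancel:
  "r \<in> carrier D \<Longrightarrow> sigpow D (- k) (sigpow D k r) = r"
  "r \<in> carrier D \<Longrightarrow> sigpow D k (sigpow D (- k) r) = r"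
  by (simp_all add: sigpow_0 flip: sigpow_add)

lemma shift_0: "U \<subseteq> carrier D \<Longrightarrow> shift D 0 U = U"
  by (simp add: shift_def sigpow_0 image_def)

lemma shift_shift: "U \<subseteq> carrier D \<Longrightarrow> shift D j (shift D k U) = shift D (j + k) U"
  by (force simp: shift_def image_image sigpow_add subset_iff)

text \<open>The image under a power of the automorphism is the preimage under the inverse power, and
  preimages of ideals are ideals.\<close>

lemma shift_ideal:
  assumes "ideal n D"
  shows "ideal (shift D k n) D"
proof -
  interpret n: ideal n D by fact
  have "ring_hom_ring D D (sigpow D (- k))"
    by (rule ring_hom_ringI2[OF ring_axioms ring_axioms sigpow_hom])
  then have "ideal {r \<in> carrier D. sigpow D (- k) r \<in> n} D"
    using ring_hom_ring.ideal_vimage[OF _ assms] by blast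
  moreover have "{r \<in> carrier D. sigpow D (- k) r \<in> n} = shift D k n"
    using n.a_subset
    by (auto simp: shift_def subset_iff image_iff sigpow_neg_cancel sigpow_closed)
      (metis sigpow_neg_cancel(2))
  ultimately show ?thesis by simp
qed

lemma shift_carrier: "shift D k (carrier D) = carrier D"
  using sigpow_iso[of k] by (simp add: shift_def ring_iso_def bij_betw_def)

text \<open>An ideal above the shifted one is shifted back, where maximality of \<open>m\<close>
  decides it, and then shifted forward again.\<close>

lemma shift_maximalideal:
  assumes "maximalideal m D"
  shows "maximalideal (shift D k m) D"
proof -
  interpret m: maximalideal m D by fact
  show ?thesis
  proof (rule maximalidealI[OF shift_ideal[OF m.is_ideal]])
    show "carrier D \<noteq> shift D k m"
      using m.I_notcarr shift_carrier[of "- k"] shift_shift[OF m.a_subset, of "- k" k]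
        shift_0[OF m.a_subset] by auto
    fix J assume J: "ideal J D" "shift D k m \<subseteq> J" "J \<subseteq> carrier D"
    have "shift D (- k) (shift D k m) \<subseteq> shift D (- k) J"
      using J(2) by (auto simp: shift_def)
    then have "m \<subseteq> shift D (- k) J"
      by (simp add: shift_shift[OF m.a_subset] shift_0[OF m.a_subset])
    moreover have "shift D (- k) J \<subseteq> carrier D"
      using shift_ideal[OF J(1), of "- k"] by (simp add: additive_subgroup.a_subset ideal.axioms(1))
    ultimately have "shift D (- k) J = m \<or> shift D (- k) J = carrier D"
      using m.I_maximal[OF shift_ideal[OF J(1)]] by blast
    then have "shift D k (shift D (- k) J) = shift D k m \<or> shift D k (shift D (- k) J) = carrier D"
      using shift_carrier by metis
    then show "J = shift D k m \<or> J = carrier D"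
      by (simp add: shift_shift[OF J(3)] shift_0[OF J(3)])
  qed
qed

lemma coset_carrier_iff:
  "a \<in> carrier (D Quot n) \<longleftrightarrow> (\<exists>r\<in>carrier D. a = n +>\<^bsub>D\<^esub> r)"
  by (auto simp: FactRing_def A_RCOSETS_def')

lemma coset_in_carrier: "r \<in> carrier D \<Longrightarrow> n +>\<^bsub>D\<^esub> r \<in> carrier (D Quot n)"
  by (auto simp: coset_carrier_iff)

text \<open>The zero of R/n is the coset n itself. Hence, throughout, \<open>f n = n\<close> says
  that the n-component of \<open>f\<close> vanishes, and n serves as the default value of a
  component.\<close>

lemma Quot_zero: "\<zero>\<^bsub>D Quot n\<^esub> = n" and Quot_one: "\<one>\<^bsub>D Quot n\<^esub> = n +>\<^bsub>D\<^esub> \<one>\<^bsub>D\<^esub>"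
  by (simp_all add: FactRing_def)

lemma coset_arith:
  assumes "ideal n D" "r \<in> carrier D" "s \<in> carrier D"
  shows "(n +>\<^bsub>D\<^esub> r) \<oplus>\<^bsub>D Quot n\<^esub> (n +>\<^bsub>D\<^esub> s) = n +>\<^bsub>D\<^esub> (r \<oplus>\<^bsub>D\<^esub> s)"
    "(n +>\<^bsub>D\<^esub> r) \<otimes>\<^bsub>D Quot n\<^esub> (n +>\<^bsub>D\<^esub> s) = n +>\<^bsub>D\<^esub> (r \<otimes>\<^bsub>D\<^esub> s)"
  using ideal.a_rcos_sum[OF assms] ideal.rcoset_mult_add[OF assms] by (simp_all add: FactRing_def)

lemma coset_zero_iff:
  assumes "ideal n D" "r \<in> carrier D"
  shows "n +>\<^bsub>D\<^esub> r = n \<longleftrightarrow> r \<in> n"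
  using ideal.rcos_const_imp_mem[OF assms] a_rcos_zero[OF assms(1)] by blast

lemma Quot_subset:
  assumes "ideal n D" "a \<in> carrier (D Quot n)"
  shows "a \<subseteq> carrier D"
proof -
  interpret ideal n D by fact
  show ?thesis using assms(2) a_r_coset_subset_G[OF a_subset] by (auto simp: coset_carrier_iff)
qed

lemma shift_coset:
  assumes "ideal n D" "r \<in> carrier D"
  shows "shift D k (n +>\<^bsub>D\<^esub> r) = shift D k n +>\<^bsub>D\<^esub> sigpow D k r"
proof -
  interpret ideal n D by fact
  show ?thesis unfolding shift_def by (rule a_coset_hom(2)[OF sigpow_hom a_subset assms(2)])
qed

lemma shift_Quot:
  assumes "ideal n D" "a \<in> carrier (D Quot n)" "b \<in> carrier (D Quot n)"
  shows "shift D k a \<in> carrier (D Quot shift D k n)"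
    "shift D k (a \<oplus>\<^bsub>D Quot n\<^esub> b) = shift D k a \<oplus>\<^bsub>D Quot shift D k n\<^esub> shift D k b"
    "shift D k (a \<otimes>\<^bsub>D Quot n\<^esub> b) = shift D k a \<otimes>\<^bsub>D Quot shift D k n\<^esub> shift D k b"
proof -
  obtain r s where "r \<in> carrier D" "a = n +>\<^bsub>D\<^esub> r" "s \<in> carrier D" "b = n +>\<^bsub>D\<^esub> s"
    using assms(2,3) by (auto simp: coset_carrier_iff)
  then show "shift D k a \<in> carrier (D Quot shift D k n)"
    "shift D k (a \<oplus>\<^bsub>D Quot n\<^esub> b) = shift D k a \<oplus>\<^bsub>D Quot shift D k n\<^esub> shift D k b"
    "shift D k (a \<otimes>\<^bsub>D Quot n\<^esub> b) = shift D k a \<otimes>\<^bsub>D Quot shift D k n\<^esub> shift D k b"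
    using assms(1) shift_ideal[OF assms(1), of k]
    by (simp_all add: shift_coset coset_in_carrier coset_arith sigpow_closed
        ring_hom_add[OF sigpow_hom] ring_hom_mult[OF sigpow_hom])
qed

end

locale gwa_orbit = gwa_setup D for D :: "'a gwa_datum" +
  fixes \<omega> :: "'a set set"
  assumes orbit: "\<omega> \<in> gwa_orbits D"
    and infinite_orbit: "infinite \<omega>"
    and real: "real_orbit D \<omega>"
begin

lemma orbit_maximal: "n \<in> \<omega> \<Longrightarrow> maximalideal n D"
  using orbit by (auto simp: gwa_orbits_def Max_ideals_def shift_maximalideal)

lemma orbit_ideal: "n \<in> \<omega> \<Longrightarrow> ideal n D"
  using orbit_maximal by (simp add: maximalideal.axioms(1))

lemma orbit_subset: "n \<in> \<omega> \<Longrightarrow> n \<subseteq> carrier D"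
  using orbit_ideal by (simp add: additive_subgroup.a_subset ideal.axioms(1))

lemma orbit_prime: "n \<in> \<omega> \<Longrightarrow> primeideal n D"
  by (rule maximalideal_prime[OF orbit_maximal])

lemma orbit_shift_shift: "n \<in> \<omega> \<Longrightarrow> shift D j (shift D k n) = shift D (j + k) n"
  by (rule shift_shift[OF orbit_subset])

lemma orbit_shift_0: "n \<in> \<omega> \<Longrightarrow> shift D 0 n = n"
  by (rule shift_0[OF orbit_subset])

text \<open>Any member of the orbit can serve as its base point, not only the one that the orbit was
  formed from.\<close>

lemma orbit_range: "n \<in> \<omega> \<Longrightarrow> \<omega> = range (\<lambda>k. shift D k n)"
proof -
  assume n: "n \<in> \<omega>"
  obtain m where m: "maximalideal m D" "\<omega> = range (\<lambda>k. shift D k m)"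
    using orbit by (auto simp: gwa_orbits_def Max_ideals_def)
  have "m \<subseteq> carrier D" using m(1) by (simp add: maximalideal.axioms(1) additive_subgroup.a_subset ideal.axioms(1))
  note sh = shift_shift[OF this]
  obtain j where "n = shift D j m" using m n by auto
  then have "shift D k n = shift D (k + j) m" "shift D k m = shift D (k - j) n" for k
    by (simp_all add: sh)
  then have "range (\<lambda>k. shift D k m) \<subseteq> range (\<lambda>k. shift D k n)" "range (\<lambda>k. shift D k n) \<subseteq> range (\<lambda>k. shift D k m)"
    by blast+
  then show ?thesis using m(2) by simp
qed

lemma orbit_shift: "n \<in> \<omega> \<Longrightarrow> shift D k n \<in> \<omega>"
  using orbit_range[of n] by (metis rangeI)

text \<open>The integers act freely: a coincidence would make the shift periodic on \<open>n\<close>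
  with period p = |j - k|, and the orbit would have at most p members.\<close>

lemma orbit_shift_inj:
  assumes n: "n \<in> \<omega>" and eq: "shift D j n = shift D k n"
  shows "j = k"
proof (rule ccontr)
  assume "j \<noteq> k"
  define p where "p = \<bar>j - k\<bar>"
  have "shift D (- k) (shift D j n) = n"
    unfolding eq using n by (simp add: orbit_shift_shift orbit_shift_0)
  moreover have "shift D (- j) (shift D k n) = n"
    unfolding eq[symmetric] using n by (simp add: orbit_shift_shift orbit_shift_0)
  ultimately have p: "shift D p n = n" "p > 0"
    using \<open>j \<noteq> k\<close> n by (auto simp: p_def abs_if orbit_shift_shift algebra_simps)
  \<comment> \<open>Multiples of the period fix n, so only the residue of the exponent modulo p
    matters.\<close>
  have mp: "shift D (p * i) n = n" for i
  proof (induction i rule: int_induct[where k = 0])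
    case (step1 i)
    then show ?case using p n orbit_shift_shift[of n "p * i" p] by (simp add: algebra_simps)
  next
    case (step2 i)
    have "shift D (p * i) n = shift D (p * (i - 1)) (shift D p n)"
      using n by (simp add: orbit_shift_shift algebra_simps)
    then show ?case using step2 p by simp
  qed (simp add: n orbit_shift_0)
  have "shift D i n = shift D (i mod p) n" for i
  proof -
    have "shift D i n = shift D (i mod p) (shift D (p * (i div p)) n)"
      using n by (simp add: orbit_shift_shift)
    then show ?thesis by (simp add: mp)
  qed
  then have "shift D i n \<in> (\<lambda>i. shift D i n) ` {0..<p}" for i
    using p(2) by (metis atLeastLessThan_iff image_eqI pos_mod_bound pos_mod_sign)
  then have "\<omega> \<subseteq> (\<lambda>i. shift D i n) ` {0..<p}"
    using orbit_range[OF n] by blast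
  then show False using infinite_orbit finite_surj by blast
qed

lemma bar_orbit: "n \<in> \<omega> \<Longrightarrow> bar D ` n = n"
  using real by (simp add: real_orbit_def)

lemma Quot_field: "n \<in> \<omega> \<Longrightarrow> field (D Quot n)"
  by (rule maximalideal.quotient_is_field[OF orbit_maximal is_cring])

lemma Quot_cring: "n \<in> \<omega> \<Longrightarrow> cring (D Quot n)"
  using Quot_field by (simp add: fieldE(1))

lemma Quot_ring: "n \<in> \<omega> \<Longrightarrow> ring (D Quot n)"
  using Quot_cring by (simp add: cring.axioms(1))

lemma bar_coset:
  assumes "n \<in> \<omega>" "r \<in> carrier D"
  shows "bar D ` (n +>\<^bsub>D\<^esub> r) = n +>\<^bsub>D\<^esub> bar D r"
  using a_coset_hom(2)[OF bar_hom orbit_subset[OF assms(1)] assms(2)] bar_orbit[OF assms(1)] by simp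

lemma bar_Quot:
  assumes "n \<in> \<omega>" "a \<in> carrier (D Quot n)" "b \<in> carrier (D Quot n)"
  shows "bar D ` a \<in> carrier (D Quot n)"
    "bar D ` (a \<oplus>\<^bsub>D Quot n\<^esub> b) = bar D ` a \<oplus>\<^bsub>D Quot n\<^esub> bar D ` b"
    "bar D ` (a \<otimes>\<^bsub>D Quot n\<^esub> b) = bar D ` a \<otimes>\<^bsub>D Quot n\<^esub> bar D ` b"
    "bar D ` bar D ` a = a"
    "bar D ` shift D k a = shift D k (bar D ` a)"
proof -
  obtain r s where r: "r \<in> carrier D" "a = n +>\<^bsub>D\<^esub> r" "s \<in> carrier D" "b = n +>\<^bsub>D\<^esub> s"
    using assms(2,3) by (auto simp: coset_carrier_iff)
  then show "bar D ` a \<in> carrier (D Quot n)"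
    "bar D ` (a \<oplus>\<^bsub>D Quot n\<^esub> b) = bar D ` a \<oplus>\<^bsub>D Quot n\<^esub> bar D ` b"
    "bar D ` (a \<otimes>\<^bsub>D Quot n\<^esub> b) = bar D ` a \<otimes>\<^bsub>D Quot n\<^esub> bar D ` b"
    "bar D ` bar D ` a = a"
    using orbit_ideal[OF assms(1)]
    by (simp_all add: coset_in_carrier coset_arith bar_closed bar_coset[OF assms(1)] bar_bar
        ring_hom_add[OF bar_hom] ring_hom_mult[OF bar_hom])
  have "a \<subseteq> carrier D" by (rule Quot_subset[OF orbit_ideal[OF assms(1)] assms(2)])
  then show "bar D ` shift D k a = shift D k (bar D ` a)"
    by (force simp: shift_def image_image sigpow_bar subset_iff)
qed

lemma coset_mult_zero_iff:
  assumes "n \<in> \<omega>" "r \<in> carrier D" "a \<in> carrier (D Quot n)"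
  shows "(n +>\<^bsub>D\<^esub> r) \<otimes>\<^bsub>D Quot n\<^esub> a = n \<longleftrightarrow> r \<in> n \<or> a = n"
proof -
  interpret K: field "D Quot n" by (rule Quot_field[OF assms(1)])
  show ?thesis
    using K.integral_iff[OF coset_in_carrier[OF assms(2)] assms(3)]
    by (simp add: Quot_zero coset_zero_iff[OF orbit_ideal[OF assms(1)] assms(2)])
qed

lemma shift_orbit_Quot:
  assumes "n \<in> \<omega>" "a \<in> carrier (D Quot n)"
  shows "shift D 0 a = a" "shift D j (shift D k a) = shift D (j + k) a"
    "shift D k a \<in> carrier (D Quot shift D k n)"
  using shift_0 shift_shift shift_Quot(1)[OF orbit_ideal[OF assms(1)] assms(2,2)]
    Quot_subset[OF orbit_ideal[OF assms(1)] assms(2)] by blast+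

end

section \<open>Direct sums of residue fields as modules over R\<close>

locale gwa_orbit_subset = gwa_orbit +
  fixes S
  assumes S_orbit: "S \<subseteq> \<omega>"
begin

lemma S_in: "n \<in> S \<Longrightarrow> n \<in> \<omega>"
  using S_orbit by auto

lemma one_Quot: "n \<in> S \<Longrightarrow> \<one>\<^bsub>D Quot n\<^esub> \<in> carrier (D Quot n)" "n \<in> S \<Longrightarrow> \<one>\<^bsub>D Quot n\<^esub> \<noteq> n"
  using ring.ring_simprules(6)[OF Quot_ring[OF S_in]]
    domain.one_not_zero[OF field.axioms(1)[OF Quot_field[OF S_in]]] by (auto simp: Quot_zero)

lemma res_sum_carrier_iff:
  "f \<in> carrier (res_sum D S) \<longleftrightarrow>
    f \<in> extensional S \<and> (\<forall>n\<in>S. f n \<in> carrier (D Quot n)) \<and> finite {n \<in> S. f n \<noteq> n}"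
proof -
  have "group (add_monoid (D Quot n))" if "n \<in> S" for n
    using abelian_group.a_group[OF ring.is_abelian_group[OF Quot_ring]] that S_orbit by auto
  then show ?thesis
    by (auto simp: res_sum_def carrier_sum_group Let_def PiE_iff Quot_zero)
qed

lemma res_sum_restrictI:
  assumes "\<And>n. n \<in> S \<Longrightarrow> f n \<in> carrier (D Quot n)" "finite {n \<in> S. f n \<noteq> n}"
  shows "(\<lambda>n\<in>S. f n) \<in> carrier (res_sum D S)"
proof -
  have "{n \<in> S. (\<lambda>n\<in>S. f n) n \<noteq> n} = {n \<in> S. f n \<noteq> n}" by auto
  then show ?thesis using assms by (simp add: res_sum_carrier_iff)
qed

lemma res_sum_simps:
  "\<zero>\<^bsub>res_sum D S\<^esub> = (\<lambda>n\<in>S. n)"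
  "f \<oplus>\<^bsub>res_sum D S\<^esub> g = (\<lambda>n\<in>S. f n \<oplus>\<^bsub>D Quot n\<^esub> g n)"
  "r \<odot>\<^bsub>res_sum D S\<^esub> f = (\<lambda>n\<in>S. (n +>\<^bsub>D\<^esub> r) \<otimes>\<^bsub>D Quot n\<^esub> f n)"
  by (simp_all add: res_sum_def Let_def Quot_zero)

lemma res_sum_carrierD:
  assumes "f \<in> carrier (res_sum D S)"
  shows "f \<in> extensional S" "n \<in> S \<Longrightarrow> f n \<in> carrier (D Quot n)" "finite {n \<in> S. f n \<noteq> n}"
  using assms by (auto simp: res_sum_carrier_iff)

lemma res_sum_zero_closed: "\<zero>\<^bsub>res_sum D S\<^esub> \<in> carrier (res_sum D S)"
  unfolding res_sum_simps
  by (rule res_sum_restrictI) (simp_all add: ring.ring_simprules(2)[OF Quot_ring[OF S_in], unfolded Quot_zero])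

lemma res_sum_closed:
  assumes f: "f \<in> carrier (res_sum D S)" and g: "g \<in> carrier (res_sum D S)" and r: "r \<in> carrier D"
  shows "f \<oplus>\<^bsub>res_sum D S\<^esub> g \<in> carrier (res_sum D S)"
    "r \<odot>\<^bsub>res_sum D S\<^esub> f \<in> carrier (res_sum D S)"
proof -
  note K = ring.ring_simprules[OF Quot_ring[OF S_in], unfolded Quot_zero]
  have "finite ({n \<in> S. f n \<noteq> n} \<union> {n \<in> S. g n \<noteq> n})"
    using f g by (simp add: res_sum_carrierD)
  then have "finite {n \<in> S. f n \<oplus>\<^bsub>D Quot n\<^esub> g n \<noteq> n}"
    by (rule rev_finite_subset) (auto simp: K)
  then show "f \<oplus>\<^bsub>res_sum D S\<^esub> g \<in> carrier (res_sum D S)"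
    unfolding res_sum_simps by (rule res_sum_restrictI[rotated]) (use f g in \<open>simp add: res_sum_carrierD K\<close>)
  have "{n \<in> S. (n +>\<^bsub>D\<^esub> r) \<otimes>\<^bsub>D Quot n\<^esub> f n \<noteq> n} \<subseteq> {n \<in> S. f n \<noteq> n}"
    using coset_mult_zero_iff[OF S_in r res_sum_carrierD(2)[OF f]] by blast
  then have "finite {n \<in> S. (n +>\<^bsub>D\<^esub> r) \<otimes>\<^bsub>D Quot n\<^esub> f n \<noteq> n}"
    using f finite_subset by (auto simp: res_sum_carrier_iff)
  then show "r \<odot>\<^bsub>res_sum D S\<^esub> f \<in> carrier (res_sum D S)"
    unfolding res_sum_simps
    by (rule res_sum_restrictI[rotated]) (use f r in \<open>simp add: res_sum_carrierD K coset_in_carrier\<close>)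
qed

lemma res_sum_eqI:
  assumes "f \<in> carrier (res_sum D S)" "g \<in> carrier (res_sum D S)" "\<And>n. n \<in> S \<Longrightarrow> f n = g n"
  shows "f = g"
  using assms by (auto simp: res_sum_carrier_iff intro: extensionalityI)

lemma res_sum_module: "module D (res_sum D S)"
proof (rule moduleI[OF is_cring])
  note K = cring.cring_simprules[OF Quot_cring[OF S_in], unfolded Quot_zero]
  show "abelian_group (res_sum D S)"
  proof (rule abelian_groupI)
    show "\<exists>g\<in>carrier (res_sum D S). g \<oplus>\<^bsub>res_sum D S\<^esub> f = \<zero>\<^bsub>res_sum D S\<^esub>"
      if f: "f \<in> carrier (res_sum D S)" for f
    proof (rule bexI[of _ "\<lambda>n\<in>S. \<ominus>\<^bsub>D Quot n\<^esub> f n"])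
      have *: "\<ominus>\<^bsub>D Quot n\<^esub> n = n" if "n \<in> S" for n
        using ring.minus_zero[OF Quot_ring[OF S_in[OF that]]] by (simp add: Quot_zero)
      have "finite {n \<in> S. \<ominus>\<^bsub>D Quot n\<^esub> f n \<noteq> n}"
        by (rule finite_subset[OF _ res_sum_carrierD(3)[OF f]]) (auto simp: *)
      then show "(\<lambda>n\<in>S. \<ominus>\<^bsub>D Quot n\<^esub> f n) \<in> carrier (res_sum D S)"
        by (rule res_sum_restrictI[rotated]) (use f in \<open>simp add: res_sum_carrierD K\<close>)
      show "(\<lambda>n\<in>S. \<ominus>\<^bsub>D Quot n\<^esub> f n) \<oplus>\<^bsub>res_sum D S\<^esub> f = \<zero>\<^bsub>res_sum D S\<^esub>"
        using f by (auto simp: res_sum_simps K res_sum_carrierD intro!: restrict_ext)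
    qed
  qed (auto intro!: res_sum_closed(1) res_sum_zero_closed res_sum_eqI simp: res_sum_closed(1)[OF _ _ zero_closed] res_sum_zero_closed,
      auto simp: res_sum_simps K res_sum_carrierD)
qed (auto intro!: res_sum_closed res_sum_eqI a_closed m_closed simp: res_sum_closed res_sum_closed(1)[OF _ _ zero_closed],
    auto simp: res_sum_simps res_sum_carrierD coset_in_carrier S_in orbit_ideal
      ring.ring_simprules[OF Quot_ring] simp flip: coset_arith Quot_one)

lemma breaks_iff: "n \<in> breaks D \<omega> \<longleftrightarrow> n \<in> \<omega> \<and> telt D \<in> n"
  by (simp add: breaks_def)

text \<open>The X-arrow indexed by its source n; \<open>V_X_at\<close> below is indexed by its
  target.\<close>

lemma V_X_apply:
  assumes "n \<in> S"
  shows "V_X D \<omega> S IX f (shift D 1 n) =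
    (if shift D 1 n \<in> S then
      if telt D \<notin> n then shift D 1 ((n +>\<^bsub>D\<^esub> telt D) \<otimes>\<^bsub>D Quot n\<^esub> f n)
      else if n \<in> IX then shift D 1 (f n) else shift D 1 n
    else undefined)"
  using assms S_in[OF assms]
  by (simp add: V_X_def Let_def orbit_shift_shift orbit_shift_0 breaks_iff Quot_zero)

end

section \<open>The modules $V(\omega, S, I_X)$\<close>

locale gwa_supportive = gwa_orbit_subset +
  assumes supp: "supportive D \<omega> S"
begin

text \<open>A local form of the condition on minimal elements. If the predecessor of n is missing
  from S, then n is minimal: any smaller element of S would force the predecessor into the
  interval.\<close>

lemma supportive_low:
  assumes n: "n \<in> S" and "shift D (- 1) n \<notin> S"
  shows "telt D \<in> shift D (- 1) n"
proof -
  have "\<not> orbit_less D m n" if m: "m \<in> S" for m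
  proof
    assume "orbit_less D m n"
    then obtain k where k: "k > 0" "n = shift D k m" by (auto simp: orbit_less_def)
    have km: "shift D (- 1) n = shift D (k - 1) m"
      using k S_in[OF m] by (simp add: orbit_shift_shift)
    have "n = shift D 1 (shift D (- 1) n)"
      using S_in[OF n] by (simp add: orbit_shift_shift orbit_shift_0)
    then have "orbit_less D (shift D (- 1) n) n"
      unfolding orbit_less_def by (metis zero_less_one)
    \<comment> \<open>For k = 1 the missing predecessor would be m itself, which lies in S.\<close>
    moreover have "k - 1 \<noteq> 0"
      using km assms(2) m S_in[OF m] by (auto simp: orbit_shift_0)
    then have "orbit_less D m (shift D (- 1) n)"
      unfolding orbit_less_def km using k(1) by (intro exI[of _ "k - 1"]) auto
    ultimately have "shift D (- 1) n \<in> S"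
      using supp m n orbit_shift[OF S_in[OF n]] unfolding supportive_def orbit_interval_def by blast
    then show False using assms(2) by simp
  qed
  then show ?thesis using supp n by (auto simp: supportive_def breaks_iff)
qed

lemma supportive_high:
  assumes n: "n \<in> S" and "shift D 1 n \<notin> S"
  shows "telt D \<in> n"
proof -
  have "\<not> orbit_less D n m" if m: "m \<in> S" for m
  proof
    assume "orbit_less D n m"
    then obtain k where k: "k > 0" "m = shift D k n" by (auto simp: orbit_less_def)
    have km: "m = shift D (k - 1) (shift D 1 n)"
      using k S_in[OF n] by (simp add: orbit_shift_shift)
    have "orbit_less D n (shift D 1 n)"
      unfolding orbit_less_def by (metis zero_less_one)
    moreover have "k - 1 \<noteq> 0"
      using km assms(2) m by (auto simp: orbit_shift_0[OF orbit_shift[OF S_in[OF n]]])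
    then have "orbit_less D (shift D 1 n) m"
      unfolding orbit_less_def km using k(1) by (intro exI[of _ "k - 1"]) auto
    ultimately have "shift D 1 n \<in> S"
      using supp m n orbit_shift[OF S_in[OF n]] unfolding supportive_def orbit_interval_def by blast
    then show False using assms(2) by simp
  qed
  then show ?thesis using supp n by (auto simp: supportive_def breaks_iff)
qed

lemma V_X_at:
  assumes "n \<in> S"
  shows "V_X D \<omega> S IX f n =
    (let m = shift D (- 1) n in
     if m \<in> S \<and> telt D \<notin> m then shift D 1 ((m +>\<^bsub>D\<^esub> telt D) \<otimes>\<^bsub>D Quot m\<^esub> f m)
     else if m \<in> S \<and> m \<in> IX then shift D 1 (f m) else n)"
  using assms by (simp add: V_X_def Let_def breaks_iff Quot_zero orbit_shift[OF S_in])

text \<open>With n and its successor both in S, a break n is automatically an inner one. So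
  membership in the complement of \<open>IX\<close> among the inner breaks reduces to
  \<open>n \<notin> IX\<close>.\<close>

lemma V_Y_at:
  assumes "n \<in> S"
  shows "V_Y D \<omega> S IX f n =
    (if shift D 1 n \<in> S \<and> (telt D \<notin> n \<or> n \<notin> IX) then shift D (- 1) (f (shift D 1 n)) else n)"
  using assms by (auto simp: V_Y_def Let_def breaks_iff Quot_zero S_in inner_breaks_def)

lemma shift_step:
  assumes "n \<in> S"
  shows "shift D 1 (shift D (- 1) n) = n" "shift D (- 1) (shift D 1 n) = n"
  using S_in[OF assms] by (simp_all add: orbit_shift_shift orbit_shift_0)

lemma shift_step_Quot:
  assumes "n \<in> S" "a \<in> carrier (D Quot n)"
  shows "shift D 1 (shift D (- 1) a) = a" "shift D (- 1) (shift D 1 a) = a"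
  using shift_orbit_Quot[OF S_in] assms by simp_all

lemma shift1_up: "\<lbrakk>n \<in> S; a \<in> carrier (D Quot shift D (- 1) n); shift D (- 1) n \<in> S\<rbrakk>
    \<Longrightarrow> shift D 1 a \<in> carrier (D Quot n)"
  using shift_orbit_Quot(3)[OF S_in, of "shift D (- 1) n" a 1] by (simp add: shift_step)

lemma shift1_down: "\<lbrakk>n \<in> S; a \<in> carrier (D Quot shift D 1 n); shift D 1 n \<in> S\<rbrakk>
    \<Longrightarrow> shift D (- 1) a \<in> carrier (D Quot n)"
  using shift_orbit_Quot(3)[OF S_in, of "shift D 1 n" a "- 1"] by (simp add: shift_step)

text \<open>Finiteness of the support survives because a nonzero component at n can only come from a
  nonzero component at one neighbour of n.\<close>

lemma V_ops_closed:
  assumes f: "f \<in> carrier (res_sum D S)"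
  shows "V_X D \<omega> S IX f \<in> carrier (res_sum D S)" "V_Y D \<omega> S IX f \<in> carrier (res_sum D S)"
proof -
  note K = cring.cring_simprules[OF Quot_cring[OF S_in], unfolded Quot_zero]
  note cl = res_sum_carrierD(2)[OF f]
  have ext: "V_X D \<omega> S IX f = restrict (V_X D \<omega> S IX f) S" "V_Y D \<omega> S IX f = restrict (V_Y D \<omega> S IX f) S"
    by (auto simp: V_X_def V_Y_def)
  have X: "V_X D \<omega> S IX f n \<in> carrier (D Quot n)" if "n \<in> S" for n
    using that shift1_up[OF that]
    by (auto simp: V_X_at Let_def cl K coset_in_carrier telt_closed)
  have Y: "V_Y D \<omega> S IX f n \<in> carrier (D Quot n)" if "n \<in> S" for n
    using that shift1_down[OF that] by (auto simp: V_Y_at cl K)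
  have "{n \<in> S. V_X D \<omega> S IX f n \<noteq> n} \<subseteq> shift D 1 ` {n \<in> S. f n \<noteq> n}"
  proof
    fix n assume "n \<in> {n \<in> S. V_X D \<omega> S IX f n \<noteq> n}"
    then have n: "n \<in> S" "V_X D \<omega> S IX f n \<noteq> n" by auto
    let ?m = "shift D (- 1) n"
    have m: "?m \<in> S" using n by (auto simp: V_X_at Let_def split: if_splits)
    have "(?m +>\<^bsub>D\<^esub> telt D) \<otimes>\<^bsub>D Quot ?m\<^esub> f ?m = ?m" if "f ?m = ?m"
      using coset_mult_zero_iff[OF S_in[OF m] telt_closed cl[OF m]] that by simp
    then have "f ?m \<noteq> ?m"
      using n by (auto simp: V_X_at Let_def shift_step split: if_splits)
    then show "n \<in> shift D 1 ` {n \<in> S. f n \<noteq> n}"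
      using m shift_step(1)[OF n(1)] by (metis (mono_tags, lifting) imageI mem_Collect_eq)
  qed
  then have "finite {n \<in> S. V_X D \<omega> S IX f n \<noteq> n}"
    using res_sum_carrierD(3)[OF f] finite_surj by blast
  then show "V_X D \<omega> S IX f \<in> carrier (res_sum D S)"
    using X by (subst ext) (rule res_sum_restrictI)
  have "{n \<in> S. V_Y D \<omega> S IX f n \<noteq> n} \<subseteq> shift D (- 1) ` {n \<in> S. f n \<noteq> n}"
  proof
    fix n assume "n \<in> {n \<in> S. V_Y D \<omega> S IX f n \<noteq> n}"
    then have n: "n \<in> S" "V_Y D \<omega> S IX f n \<noteq> n" by auto
    then have "shift D 1 n \<in> S" "f (shift D 1 n) \<noteq> shift D 1 n"
      by (auto simp: V_Y_at shift_step split: if_splits)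
    then show "n \<in> shift D (- 1) ` {n \<in> S. f n \<noteq> n}"
      using shift_step(2)[OF n(1)] by (metis (mono_tags, lifting) imageI mem_Collect_eq)
  qed
  then have "finite {n \<in> S. V_Y D \<omega> S IX f n \<noteq> n}"
    using res_sum_carrierD(3)[OF f] finite_surj by blast
  then show "V_Y D \<omega> S IX f \<in> carrier (res_sum D S)"
    using Y by (subst ext) (rule res_sum_restrictI)
qed

lemma coset_null_mult:
  assumes "n \<in> S" "r \<in> n" "a \<in> carrier (D Quot n)"
  shows "(n +>\<^bsub>D\<^esub> r) \<otimes>\<^bsub>D Quot n\<^esub> a = n"
  using assms orbit_subset[OF S_in[OF assms(1)]] by (subst coset_mult_zero_iff) (auto simp: S_in)

lemma shift_Quot_step:
  assumes "n \<in> S" "a \<in> carrier (D Quot n)" "b \<in> carrier (D Quot n)"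
  shows "shift D k (a \<oplus>\<^bsub>D Quot n\<^esub> b) = shift D k a \<oplus>\<^bsub>D Quot shift D k n\<^esub> shift D k b"
    "shift D k (a \<otimes>\<^bsub>D Quot n\<^esub> b) = shift D k a \<otimes>\<^bsub>D Quot shift D k n\<^esub> shift D k b"
  by (rule shift_Quot(2,3)[OF orbit_ideal[OF S_in[OF assms(1)]] assms(2,3)])+

lemma shift_coset_S:
  "\<lbrakk>n \<in> S; r \<in> carrier D\<rbrakk> \<Longrightarrow> shift D k (n +>\<^bsub>D\<^esub> r) = shift D k n +>\<^bsub>D\<^esub> sigpow D k r"
  by (rule shift_coset[OF orbit_ideal[OF S_in]])

text \<open>Off the breaks X carries the factor t and Y carries none, so each of YX and XY picks up
  exactly one factor; such arrows stay inside S by \<open>supportive_high\<close> and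
  \<open>supportive_low\<close>. At a break one of the two arrows is zero or leaves S, and t also
  acts as zero there, so both sides vanish.\<close>

lemma V_rep: 
  assumes IX: "IX \<subseteq> inner_breaks D \<omega> S"
  shows "gwa_rep D (res_sum D S) (V_X D \<omega> S IX) (V_Y D \<omega> S IX)"
proof (intro gwa_rep.intro gwa_setup_axioms res_sum_module gwa_rep_axioms.intro)
  note K = cring.cring_simprules[OF Quot_cring[OF S_in], unfolded Quot_zero]
  have IXt: "telt D \<in> n" if "n \<in> IX" for n
    using IX that by (auto simp: inner_breaks_def breaks_iff)
  have sig1: "sigpow D 1 r = sig D r" for r by (simp add: sigpow_1)
  fix f assume f: "f \<in> carrier (res_sum D S)"
  note cl = res_sum_carrierD(2)[OF f]
  show "V_X D \<omega> S IX f \<in> carrier (res_sum D S)" "V_Y D \<omega> S IX f \<in> carrier (res_sum D S)"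
    by (rule V_ops_closed[OF f])+
  show "V_Y D \<omega> S IX (V_X D \<omega> S IX f) = telt D \<odot>\<^bsub>res_sum D S\<^esub> f"
  proof (rule res_sum_eqI)
    fix n assume n: "n \<in> S"
    show "V_Y D \<omega> S IX (V_X D \<omega> S IX f) n = (telt D \<odot>\<^bsub>res_sum D S\<^esub> f) n"
    proof (cases "telt D \<in> n")
      case True
      then show ?thesis
        using n coset_null_mult[OF n True cl[OF n]]
        by (auto simp: V_Y_at V_X_apply res_sum_simps shift_step)
    next
      case False
      then have "shift D 1 n \<in> S" using supportive_high[OF n] by auto
      then show ?thesis using n False
        by (simp add: V_Y_at V_X_apply res_sum_simps shift_step_Quot K cl coset_in_carrier telt_closed)
    qed
  qed (auto intro!: V_ops_closed res_sum_closed(2) f telt_closed)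
  show "V_X D \<omega> S IX (V_Y D \<omega> S IX f) = sig D (telt D) \<odot>\<^bsub>res_sum D S\<^esub> f"
  proof (rule res_sum_eqI)
    fix n assume n: "n \<in> S"
    let ?m = "shift D (- 1) n"
    have mw: "?m \<in> \<omega>" using n by (simp add: orbit_shift S_in)
    show "V_X D \<omega> S IX (V_Y D \<omega> S IX f) n = (sig D (telt D) \<odot>\<^bsub>res_sum D S\<^esub> f) n"
    proof (cases "telt D \<in> ?m")
      case True
      then have "sig D (telt D) \<in> shift D 1 ?m" by (simp add: shift_def sig1)
      then have "sig D (telt D) \<in> n" using shift_step[OF n] by simp
      from coset_null_mult[OF n this cl[OF n]] True show ?thesis
        using n by (auto simp: V_X_at V_Y_at Let_def res_sum_simps shift_step)
    next
      case False
      then have m: "?m \<in> S" using supportive_low[OF n] by auto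
      have "shift D (- 1) (f n) \<in> carrier (D Quot ?m)"
        using shift1_down[OF m] n by (simp add: shift_step cl)
      then show ?thesis using n m False
        by (simp add: V_X_at V_Y_at Let_def res_sum_simps shift_step shift_Quot_step shift_coset_S K cl coset_in_carrier
            telt_closed sig1 shift_step_Quot sig_closed)
    qed
  qed (auto intro!: V_ops_closed res_sum_closed(2) f sig_closed telt_closed)
  show "V_X D \<omega> S IX (r \<odot>\<^bsub>res_sum D S\<^esub> f) = sig D r \<odot>\<^bsub>res_sum D S\<^esub> V_X D \<omega> S IX f"
    if r: "r \<in> carrier D" for r
  proof (rule res_sum_eqI)
    fix n assume n: "n \<in> S"
    let ?m = "shift D (- 1) n"
    have "(n +>\<^bsub>D\<^esub> sig D r) \<otimes>\<^bsub>D Quot n\<^esub> n = n"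
      using n r by (subst coset_mult_zero_iff) (auto simp: S_in sig_closed K)
    then show "V_X D \<omega> S IX (r \<odot>\<^bsub>res_sum D S\<^esub> f) n = (sig D r \<odot>\<^bsub>res_sum D S\<^esub> V_X D \<omega> S IX f) n"
      using n r by (auto simp: V_X_at Let_def res_sum_simps shift_step shift_Quot_step shift_coset_S K cl coset_in_carrier
            telt_closed sig1 shift1_up sig_closed)
  qed (auto intro!: V_ops_closed res_sum_closed(2) f sig_closed r)
  show "V_Y D \<omega> S IX (r \<odot>\<^bsub>res_sum D S\<^esub> f) = sigpow D (- 1) r \<odot>\<^bsub>res_sum D S\<^esub> V_Y D \<omega> S IX f"
    if r: "r \<in> carrier D" for r
  proof (rule res_sum_eqI)
    fix n assume n: "n \<in> S"
    have "(n +>\<^bsub>D\<^esub> sigpow D (- 1) r) \<otimes>\<^bsub>D Quot n\<^esub> n = n"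
      using n r by (subst coset_mult_zero_iff) (auto simp: S_in sigpow_closed K)
    then show "V_Y D \<omega> S IX (r \<odot>\<^bsub>res_sum D S\<^esub> f) n = (sigpow D (- 1) r \<odot>\<^bsub>res_sum D S\<^esub> V_Y D \<omega> S IX f) n"
      using n r by (auto simp: V_Y_at res_sum_simps shift_step shift_Quot_step shift_coset_S K cl coset_in_carrier
            shift1_down sigpow_closed)
  qed (auto intro!: V_ops_closed res_sum_closed(2) f sigpow_closed r)
  fix g assume g: "g \<in> carrier (res_sum D S)"
  note clg = res_sum_carrierD(2)[OF g]
  show "V_X D \<omega> S IX (f \<oplus>\<^bsub>res_sum D S\<^esub> g) = V_X D \<omega> S IX f \<oplus>\<^bsub>res_sum D S\<^esub> V_X D \<omega> S IX g"
  proof (rule res_sum_eqI)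
    fix n assume n: "n \<in> S"
    show "V_X D \<omega> S IX (f \<oplus>\<^bsub>res_sum D S\<^esub> g) n = (V_X D \<omega> S IX f \<oplus>\<^bsub>res_sum D S\<^esub> V_X D \<omega> S IX g) n"
      using n by (auto simp: V_X_at Let_def res_sum_simps shift_step shift_Quot_step shift_coset_S K cl clg coset_in_carrier
            telt_closed)
  qed (auto intro!: V_ops_closed res_sum_closed(1) f g zero_closed)
  show "V_Y D \<omega> S IX (f \<oplus>\<^bsub>res_sum D S\<^esub> g) = V_Y D \<omega> S IX f \<oplus>\<^bsub>res_sum D S\<^esub> V_Y D \<omega> S IX g"
  proof (rule res_sum_eqI)
    fix n assume n: "n \<in> S"
    show "V_Y D \<omega> S IX (f \<oplus>\<^bsub>res_sum D S\<^esub> g) n = (V_Y D \<omega> S IX f \<oplus>\<^bsub>res_sum D S\<^esub> V_Y D \<omega> S IX g) n"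
      using n by (auto simp: V_Y_at res_sum_simps shift_step shift_Quot_step shift_coset_S K cl clg)
  qed (auto intro!: V_ops_closed res_sum_closed(1) f g zero_closed)
qed

end

section \<open>The pairing and the finitistic dual\<close>

text \<open>Two one-sided choices, upward and downward from 0, are glued at 0. The conjunct fixing
  the value at 0 to be \<open>a0\<close> makes the two halves agree there.\<close>

lemma int_dependent_choice:
  fixes P :: "int \<Rightarrow> 'b \<Rightarrow> bool"
  assumes base: "P 0 a0"
    and up: "\<And>k a. P k a \<Longrightarrow> \<exists>b. P (k + 1) b \<and> Q k a b"
    and down: "\<And>k b. P (k + 1) b \<Longrightarrow> \<exists>a. P k a \<and> Q k a b"
  shows "\<exists>e. \<forall>k. P k (e k) \<and> Q k (e k) (e (k + 1))"
proof -
  have "\<exists>f. \<forall>n. (P (int n) (f n) \<and> (n = 0 \<longrightarrow> f n = a0)) \<and> Q (int n) (f n) (f (Suc n))"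
  proof (rule dependent_nat_choice)
    show "\<exists>y. (P (int (Suc n)) y \<and> (Suc n = 0 \<longrightarrow> y = a0)) \<and> Q (int n) x y"
      if "P (int n) x \<and> (n = 0 \<longrightarrow> x = a0)" for x n
      using up[of "int n" x] that by (simp add: add.commute)
  qed (use base in simp)
  then obtain f where f: "\<And>n. P (int n) (f n)" "f 0 = a0" "\<And>n. Q (int n) (f n) (f (Suc n))"
    by blast
  have "\<exists>g. \<forall>n. (P (- int n) (g n) \<and> (n = 0 \<longrightarrow> g n = a0)) \<and> Q (- int n - 1) (g (Suc n)) (g n)"
  proof (rule dependent_nat_choice)
    show "\<exists>y. (P (- int (Suc n)) y \<and> (Suc n = 0 \<longrightarrow> y = a0)) \<and> Q (- int n - 1) y x"
      if "P (- int n) x \<and> (n = 0 \<longrightarrow> x = a0)" for x n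
    proof -
      have *: "- int (Suc n) = - int n - 1" by simp
      show ?thesis using down[of "- int n - 1" x] that unfolding * by auto
    qed
  qed (use base in simp)
  then obtain g where g: "\<And>n. P (- int n) (g n)" "g 0 = a0" "\<And>n. Q (- int n - 1) (g (Suc n)) (g n)"
    by blast
  define e where "e = (\<lambda>k. if 0 \<le> k then f (nat k) else g (nat (- k)))"
  have "P k (e k) \<and> Q k (e k) (e (k + 1))" for k
  proof (cases "0 \<le> k")
    case True
    then show ?thesis using f(1)[of "nat k"] f(3)[of "nat k"]
      by (simp add: e_def nat_add_distrib)
  next
    case False
    define n where "n = nat (- k) - 1"
    have k: "k = - int n - 1" using False by (simp add: n_def)
    \<comment> \<open>For n = 0 the upper neighbour is \<open>e 0\<close>, which is taken from
      \<open>f\<close>; it equals \<open>g 0\<close> because both are \<open>a0\<close>.\<close>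
    show ?thesis using g(1)[of "Suc n"] g(2) g(3)[of n] f(2)
      by (cases n) (simp_all add: e_def k nat_add_distrib algebra_simps)
  qed
  then show ?thesis by blast
qed

text \<open>The target of forms and dual vectors is the direct sum over all of \<omega>, so the
  facts about \<open>res_sum\<close> apply to it under the prefix \<open>Om\<close>.\<close>

sublocale gwa_orbit \<subseteq> Om: gwa_orbit_subset D \<omega> \<omega>
  by unfold_locales simp

section \<open>Scalars of the pairing, separation of weights, and the action of \<sigma> on the
  direct sum over \<omega>\<close>

context gwa_orbit
begin

lemma shift_nonzero:
  assumes "n \<in> \<omega>" "a \<in> carrier (D Quot n)" "a \<noteq> n"
  shows "shift D k a \<noteq> shift D k n"
proof
  assume "shift D k a = shift D k n"
  then have "shift D (- k) (shift D k a) = shift D (- k) (shift D k n)" by simp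
  then show False using assms by (simp add: shift_orbit_Quot orbit_shift_shift orbit_shift_0)
qed

text \<open>From 1 at a base point the values are propagated along the orbit: upward by applying
  \<sigma> and dividing by \<sigma>(t), downward by multiplying by \<sigma>(t) and applying the
  inverse of \<sigma>. At breaks the factor is dropped. All values stay nonzero because the residue
  rings are fields and \<sigma>(t) is nonzero at \<sigma>(n) when t is nonzero at n.\<close>

lemma scaling_exists:
  obtains d where "\<And>n. n \<in> \<omega> \<Longrightarrow> d n \<in> carrier (D Quot n)" "\<And>n. n \<in> \<omega> \<Longrightarrow> d n \<noteq> n"
    "\<And>n. \<lbrakk>n \<in> \<omega>; telt D \<notin> n\<rbrakk> \<Longrightarrow>
      shift D 1 (d n) = d (shift D 1 n) \<otimes>\<^bsub>D Quot shift D 1 n\<^esub> (shift D 1 n +>\<^bsub>D\<^esub> sig D (telt D))"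
    "\<And>n. \<lbrakk>n \<in> \<omega>; telt D \<in> n\<rbrakk> \<Longrightarrow> shift D 1 (d n) = d (shift D 1 n)"
proof -
  obtain m where m: "m \<in> \<omega>" using infinite_orbit by (metis all_not_in_conv finite.emptyI)
  define P where "P = (\<lambda>k a. a \<in> carrier (D Quot shift D k m) \<and> a \<noteq> shift D k m)"
  define R where "R = (\<lambda>n a b. shift D 1 a =
    (if telt D \<in> n then b else b \<otimes>\<^bsub>D Quot shift D 1 n\<^esub> (shift D 1 n +>\<^bsub>D\<^esub> sig D (telt D))))"
  have sm: "shift D (k + 1) m = shift D 1 (shift D k m)" for k
    using m by (simp add: orbit_shift_shift add.commute)
  have c: "shift D 1 n +>\<^bsub>D\<^esub> sig D (telt D) \<in> carrier (D Quot shift D 1 n) - {shift D 1 n}"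
    if n: "n \<in> \<omega>" "telt D \<notin> n" for n
  proof -
    have 1: "n +>\<^bsub>D\<^esub> telt D \<noteq> n"
      using n by (simp add: coset_zero_iff orbit_ideal telt_closed)
    have "shift D 1 (n +>\<^bsub>D\<^esub> telt D) = shift D 1 n +>\<^bsub>D\<^esub> sig D (telt D)"
      using n by (simp add: shift_coset orbit_ideal telt_closed sigpow_1)
    then show ?thesis
      using shift_nonzero[OF n(1) coset_in_carrier[OF telt_closed] 1, of 1]
      by (simp add: coset_in_carrier sig_closed telt_closed)
  qed
  have "\<exists>e. \<forall>k. P k (e k) \<and> R (shift D k m) (e k) (e (k + 1))"
  proof (rule int_dependent_choice)
    interpret K: field "D Quot m" by (rule Quot_field[OF m])
    show "P 0 \<one>\<^bsub>D Quot m\<^esub>"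
      using K.one_not_zero m by (simp add: P_def orbit_shift_0 Quot_zero)
  next
    fix k a assume a: "P k a"
    let ?n = "shift D k m"
    have n: "?n \<in> \<omega>" by (rule orbit_shift[OF m])
    interpret K: field "D Quot shift D 1 ?n" by (rule Quot_field[OF orbit_shift[OF n]])
    have sa: "shift D 1 a \<in> carrier (D Quot shift D 1 ?n)" "shift D 1 a \<noteq> shift D 1 ?n"
      using a n by (auto simp: P_def shift_nonzero shift_orbit_Quot(3))
    show "\<exists>b. P (k + 1) b \<and> R ?n a b"
    proof (cases "telt D \<in> ?n")
      case True
      then show ?thesis using sa by (auto simp: P_def R_def sm)
    next
      case False
      let ?c = "shift D 1 ?n +>\<^bsub>D\<^esub> sig D (telt D)"
      have u: "?c \<in> Units (D Quot shift D 1 ?n)"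
        using c[OF n False] by (simp add: K.field_Units Quot_zero)
      have "shift D 1 a = shift D 1 a \<otimes>\<^bsub>D Quot shift D 1 ?n\<^esub> inv\<^bsub>D Quot shift D 1 ?n\<^esub> ?c
          \<otimes>\<^bsub>D Quot shift D 1 ?n\<^esub> ?c"
        using u sa by (simp add: K.m_assoc K.Units_closed)
      moreover have "shift D 1 a \<otimes>\<^bsub>D Quot shift D 1 ?n\<^esub> inv\<^bsub>D Quot shift D 1 ?n\<^esub> ?c \<noteq> shift D 1 ?n"
        using calculation sa(2) K.l_null[OF K.Units_closed[OF u]] unfolding Quot_zero by metis
      ultimately show ?thesis using False sa u
        \<comment> \<open>The witness is the quotient of the shifted value by the residue of
          \<sigma>(t).\<close>
        by (intro exI[of _ "shift D 1 a \<otimes>\<^bsub>D Quot shift D 1 ?n\<^esub> inv\<^bsub>D Quot shift D 1 ?n\<^esub> ?c"])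
          (simp add: P_def R_def sm)
    qed
  next
    fix k b assume b: "P (k + 1) b"
    let ?n = "shift D k m"
    have n: "?n \<in> \<omega>" by (rule orbit_shift[OF m])
    interpret K: field "D Quot shift D 1 ?n" by (rule Quot_field[OF orbit_shift[OF n]])
    have b': "b \<in> carrier (D Quot shift D 1 ?n)" "b \<noteq> shift D 1 ?n"
      using b by (auto simp: P_def sm)
    have *: "P k (shift D (- 1) b') \<and> shift D 1 (shift D (- 1) b') = b'"
      if "b' \<in> carrier (D Quot shift D 1 ?n)" "b' \<noteq> shift D 1 ?n" for b'
    proof -
      have i: "shift D (- 1) (shift D 1 ?n) = ?n"
        using n by (simp add: orbit_shift_shift[OF n] orbit_shift_0[OF n])
      have "P k (shift D (- 1) b')"
        using shift_orbit_Quot(3)[OF orbit_shift[OF n] that(1), of "- 1"]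
          shift_nonzero[OF orbit_shift[OF n] that, of "- 1"]
        unfolding P_def i by simp
      moreover have "shift D 1 (shift D (- 1) b') = b'"
        using shift_orbit_Quot(1,2)[OF orbit_shift[OF n] that(1)] by simp
      ultimately show ?thesis by simp
    qed
    show "\<exists>a. P k a \<and> R ?n a b"
    proof (cases "telt D \<in> ?n")
      case True
      then show ?thesis using *[OF b'] by (auto simp: R_def)
    next
      case False
      let ?c = "shift D 1 ?n +>\<^bsub>D\<^esub> sig D (telt D)"
      have "b \<otimes>\<^bsub>D Quot shift D 1 ?n\<^esub> ?c \<in> carrier (D Quot shift D 1 ?n)"
        "b \<otimes>\<^bsub>D Quot shift D 1 ?n\<^esub> ?c \<noteq> shift D 1 ?n"
        using b' c[OF n False] K.integral_iff[of b ?c] by (auto simp: Quot_zero)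
      from *[OF this] show ?thesis using False by (auto simp: R_def)
    qed
  qed
  then obtain e where e: "\<And>k. P k (e k)" "\<And>k. R (shift D k m) (e k) (e (k + 1))" by blast
  \<comment> \<open>The choice produced a sequence indexed by integers; freeness of the shift makes
    the index of an ideal unique, so \<open>d\<close> is a function of the ideal.\<close>
  define d where "d = (\<lambda>n. e (THE k. n = shift D k m))"
  have d: "d (shift D k m) = e k" for k
  proof -
    have "(THE j. shift D k m = shift D j m) = k"
      by (rule the_equality) (auto dest: orbit_shift_inj[OF m])
    then show ?thesis by (simp add: d_def)
  qed
  have n: "\<exists>k. n = shift D k m" if "n \<in> \<omega>" for n
    using that orbit_range[OF m] by auto
  show thesis
  proof (rule that[of d])
    fix n assume "n \<in> \<omega>"
    then obtain k where k: "n = shift D k m" using n by auto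
    show "d n \<in> carrier (D Quot n)" "d n \<noteq> n"
      using e(1)[of k] by (simp_all add: k d P_def)
    show "telt D \<notin> n \<Longrightarrow>
      shift D 1 (d n) = d (shift D 1 n) \<otimes>\<^bsub>D Quot shift D 1 n\<^esub> (shift D 1 n +>\<^bsub>D\<^esub> sig D (telt D))"
      "telt D \<in> n \<Longrightarrow> shift D 1 (d n) = d (shift D 1 n)"
      using e(2)[of k] d[of "k + 1"] by (simp_all add: k d R_def sm)
  qed
qed

text \<open>Distinct maximal ideals do not contain one another. For each k in F take an element of k
  outside n; the product of these lies in every k, and it stays outside n because n is
  prime.\<close>

lemma ideals_separate:
  assumes "finite F" "F \<subseteq> \<omega>" "n \<in> \<omega>" "n \<notin> F"
  shows "\<exists>r\<in>carrier D. r \<notin> n \<and> (\<forall>k\<in>F. r \<in> k)"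
  using assms
proof (induction F rule: finite_induct)
  case empty
  interpret n: primeideal n D by (rule orbit_prime[OF \<open>n \<in> \<omega>\<close>])
  show ?case using n.I_notcarr n.a_subset by auto
next
  case (insert k F)
  interpret n: primeideal n D by (rule orbit_prime[OF \<open>n \<in> \<omega>\<close>])
  have k: "k \<in> \<omega>" "k \<noteq> n" using insert by auto
  interpret k: maximalideal k D by (rule orbit_maximal[OF k(1)])
  obtain r where r: "r \<in> carrier D" "r \<notin> n" "\<forall>k\<in>F. r \<in> k"
    using insert by auto
  have "\<not> k \<subseteq> n"
    using k.I_maximal[OF n.is_ideal] n.I_notcarr n.a_subset k(2) by auto
  then obtain s where s: "s \<in> k" "s \<notin> n" by auto
  have sc: "s \<in> carrier D" using s(1) k.a_subset by auto
  have "s \<otimes>\<^bsub>D\<^esub> r \<in> j" if "j \<in> F" for j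
    using ideal.I_l_closed[OF orbit_ideal, of j r s] insert.prems that r sc by auto
  moreover have "s \<otimes>\<^bsub>D\<^esub> r \<in> k" using k.I_r_closed s r by auto
  moreover have "s \<otimes>\<^bsub>D\<^esub> r \<notin> n" using n.I_prime[OF sc r(1)] s r by auto
  ultimately show ?case using sc r(1) by (intro bexI[of _ "s \<otimes>\<^bsub>D\<^esub> r"]) auto
qed

text \<open>Reality of the orbit in the form needed for locality: a scalar invertible at n remains
  so after conjugation.\<close>

lemma bar_mem_iff: "\<lbrakk>n \<in> \<omega>; r \<in> carrier D\<rbrakk> \<Longrightarrow> bar D r \<in> n \<longleftrightarrow> r \<in> n"
  using bar_orbit[of n] bar_bar[of r] by (metis imageI)

lemma res_sig_closed:
  assumes f: "f \<in> carrier (res_sum D \<omega>)"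
  shows "res_sig D \<omega> k f \<in> carrier (res_sum D \<omega>)"
  unfolding res_sig_def
proof (rule Om.res_sum_restrictI)
  have sk: "shift D k (shift D (- k) n) = n" if "n \<in> \<omega>" for n
    using that by (simp add: orbit_shift_shift orbit_shift_0)
  show "shift D k (f (shift D (- k) n)) \<in> carrier (D Quot n)" if n: "n \<in> \<omega>" for n
    using shift_orbit_Quot(3)[OF orbit_shift[OF n] Om.res_sum_carrierD(2)[OF f orbit_shift[OF n]], of k "- k"]
    by (simp add: sk n)
  have "{n \<in> \<omega>. shift D k (f (shift D (- k) n)) \<noteq> n} \<subseteq> shift D k ` {n \<in> \<omega>. f n \<noteq> n}"
  proof
    fix n assume "n \<in> {n \<in> \<omega>. shift D k (f (shift D (- k) n)) \<noteq> n}"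
    then have n: "n \<in> \<omega>" "shift D k (f (shift D (- k) n)) \<noteq> n" by auto
    then have "f (shift D (- k) n) \<noteq> shift D (- k) n" using sk by auto
    then show "n \<in> shift D k ` {n \<in> \<omega>. f n \<noteq> n}"
      using sk[OF n(1)] orbit_shift[OF n(1)] by (metis (mono_tags, lifting) imageI mem_Collect_eq)
  qed
  then show "finite {n \<in> \<omega>. shift D k (f (shift D (- k) n)) \<noteq> n}"
    using Om.res_sum_carrierD(3)[OF f] finite_surj by blast
qed

lemma res_sig_add:
  "f \<in> carrier (res_sum D \<omega>) \<Longrightarrow> res_sig D \<omega> j (res_sig D \<omega> k f) = res_sig D \<omega> (j + k) f"
proof -
  assume f: "f \<in> carrier (res_sum D \<omega>)"
  have "shift D j (res_sig D \<omega> k f (shift D (- j) n)) = shift D (j + k) (f (shift D (- (j + k)) n))"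
    if n: "n \<in> \<omega>" for n
    using shift_orbit_Quot(2)[OF orbit_shift[OF n] Om.res_sum_carrierD(2)[OF f orbit_shift[OF n]]] n
    by (simp add: res_sig_def orbit_shift orbit_shift_shift algebra_simps)
  then show ?thesis
    unfolding res_sig_def[of D \<omega> j] res_sig_def[of D \<omega> "j + k"] by (intro restrict_ext)
qed

lemma res_sig_0: "f \<in> carrier (res_sum D \<omega>) \<Longrightarrow> res_sig D \<omega> 0 f = f"
proof -
  assume f: "f \<in> carrier (res_sum D \<omega>)"
  show ?thesis
    using Om.res_sum_carrierD(1)[OF f] Om.res_sum_carrierD(2)[OF f]
    by (intro extensionalityI[of _ \<omega>]) (auto simp: res_sig_def orbit_shift_0 shift_orbit_Quot(1))
qed

lemma res_sig_plus:
  assumes f: "f \<in> carrier (res_sum D \<omega>)" and g: "g \<in> carrier (res_sum D \<omega>)"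
  shows "res_sig D \<omega> k (f \<oplus>\<^bsub>res_sum D \<omega>\<^esub> g) = res_sig D \<omega> k f \<oplus>\<^bsub>res_sum D \<omega>\<^esub> res_sig D \<omega> k g"
proof -
  have "shift D k ((f \<oplus>\<^bsub>res_sum D \<omega>\<^esub> g) (shift D (- k) n)) =
      shift D k (f (shift D (- k) n)) \<oplus>\<^bsub>D Quot n\<^esub> shift D k (g (shift D (- k) n))" if n: "n \<in> \<omega>" for n
    using shift_Quot(2)[OF orbit_ideal[OF orbit_shift[OF n]] Om.res_sum_carrierD(2)[OF f orbit_shift[OF n]]
        Om.res_sum_carrierD(2)[OF g orbit_shift[OF n]], of k "- k"] n
    by (simp add: Om.res_sum_simps orbit_shift orbit_shift_shift orbit_shift_0)
  then show ?thesis
    by (auto simp: res_sig_def Om.res_sum_simps(2)[of "restrict _ _"] intro!: restrict_ext)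
qed

end

section \<open>Locality of maps that are linear up to a twist of the scalars\<close>

context gwa_orbit_subset
begin

text \<open>Choose r outside n that kills v. Then r and 0 act equally on v, hence \<beta>(r) and
  \<beta>(0) act equally on the image; at n the latter is zero and the former is invertible.
  Comparing with the scalar 0 replaces an appeal to additivity. The twist \<beta> is
  \<open>bar D\<close> for dual vectors and for the right argument of a form, and the identity for
  its left argument.\<close>

lemma twisted_linear_local:
  assumes \<phi>: "\<And>v. v \<in> carrier (res_sum D S) \<Longrightarrow> \<phi> v \<in> carrier (res_sum D \<omega>)"
    and semi: "\<And>r v. \<lbrakk>r \<in> carrier D; v \<in> carrier (res_sum D S)\<rbrakk> \<Longrightarrow>
      \<phi> (r \<odot>\<^bsub>res_sum D S\<^esub> v) = \<beta> r \<odot>\<^bsub>res_sum D \<omega>\<^esub> \<phi> v"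
    and \<beta>: "\<And>r. r \<in> carrier D \<Longrightarrow> \<beta> r \<in> carrier D" "\<And>r. r \<in> carrier D \<Longrightarrow> \<beta> r \<in> n \<longleftrightarrow> r \<in> n"
    and v: "v \<in> carrier (res_sum D S)" and n: "n \<in> \<omega>" and vn: "n \<in> S \<Longrightarrow> v n = n"
  shows "\<phi> v n = n"
proof -
  let ?F = "{k \<in> S. v k \<noteq> k}"
  obtain r where r: "r \<in> carrier D" "r \<notin> n" "\<forall>k\<in>?F. r \<in> k"
    using ideals_separate[of ?F n] res_sum_carrierD(3)[OF v] S_orbit n vn by auto
  have "r \<odot>\<^bsub>res_sum D S\<^esub> v = \<zero>\<^bsub>D\<^esub> \<odot>\<^bsub>res_sum D S\<^esub> v"
  proof (rule res_sum_eqI)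
    fix k assume k: "k \<in> S"
    have "(k +>\<^bsub>D\<^esub> r) \<otimes>\<^bsub>D Quot k\<^esub> v k = k"
      using r k coset_mult_zero_iff[OF S_in[OF k] r(1) res_sum_carrierD(2)[OF v k]] by auto
    moreover have "(k +>\<^bsub>D\<^esub> \<zero>\<^bsub>D\<^esub>) \<otimes>\<^bsub>D Quot k\<^esub> v k = k"
      using k coset_mult_zero_iff[OF S_in[OF k] zero_closed res_sum_carrierD(2)[OF v k]]
        additive_subgroup.zero_closed[OF ideal.axioms(1)[OF orbit_ideal[OF S_in[OF k]]]] by auto
    ultimately show "(r \<odot>\<^bsub>res_sum D S\<^esub> v) k = (\<zero>\<^bsub>D\<^esub> \<odot>\<^bsub>res_sum D S\<^esub> v) k"
      using k by (simp add: res_sum_simps)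
  qed (auto intro!: res_sum_closed(2) v r)
  then have "\<beta> r \<odot>\<^bsub>res_sum D \<omega>\<^esub> \<phi> v = \<beta> \<zero>\<^bsub>D\<^esub> \<odot>\<^bsub>res_sum D \<omega>\<^esub> \<phi> v"
    using semi v r(1) zero_closed by metis
  then have *: "(n +>\<^bsub>D\<^esub> \<beta> r) \<otimes>\<^bsub>D Quot n\<^esub> \<phi> v n = (n +>\<^bsub>D\<^esub> \<beta> \<zero>\<^bsub>D\<^esub>) \<otimes>\<^bsub>D Quot n\<^esub> \<phi> v n"
    using n by (auto simp: Om.res_sum_simps dest: fun_cong[of _ _ n])
  have cl: "\<phi> v n \<in> carrier (D Quot n)" by (rule Om.res_sum_carrierD(2)[OF \<phi>[OF v] n])
  have "\<beta> \<zero>\<^bsub>D\<^esub> \<in> n"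
    using additive_subgroup.zero_closed[OF ideal.axioms(1)[OF orbit_ideal[OF n]]] \<beta>(2)[OF zero_closed] by simp
  then have "(n +>\<^bsub>D\<^esub> \<beta> r) \<otimes>\<^bsub>D Quot n\<^esub> \<phi> v n = n"
    using * coset_mult_zero_iff[OF n \<beta>(1)[OF zero_closed] cl] by simp
  then show ?thesis
    using coset_mult_zero_iff[OF n \<beta>(1)[OF r(1)] cl] \<beta>(2)[OF r(1)] r(2) by auto
qed

lemma semilinear_local:
  assumes "\<And>v. v \<in> carrier (res_sum D S) \<Longrightarrow> \<phi> v \<in> carrier (res_sum D \<omega>)"
    and "\<And>r v. \<lbrakk>r \<in> carrier D; v \<in> carrier (res_sum D S)\<rbrakk> \<Longrightarrow>
      \<phi> (r \<odot>\<^bsub>res_sum D S\<^esub> v) = bar D r \<odot>\<^bsub>res_sum D \<omega>\<^esub> \<phi> v"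
    and v: "v \<in> carrier (res_sum D S)" and n: "n \<in> \<omega>" and vn: "n \<in> S \<Longrightarrow> v n = n"
  shows "\<phi> v n = n"
  by (rule twisted_linear_local[OF assms(1,2) bar_closed bar_mem_iff[OF n] v n vn])

definition single :: "'a set \<Rightarrow> 'a set \<Rightarrow> 'a set \<Rightarrow> 'a set" where
  "single n a = (\<lambda>k\<in>S. if k = n then a else k)"

lemma single_closed: "a \<in> carrier (D Quot n) \<Longrightarrow> single n a \<in> carrier (res_sum D S)"
  unfolding single_def
proof (rule res_sum_restrictI)
  show "finite {k \<in> S. (if k = n then a else k) \<noteq> k}"
    by (rule finite_subset[of _ "{n}"]) auto
qed (use ring.ring_simprules(2)[OF Quot_ring[OF S_in], unfolded Quot_zero] in auto)

lemma single_apply: "k \<in> S \<Longrightarrow> single n a k = (if k = n then a else k)"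
  by (simp add: single_def)

lemma single_smult:
  assumes "n \<in> S" "r \<in> carrier D" "a \<in> carrier (D Quot n)"
  shows "r \<odot>\<^bsub>res_sum D S\<^esub> single n a = single n ((n +>\<^bsub>D\<^esub> r) \<otimes>\<^bsub>D Quot n\<^esub> a)"
proof (rule res_sum_eqI)
  note K = ring.ring_simprules[OF Quot_ring[OF S_in], unfolded Quot_zero]
  show "r \<odot>\<^bsub>res_sum D S\<^esub> single n a \<in> carrier (res_sum D S)"
    using assms by (intro res_sum_closed(2)) (auto intro: single_closed)
  show "single n ((n +>\<^bsub>D\<^esub> r) \<otimes>\<^bsub>D Quot n\<^esub> a) \<in> carrier (res_sum D S)"
    using assms by (intro single_closed) (auto simp: K coset_in_carrier)
  show "(r \<odot>\<^bsub>res_sum D S\<^esub> single n a) k = single n ((n +>\<^bsub>D\<^esub> r) \<otimes>\<^bsub>D Quot n\<^esub> a) k" if "k \<in> S" for k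
    using that assms by (auto simp: res_sum_simps single_apply coset_mult_zero_iff S_in K(2))
qed

end

text \<open>The rules for \<open>d\<close> are what adjointness of X and Y demands. Off the breaks,
  pairing Xf with v at \<sigma>(m) produces the factors d(\<sigma>(m)) and \<sigma>(t), since X
  carries t. Pairing f with Yv and applying \<sigma> produces only \<sigma>(d(m)), since Y carries
  no t. At a break the surviving arrow is a pure shift on both sides, so the factor \<sigma>(t)
  disappears.\<close>

locale gwa_pairing = gwa_supportive D \<omega> S for D :: "'a gwa_datum" and \<omega> S +
  fixes d :: "'a set \<Rightarrow> 'a set" and IX :: "'a set set"
  assumes d_closed: "n \<in> \<omega> \<Longrightarrow> d n \<in> carrier (D Quot n)" and d_nonzero: "n \<in> \<omega> \<Longrightarrow> d n \<noteq> n"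
    and d_unbroken: "\<lbrakk>n \<in> \<omega>; telt D \<notin> n\<rbrakk> \<Longrightarrow>
      shift D 1 (d n) = d (shift D 1 n) \<otimes>\<^bsub>D Quot shift D 1 n\<^esub> (shift D 1 n +>\<^bsub>D\<^esub> sig D (telt D))"
    and d_break: "\<lbrakk>n \<in> \<omega>; telt D \<in> n\<rbrakk> \<Longrightarrow> shift D 1 (d n) = d (shift D 1 n)"
    and IX: "IX \<subseteq> inner_breaks D \<omega> S"
begin

text \<open>The left argument is meant in the module with index set \<open>JX\<close>, the right one
  in \<open>V\<close>. Both have the same underlying R-module, so the same function can later serve
  as a form on \<open>V\<close>.\<close>

definition pairing :: "('a set \<Rightarrow> 'a set) \<Rightarrow> ('a set \<Rightarrow> 'a set) \<Rightarrow> 'a set \<Rightarrow> 'a set" where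
  "pairing f v = (\<lambda>n\<in>\<omega>. if n \<in> S then d n \<otimes>\<^bsub>D Quot n\<^esub> (f n \<otimes>\<^bsub>D Quot n\<^esub> bar D ` v n) else n)"

abbreviation "JX \<equiv> inner_breaks D \<omega> S - IX"
abbreviation "V \<equiv> V_mod D \<omega> S IX"

lemma pairing_at:
  "n \<in> S \<Longrightarrow> pairing f v n = d n \<otimes>\<^bsub>D Quot n\<^esub> (f n \<otimes>\<^bsub>D Quot n\<^esub> bar D ` v n)"
  "\<lbrakk>n \<in> \<omega>; n \<notin> S\<rbrakk> \<Longrightarrow> pairing f v n = n"
  by (simp_all add: pairing_def S_in)

lemma bar_closed_at:
  "\<lbrakk>v \<in> carrier (res_sum D S); n \<in> S\<rbrakk> \<Longrightarrow> bar D ` v n \<in> carrier (D Quot n)"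
  using bar_Quot(1)[OF S_in] res_sum_carrierD(2) by blast

lemma pairing_zero_iff:
  assumes "f \<in> carrier (res_sum D S)" "v \<in> carrier (res_sum D S)" "n \<in> S"
  shows "pairing f v n = n \<longleftrightarrow> f n = n \<or> v n = n"
proof -
  have n: "n \<in> \<omega>" by (rule S_in[OF assms(3)])
  interpret K: field "D Quot n" by (rule Quot_field[OF n])
  have b: "bar D ` v n = n \<longleftrightarrow> v n = n"
    using bar_orbit[OF n] bar_Quot(4)[OF n res_sum_carrierD(2)[OF assms(2,3)] res_sum_carrierD(2)[OF assms(2,3)]]
    by metis
  show ?thesis
    using K.integral_iff d_closed[OF n] d_nonzero[OF n] res_sum_carrierD(2)[OF assms(1,3)]
      bar_closed_at[OF assms(2,3)]
    by (auto simp: pairing_at assms(3) Quot_zero b)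
qed

lemma pairing_closed:
  assumes f: "f \<in> carrier (res_sum D S)" and v: "v \<in> carrier (res_sum D S)"
  shows "pairing f v \<in> carrier (res_sum D \<omega>)"
proof -
  have "{n \<in> \<omega>. (if n \<in> S then d n \<otimes>\<^bsub>D Quot n\<^esub> (f n \<otimes>\<^bsub>D Quot n\<^esub> bar D ` v n) else n) \<noteq> n} \<subseteq> {n \<in> S. f n \<noteq> n}"
    using pairing_zero_iff[OF f v] by (auto simp: pairing_at split: if_splits)
  from finite_subset[OF this res_sum_carrierD(3)[OF f]] show ?thesis
    unfolding pairing_def
    by (rule Om.res_sum_restrictI[rotated])
      (use bar_closed_at[OF v] res_sum_carrierD(2)[OF f] d_closed ring.ring_simprules(2,5)[OF Quot_ring, unfolded Quot_zero]
        in auto)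
qed

lemma pairing_add_left:
  assumes f: "f \<in> carrier (res_sum D S)" and g: "g \<in> carrier (res_sum D S)" and v: "v \<in> carrier (res_sum D S)"
  shows "pairing (f \<oplus>\<^bsub>res_sum D S\<^esub> g) v = pairing f v \<oplus>\<^bsub>res_sum D \<omega>\<^esub> pairing g v"
proof (rule Om.res_sum_eqI)
  note K = cring.cring_simprules[OF Quot_cring, unfolded Quot_zero]
  show "pairing (f \<oplus>\<^bsub>res_sum D S\<^esub> g) v n = (pairing f v \<oplus>\<^bsub>res_sum D \<omega>\<^esub> pairing g v) n" if "n \<in> \<omega>" for n
    using that bar_closed_at[OF v] res_sum_carrierD(2)[OF f] res_sum_carrierD(2)[OF g] d_closed[OF that]
    by (cases "n \<in> S") (simp_all add: pairing_at Om.res_sum_simps res_sum_simps K)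
qed (auto intro!: pairing_closed res_sum_closed(1) Om.res_sum_closed(1) f g v zero_closed)

lemma pairing_add_right:
  assumes f: "f \<in> carrier (res_sum D S)" and g: "g \<in> carrier (res_sum D S)" and v: "v \<in> carrier (res_sum D S)"
  shows "pairing f (g \<oplus>\<^bsub>res_sum D S\<^esub> v) = pairing f g \<oplus>\<^bsub>res_sum D \<omega>\<^esub> pairing f v"
proof (rule Om.res_sum_eqI)
  note K = cring.cring_simprules[OF Quot_cring, unfolded Quot_zero]
  show "pairing f (g \<oplus>\<^bsub>res_sum D S\<^esub> v) n = (pairing f g \<oplus>\<^bsub>res_sum D \<omega>\<^esub> pairing f v) n" if "n \<in> \<omega>" for n
    using that bar_closed_at[OF v] bar_closed_at[OF g] res_sum_carrierD(2)[OF f] res_sum_carrierD(2)[OF g]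
      res_sum_carrierD(2)[OF v] d_closed[OF that]
    by (cases "n \<in> S") (simp_all add: pairing_at Om.res_sum_simps res_sum_simps K bar_Quot(2))
qed (auto intro!: pairing_closed res_sum_closed(1) Om.res_sum_closed(1) f g v zero_closed)

lemma pairing_smult_left:
  assumes f: "f \<in> carrier (res_sum D S)" and r: "r \<in> carrier D" and v: "v \<in> carrier (res_sum D S)"
  shows "pairing (r \<odot>\<^bsub>res_sum D S\<^esub> f) v = r \<odot>\<^bsub>res_sum D \<omega>\<^esub> pairing f v"
proof (rule Om.res_sum_eqI)
  note K = cring.cring_simprules[OF Quot_cring, unfolded Quot_zero]
  show "pairing (r \<odot>\<^bsub>res_sum D S\<^esub> f) v n = (r \<odot>\<^bsub>res_sum D \<omega>\<^esub> pairing f v) n" if "n \<in> \<omega>" for n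
    using that bar_closed_at[OF v] res_sum_carrierD(2)[OF f] d_closed[OF that] r
    by (cases "n \<in> S") (simp_all add: pairing_at Om.res_sum_simps res_sum_simps K coset_in_carrier)
qed (auto intro!: pairing_closed res_sum_closed(2) Om.res_sum_closed(2) f v r)

lemma pairing_smult_right:
  assumes f: "f \<in> carrier (res_sum D S)" and r: "r \<in> carrier D" and v: "v \<in> carrier (res_sum D S)"
  shows "pairing f (r \<odot>\<^bsub>res_sum D S\<^esub> v) = bar D r \<odot>\<^bsub>res_sum D \<omega>\<^esub> pairing f v"
proof (rule Om.res_sum_eqI)
  note K = cring.cring_simprules[OF Quot_cring, unfolded Quot_zero]
  show "pairing f (r \<odot>\<^bsub>res_sum D S\<^esub> v) n = (bar D r \<odot>\<^bsub>res_sum D \<omega>\<^esub> pairing f v) n" if "n \<in> \<omega>" for n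
    using that bar_closed_at[OF v] res_sum_carrierD(2)[OF f] d_closed[OF that] r res_sum_carrierD(2)[OF v]
    by (cases "n \<in> S")
      (simp_all add: pairing_at Om.res_sum_simps res_sum_simps K coset_in_carrier bar_Quot(3) bar_coset bar_closed)
qed (auto intro!: pairing_closed res_sum_closed(2) Om.res_sum_closed(2) f v r bar_closed)

text \<open>X on the left module and Y on the right module use the arrow between m and n =
  \<sigma>(m) under the same condition: both ends lie in S and m is not in \<open>IX\<close>.
  Otherwise both sides are zero. When the arrow is present, the components differ only by the factor
  governed by the rules for \<open>d\<close>.\<close>

lemma pairing_X:
  assumes f: "f \<in> carrier (res_sum D S)" and v: "v \<in> carrier (res_sum D S)"
  shows "pairing (V_X D \<omega> S JX f) v = res_sig D \<omega> 1 (pairing f (V_Y D \<omega> S IX v))"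
proof (rule Om.res_sum_eqI)
  note K = cring.cring_simprules[OF Quot_cring, unfolded Quot_zero]
  note cl = res_sum_carrierD(2)[OF f] and clv = res_sum_carrierD(2)[OF v]
  note Yv = V_ops_closed(2)[OF v, of IX] and Xf = V_ops_closed(1)[OF f, of JX]
  fix n assume n: "n \<in> \<omega>"
  define m where "m = shift D (- 1) n"
  have m: "m \<in> \<omega>" "shift D 1 m = n" using n by (simp_all add: m_def orbit_shift orbit_shift_shift orbit_shift_0)
  have R: "res_sig D \<omega> 1 (pairing f (V_Y D \<omega> S IX v)) n = shift D 1 (pairing f (V_Y D \<omega> S IX v) m)"
    using n by (simp add: res_sig_def m_def)
  show "pairing (V_X D \<omega> S JX f) v n = res_sig D \<omega> 1 (pairing f (V_Y D \<omega> S IX v)) n"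
  proof (cases "n \<in> S \<and> m \<in> S \<and> m \<notin> IX")
    case False
    then have "pairing (V_X D \<omega> S JX f) v n = n"
    proof (cases "n \<in> S")
      case True
      then have "V_X D \<omega> S JX f n = n"
        using False IX by (auto simp: V_X_at m_def[symmetric] Let_def inner_breaks_def breaks_iff)
      then show ?thesis using pairing_zero_iff[OF Xf v True] by simp
    qed (simp add: n pairing_at)
    moreover have "pairing f (V_Y D \<omega> S IX v) m = m"
    proof (cases "m \<in> S")
      case True
      then have "V_Y D \<omega> S IX v m = m"
        using False IX m by (auto simp: V_Y_at inner_breaks_def breaks_iff)
      then show ?thesis using pairing_zero_iff[OF f Yv True] by simp
    qed (simp add: m pairing_at)
    ultimately show ?thesis by (simp add: R m)
  next
    case True
    then have nS: "n \<in> S" and mS: "m \<in> S" and mI: "m \<notin> IX" by auto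
    have bv: "bar D ` v n \<in> carrier (D Quot n)" by (rule bar_closed_at[OF v nS])
    have sbv: "shift D (- 1) (bar D ` v n) \<in> carrier (D Quot m)"
      using shift_orbit_Quot(3)[OF n bv, of "- 1"] by (simp add: m_def)
    have Y: "V_Y D \<omega> S IX v m = shift D (- 1) (v n)"
      using mS nS mI m by (simp add: V_Y_at)
    have RR: "shift D 1 (pairing f (V_Y D \<omega> S IX v) m) =
        shift D 1 (d m) \<otimes>\<^bsub>D Quot n\<^esub> (shift D 1 (f m) \<otimes>\<^bsub>D Quot n\<^esub> bar D ` v n)"
      using shift_orbit_Quot(1,2)[OF n bv]
      by (simp add: pairing_at mS Y bar_Quot(5)[OF n clv[OF nS] clv[OF nS]] shift_Quot_step m sbv cl
          d_closed K)
    have sf: "shift D 1 (f m) \<in> carrier (D Quot n)"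
      using shift_orbit_Quot(3)[OF m(1) cl[OF mS], of 1] by (simp add: m)
    show ?thesis
    proof (cases "telt D \<in> m")
      case t: True
      then have "V_X D \<omega> S JX f n = shift D 1 (f m)"
        using mS nS mI m by (simp add: V_X_at m_def[symmetric] Let_def inner_breaks_def breaks_iff)
      then show ?thesis using t by (simp add: R RR pairing_at nS d_break m)
    next
      case t: False
      then have "V_X D \<omega> S JX f n = (n +>\<^bsub>D\<^esub> sig D (telt D)) \<otimes>\<^bsub>D Quot n\<^esub> shift D 1 (f m)"
        using mS nS by (simp add: V_X_at m_def[symmetric] Let_def shift_Quot_step shift_coset_S coset_in_carrier telt_closed
            cl m sigpow_1)
      then show ?thesis using t sf bv n d_closed[OF n]
        by (simp add: R RR pairing_at nS d_unbroken m K coset_in_carrier sig_closed telt_closed)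
    qed
  qed
qed (auto intro!: pairing_closed res_sig_closed V_ops_closed f v)

text \<open>The arrow is now present exactly when both ends lie in S and m is unbroken or in
  \<open>IX\<close>. The factor t arises in the right argument, so it is conjugated before it meets
  \<open>d\<close>; this is where t being fixed by bar is used.\<close>

lemma pairing_Y:
  assumes f: "f \<in> carrier (res_sum D S)" and v: "v \<in> carrier (res_sum D S)"
  shows "pairing (V_Y D \<omega> S JX f) v = res_sig D \<omega> (- 1) (pairing f (V_X D \<omega> S IX v))"
proof (rule Om.res_sum_eqI)
  note K = cring.cring_simprules[OF Quot_cring, unfolded Quot_zero]
  note cl = res_sum_carrierD(2)[OF f] and clv = res_sum_carrierD(2)[OF v]
  note Xv = V_ops_closed(1)[OF v, of IX] and Yf = V_ops_closed(2)[OF f, of JX]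
  fix m assume m: "m \<in> \<omega>"
  define n where "n = shift D 1 m"
  have n: "n \<in> \<omega>" "shift D (- 1) n = m" using m by (simp_all add: n_def orbit_shift orbit_shift_shift orbit_shift_0)
  have R: "res_sig D \<omega> (- 1) (pairing f (V_X D \<omega> S IX v)) m = shift D (- 1) (pairing f (V_X D \<omega> S IX v) n)"
    using m by (simp add: res_sig_def n_def)
  show "pairing (V_Y D \<omega> S JX f) v m = res_sig D \<omega> (- 1) (pairing f (V_X D \<omega> S IX v)) m"
  proof (cases "n \<in> S \<and> m \<in> S \<and> (telt D \<notin> m \<or> m \<in> IX)")
    case False
    then have "pairing (V_Y D \<omega> S JX f) v m = m"
    proof (cases "m \<in> S")
      case True
      then have "V_Y D \<omega> S JX f m = m"
        using False m IX by (auto simp: V_Y_at n_def[symmetric] inner_breaks_def breaks_iff)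
      then show ?thesis using pairing_zero_iff[OF Yf v True] by simp
    qed (simp add: m pairing_at)
    moreover have "pairing f (V_X D \<omega> S IX v) n = n"
    proof (cases "n \<in> S")
      case True
      then have "V_X D \<omega> S IX v n = n"
        using False n by (auto simp: V_X_at Let_def)
      then show ?thesis using pairing_zero_iff[OF f Xv True] by simp
    qed (simp add: n pairing_at)
    ultimately show ?thesis by (simp add: R n)
  next
    case True
    then have nS: "n \<in> S" and mS: "m \<in> S" and mI: "telt D \<notin> m \<or> m \<in> IX" by auto
    have bv: "bar D ` v m \<in> carrier (D Quot m)" by (rule bar_closed_at[OF v mS])
    have sbv: "shift D 1 (bar D ` v m) \<in> carrier (D Quot n)"
      using shift_orbit_Quot(3)[OF m bv, of 1] by (simp add: n_def)
    have Y: "V_Y D \<omega> S JX f m = shift D (- 1) (f n)"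
      using mS nS mI by (auto simp: V_Y_at n_def[symmetric])
    have dn: "shift D (- 1) (shift D 1 (d m)) = d m"
      using shift_orbit_Quot(1,2)[OF m d_closed[OF m]] by simp
    have sf: "shift D (- 1) (f n) \<in> carrier (D Quot m)"
      using shift_orbit_Quot(3)[OF n(1) cl[OF nS], of "- 1"] by (simp add: n)
    show ?thesis
    proof (cases "telt D \<in> m")
      case t: True
      then have "V_X D \<omega> S IX v n = shift D 1 (v m)"
        using mS nS mI n by (simp add: V_X_at Let_def)
      then have "shift D (- 1) (pairing f (V_X D \<omega> S IX v) n) =
        shift D (- 1) (d n) \<otimes>\<^bsub>D Quot m\<^esub> (shift D (- 1) (f n) \<otimes>\<^bsub>D Quot m\<^esub> bar D ` v m)"
        using shift_orbit_Quot(1,2)[OF m bv]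
        by (simp add: pairing_at nS bar_Quot(5)[OF m clv[OF mS] clv[OF mS]] shift_Quot_step n sbv cl
            d_closed K)
      moreover have "shift D (- 1) (d n) = d m"
        using dn d_break[OF m t] by (simp add: n_def)
      ultimately show ?thesis by (simp add: R pairing_at mS Y)
    next
      case t: False
      let ?c = "n +>\<^bsub>D\<^esub> sig D (telt D)"
      have c: "?c \<in> carrier (D Quot n)" by (simp add: coset_in_carrier sig_closed telt_closed)
      have "V_X D \<omega> S IX v n = shift D 1 ((m +>\<^bsub>D\<^esub> telt D) \<otimes>\<^bsub>D Quot m\<^esub> v m)"
        using mS nS n t by (simp add: V_X_at Let_def)
      then have "bar D ` V_X D \<omega> S IX v n = shift D 1 ((m +>\<^bsub>D\<^esub> telt D) \<otimes>\<^bsub>D Quot m\<^esub> bar D ` v m)"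
        using bar_Quot(5)[OF m, of "(m +>\<^bsub>D\<^esub> telt D) \<otimes>\<^bsub>D Quot m\<^esub> v m"
            "(m +>\<^bsub>D\<^esub> telt D) \<otimes>\<^bsub>D Quot m\<^esub> v m" 1]
          bar_Quot(3)[OF m coset_in_carrier[OF telt_closed] clv[OF mS]]
        by (simp add: bar_coset m telt_closed bar_telt K clv mS coset_in_carrier)
      then have "bar D ` V_X D \<omega> S IX v n = ?c \<otimes>\<^bsub>D Quot n\<^esub> shift D 1 (bar D ` v m)"
        using mS by (simp add: shift_Quot_step shift_coset_S coset_in_carrier telt_closed bv n_def sigpow_1)
      then have "pairing f (V_X D \<omega> S IX v) n =
          (d n \<otimes>\<^bsub>D Quot n\<^esub> ?c) \<otimes>\<^bsub>D Quot n\<^esub> (f n \<otimes>\<^bsub>D Quot n\<^esub> shift D 1 (bar D ` v m))"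
        using n(1) c sbv cl[OF nS] d_closed[OF n(1)] by (simp add: pairing_at nS K)
      \<comment> \<open>The rule for \<open>d\<close> absorbs \<sigma>(t): the product is the shift
        of \<open>d m\<close>, and the shift by -1 then undoes it.\<close>
      also have "d n \<otimes>\<^bsub>D Quot n\<^esub> ?c = shift D 1 (d m)"
        using d_unbroken[OF m t] by (simp add: n_def)
      finally have "shift D (- 1) (pairing f (V_X D \<omega> S IX v) n) =
          d m \<otimes>\<^bsub>D Quot m\<^esub> (shift D (- 1) (f n) \<otimes>\<^bsub>D Quot m\<^esub> bar D ` v m)"
        using shift_orbit_Quot(1,2)[OF m bv] shift_orbit_Quot(3)[OF m d_closed[OF m], of 1, folded n_def]
        by (simp add: shift_Quot_step nS n m sf bv sbv cl K dn d_closed)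
      then show ?thesis by (simp add: R pairing_at mS Y)
    qed
  qed
qed (auto intro!: pairing_closed res_sig_closed V_ops_closed f v)

end

section \<open>Weight spaces of V and the pairing as a model of the dual\<close>

context gwa_supportive
begin

lemma V_mod_simps:
  assumes "IX \<subseteq> inner_breaks D \<omega> S"
  shows "carrier (V_mod D \<omega> S IX) = carrier (res_sum D S)"
    "\<zero>\<^bsub>V_mod D \<omega> S IX\<^esub> = (\<lambda>n\<in>S. n)"
    "v \<oplus>\<^bsub>V_mod D \<omega> S IX\<^esub> w = v \<oplus>\<^bsub>res_sum D S\<^esub> w"
    "\<lbrakk>r \<in> carrier D; v \<in> carrier (res_sum D S)\<rbrakk> \<Longrightarrow> gwa_coef D r \<odot>\<^bsub>V_mod D \<omega> S IX\<^esub> v = r \<odot>\<^bsub>res_sum D S\<^esub> v"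
    "v \<in> carrier (res_sum D S) \<Longrightarrow> gwa_X D \<odot>\<^bsub>V_mod D \<omega> S IX\<^esub> v = V_X D \<omega> S IX v"
    "v \<in> carrier (res_sum D S) \<Longrightarrow> gwa_Y D \<odot>\<^bsub>V_mod D \<omega> S IX\<^esub> v = V_Y D \<omega> S IX v"
  using gwa_rep.gwa_module_simps[OF V_rep[OF assms]] gwa_rep.gwa_module_gens[OF V_rep[OF assms]]
  by (simp_all add: V_mod_def res_sum_simps)

text \<open>For n different from m the maximal ideal m is not contained in n, so some element of m
  is invertible on R/n and kills no nonzero component there.\<close>

lemma weight_space_V_mod:
  assumes IX: "IX \<subseteq> inner_breaks D \<omega> S" and m: "m \<in> Max_ideals D"
  shows "weight_space D (V_mod D \<omega> S IX) m = {v \<in> carrier (res_sum D S). \<forall>n\<in>S. n \<noteq> m \<longrightarrow> v n = n}"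
proof -
  interpret m: maximalideal m D using m by (simp add: Max_ideals_def)
  have "(\<forall>r\<in>m. gwa_coef D r \<odot>\<^bsub>V_mod D \<omega> S IX\<^esub> v = \<zero>\<^bsub>V_mod D \<omega> S IX\<^esub>) \<longleftrightarrow> (\<forall>n\<in>S. n \<noteq> m \<longrightarrow> v n = n)"
    if v: "v \<in> carrier (res_sum D S)" for v
  proof -
    have kill: "gwa_coef D r \<odot>\<^bsub>V_mod D \<omega> S IX\<^esub> v = \<zero>\<^bsub>V_mod D \<omega> S IX\<^esub> \<longleftrightarrow> (\<forall>n\<in>S. r \<in> n \<or> v n = n)"
      if "r \<in> m" for r
    proof -
      have r: "r \<in> carrier D" using that m.a_subset by auto
      have "(\<lambda>n\<in>S. (n +>\<^bsub>D\<^esub> r) \<otimes>\<^bsub>D Quot n\<^esub> v n) = (\<lambda>n\<in>S. n) \<longleftrightarrow>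
          (\<forall>n\<in>S. (n +>\<^bsub>D\<^esub> r) \<otimes>\<^bsub>D Quot n\<^esub> v n = n)"
        by (metis (mono_tags, lifting) restrict_apply' restrict_ext)
      then show ?thesis
        using r v coset_mult_zero_iff[OF S_in r res_sum_carrierD(2)[OF v]]
        by (auto simp: V_mod_simps[OF IX] res_sum_simps)
    qed
    have sep: "\<exists>r\<in>m. r \<notin> n" if "n \<in> S" "n \<noteq> m" for n
    proof -
      interpret n: maximalideal n D by (rule orbit_maximal[OF S_in[OF that(1)]])
      show ?thesis using m.I_maximal[OF n.is_ideal] n.a_subset n.I_notcarr that(2) by blast
    qed
    show ?thesis
    proof
      assume L: "\<forall>r\<in>m. gwa_coef D r \<odot>\<^bsub>V_mod D \<omega> S IX\<^esub> v = \<zero>\<^bsub>V_mod D \<omega> S IX\<^esub>"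
      show "\<forall>n\<in>S. n \<noteq> m \<longrightarrow> v n = n"
      proof (intro ballI impI)
        fix n assume n: "n \<in> S" "n \<noteq> m"
        obtain r where "r \<in> m" "r \<notin> n" using sep[OF n] by auto
        then show "v n = n" using L kill n(1) by metis
      qed
    next
      assume R: "\<forall>n\<in>S. n \<noteq> m \<longrightarrow> v n = n"
      show "\<forall>r\<in>m. gwa_coef D r \<odot>\<^bsub>V_mod D \<omega> S IX\<^esub> v = \<zero>\<^bsub>V_mod D \<omega> S IX\<^esub>"
      proof
        fix r assume r: "r \<in> m"
        show "gwa_coef D r \<odot>\<^bsub>V_mod D \<omega> S IX\<^esub> v = \<zero>\<^bsub>V_mod D \<omega> S IX\<^esub>"
          unfolding kill[OF r] using R r by metis
      qed
    qed
  qed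
  then show ?thesis unfolding weight_space_def V_mod_simps(1)[OF IX] by blast
qed

end

context gwa_pairing
begin

text \<open>By locality the n-component of a value depends only on the n-component of the argument,
  hence on the image of the unit vector at n. Dividing that image by d(n) gives \<open>f\<close>.
  The finiteness assumption is exactly the finite support of \<open>f\<close>.\<close>

lemma pairing_semilinear_repr:
  assumes \<phi>: "\<And>v. v \<in> carrier (res_sum D S) \<Longrightarrow> \<phi> v \<in> carrier (res_sum D \<omega>)"
    and add: "\<And>v w. \<lbrakk>v \<in> carrier (res_sum D S); w \<in> carrier (res_sum D S)\<rbrakk> \<Longrightarrow>
      \<phi> (v \<oplus>\<^bsub>res_sum D S\<^esub> w) = \<phi> v \<oplus>\<^bsub>res_sum D \<omega>\<^esub> \<phi> w"
    and semi: "\<And>r v. \<lbrakk>r \<in> carrier D; v \<in> carrier (res_sum D S)\<rbrakk> \<Longrightarrow>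
      \<phi> (r \<odot>\<^bsub>res_sum D S\<^esub> v) = bar D r \<odot>\<^bsub>res_sum D \<omega>\<^esub> \<phi> v"
    and fin: "finite {n \<in> S. \<phi> (single n \<one>\<^bsub>D Quot n\<^esub>) n \<noteq> n}"
  shows "\<exists>f\<in>carrier (res_sum D S). \<forall>v\<in>carrier (res_sum D S). \<phi> v = pairing f v"
proof -
  interpret M: module D "res_sum D S" by (rule res_sum_module)
  note one = one_Quot(1)
  let ?p = "\<lambda>n. \<phi> (single n \<one>\<^bsub>D Quot n\<^esub>) n"
  have p: "?p n \<in> carrier (D Quot n)" if "n \<in> S" for n
    using Om.res_sum_carrierD(2)[OF \<phi>[OF single_closed[OF one[OF that]]] S_in[OF that]] .
  have du: "d n \<in> Units (D Quot n)" if "n \<in> \<omega>" for n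
    using d_closed[OF that] d_nonzero[OF that] by (simp add: field.field_Units[OF Quot_field[OF that]] Quot_zero)
  define f where "f = (\<lambda>n\<in>S. inv\<^bsub>D Quot n\<^esub> d n \<otimes>\<^bsub>D Quot n\<^esub> ?p n)"
  have id: "inv\<^bsub>D Quot n\<^esub> d n \<in> carrier (D Quot n)"
      "d n \<otimes>\<^bsub>D Quot n\<^esub> inv\<^bsub>D Quot n\<^esub> d n = \<one>\<^bsub>D Quot n\<^esub>" if "n \<in> \<omega>" for n
    using du[OF that] monoid.Units_r_inv[of "D Quot n"] monoid.Units_inv_closed[of "D Quot n"]
      ring.axioms(2)[OF Quot_ring[OF that]] by auto
  have f: "f \<in> carrier (res_sum D S)"
    unfolding f_def
  proof (rule res_sum_restrictI)
    have "inv\<^bsub>D Quot n\<^esub> d n \<otimes>\<^bsub>D Quot n\<^esub> ?p n = n" if n: "n \<in> S" "?p n = n" for n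
      using cring.cring_simprules(27)[OF Quot_cring[OF S_in[OF n(1)]] id(1)[OF S_in[OF n(1)]]] n
      by (simp add: Quot_zero)
    then have "{n \<in> S. inv\<^bsub>D Quot n\<^esub> d n \<otimes>\<^bsub>D Quot n\<^esub> ?p n \<noteq> n} \<subseteq> {n \<in> S. ?p n \<noteq> n}"
      by blast
    then show "finite {n \<in> S. inv\<^bsub>D Quot n\<^esub> d n \<otimes>\<^bsub>D Quot n\<^esub> ?p n \<noteq> n}"
      using finite_subset[OF _ fin] by blast
    show "inv\<^bsub>D Quot n\<^esub> d n \<otimes>\<^bsub>D Quot n\<^esub> ?p n \<in> carrier (D Quot n)" if "n \<in> S" for n
      using ring.ring_simprules(5)[OF Quot_ring[OF S_in[OF that]] id(1)[OF S_in[OF that]] p[OF that]] .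
  qed
  have "\<phi> v = pairing f v" if v: "v \<in> carrier (res_sum D S)" for v
  proof (rule Om.res_sum_eqI[OF \<phi>[OF v] pairing_closed[OF f v]])
    fix n assume n: "n \<in> \<omega>"
    interpret K: field "D Quot n" by (rule Quot_field[OF n])
    show "\<phi> v n = pairing f v n"
    proof (cases "n \<in> S")
      case False
      then show ?thesis
        using semilinear_local[OF \<phi> semi v n] by (simp add: pairing_at n)
    next
      case nS: True
      note vn = res_sum_carrierD(2)[OF v nS]
      obtain a where a: "a \<in> carrier D" "v n = n +>\<^bsub>D\<^esub> a" using vn by (auto simp: coset_carrier_iff)
      \<comment> \<open>Split off the n-component of v: the remainder \<open>?u\<close> vanishes at
        n, so by locality its image does too, and only a multiple of the unit vector is
        left.\<close>
      let ?s = "a \<odot>\<^bsub>res_sum D S\<^esub> single n \<one>\<^bsub>D Quot n\<^esub>"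
      have sc: "?s \<in> carrier (res_sum D S)" by (intro M.smult_closed a single_closed one nS)
      let ?u = "v \<ominus>\<^bsub>res_sum D S\<^esub> ?s"
      have u: "?u \<in> carrier (res_sum D S)" using sc v by (rule M.M.minus_closed[rotated])
      have vu: "v = ?u \<oplus>\<^bsub>res_sum D S\<^esub> ?s"
        using sc v by (simp add: M.M.minus_eq M.M.add.m_assoc M.M.l_neg)
      have sn: "?s n = v n"
        using nS a vn by (simp add: single_smult one single_apply)
      have "v n = ?u n \<oplus>\<^bsub>D Quot n\<^esub> v n"
      proof -
        have "(g \<oplus>\<^bsub>res_sum D S\<^esub> h) n = g n \<oplus>\<^bsub>D Quot n\<^esub> h n" for g h
          using nS by (simp add: res_sum_simps)
        from trans[OF fun_cong[OF vu, of n] this] show ?thesis unfolding sn .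
      qed
      then have "?u n = n"
        using K.add.r_cancel_one'[OF vn res_sum_carrierD(2)[OF u nS]] by (simp add: Quot_zero)
      then have un: "\<phi> ?u n = n"
        by (intro semilinear_local[OF \<phi> semi u n])
      have "\<phi> v = \<phi> ?u \<oplus>\<^bsub>res_sum D \<omega>\<^esub> \<phi> ?s" using add[OF u sc] vu by simp
      then have "\<phi> v n = \<phi> ?u n \<oplus>\<^bsub>D Quot n\<^esub> \<phi> ?s n" using n by (simp add: Om.res_sum_simps)
      also have "\<phi> ?s n = (n +>\<^bsub>D\<^esub> bar D a) \<otimes>\<^bsub>D Quot n\<^esub> ?p n"
        using semi[OF a(1) single_closed[OF one[OF nS]]] n by (simp add: Om.res_sum_simps)
      also have "\<phi> ?u n \<oplus>\<^bsub>D Quot n\<^esub> \<dots> = (n +>\<^bsub>D\<^esub> bar D a) \<otimes>\<^bsub>D Quot n\<^esub> ?p n"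
        using K.l_zero[OF K.m_closed[OF coset_in_carrier[OF bar_closed[OF a(1)]] p[OF nS]]]
        by (simp add: un Quot_zero)
      also have "\<dots> = d n \<otimes>\<^bsub>D Quot n\<^esub> (inv\<^bsub>D Quot n\<^esub> d n \<otimes>\<^bsub>D Quot n\<^esub> ?p n \<otimes>\<^bsub>D Quot n\<^esub> (n +>\<^bsub>D\<^esub> bar D a))"
      proof -
        let ?c = "n +>\<^bsub>D\<^esub> bar D a"
        have c: "?c \<in> carrier (D Quot n)" by (rule coset_in_carrier[OF bar_closed[OF a(1)]])
        have "d n \<otimes>\<^bsub>D Quot n\<^esub> (inv\<^bsub>D Quot n\<^esub> d n \<otimes>\<^bsub>D Quot n\<^esub> ?p n \<otimes>\<^bsub>D Quot n\<^esub> ?c) =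
            (d n \<otimes>\<^bsub>D Quot n\<^esub> inv\<^bsub>D Quot n\<^esub> d n) \<otimes>\<^bsub>D Quot n\<^esub> (?p n \<otimes>\<^bsub>D Quot n\<^esub> ?c)"
          using id(1)[OF n] d_closed[OF n] p[OF nS] c by (simp add: K.m_assoc)
        also have "\<dots> = ?c \<otimes>\<^bsub>D Quot n\<^esub> ?p n"
          using id(2)[OF n] p[OF nS] c by (simp add: K.m_comm)
        finally show ?thesis by simp
      qed
      also have "\<dots> = pairing f v n"
        using nS a by (simp add: pairing_at f_def bar_coset n)
      finally show ?thesis .
    qed
  qed
  then show ?thesis using f by blast
qed

definition to_dual :: "('a set \<Rightarrow> 'a set) \<Rightarrow> ('a set \<Rightarrow> 'a set) \<Rightarrow> 'a set \<Rightarrow> 'a set" where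
  "to_dual f = (\<lambda>v\<in>carrier (res_sum D S). pairing f v)"

lemma fdual_res_carrier_iff:
  "\<phi> \<in> carrier (fdual_res D \<omega> V) \<longleftrightarrow> \<phi> \<in> carrier (res_sum D S) \<rightarrow>\<^sub>E carrier (res_sum D \<omega>) \<and>
    (\<forall>v\<in>carrier (res_sum D S). \<forall>w\<in>carrier (res_sum D S).
      \<phi> (v \<oplus>\<^bsub>res_sum D S\<^esub> w) = \<phi> v \<oplus>\<^bsub>res_sum D \<omega>\<^esub> \<phi> w) \<and>
    (\<forall>r\<in>carrier D. \<forall>v\<in>carrier (res_sum D S). \<phi> (r \<odot>\<^bsub>res_sum D S\<^esub> v) = bar D r \<odot>\<^bsub>res_sum D \<omega>\<^esub> \<phi> v) \<and>
    finite {m \<in> \<omega>. \<exists>v\<in>weight_space D V m. \<phi> v \<noteq> (\<lambda>n\<in>\<omega>. n)}"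
  by (simp add: fdual_res_def V_mod_simps[OF IX] Om.res_sum_simps)

text \<open>The finiteness condition on dual vectors matches finite support of \<open>f\<close>. The
  functional of \<open>f\<close> is nonzero on a weight space only where \<open>f\<close> is
  nonzero; conversely, a unit vector whose image is nonzero at its own weight exhibits a weight
  space that is not killed.\<close>

lemma to_dual_bij: "bij_betw to_dual (carrier (res_sum D S)) (carrier (fdual_res D \<omega> V))"
proof (rule bij_betw_imageI)
  note one = one_Quot(1)
  have Max: "n \<in> \<omega> \<Longrightarrow> n \<in> Max_ideals D" for n
    by (simp add: Max_ideals_def orbit_maximal)
  show "inj_on to_dual (carrier (res_sum D S))"
  proof (rule inj_onI)
    fix f g assume f: "f \<in> carrier (res_sum D S)" and g: "g \<in> carrier (res_sum D S)" and eq: "to_dual f = to_dual g"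
    show "f = g"
    proof (rule res_sum_eqI[OF f g])
      fix n assume n: "n \<in> S"
      interpret K: field "D Quot n" by (rule Quot_field[OF S_in[OF n]])
      let ?s = "single n \<one>\<^bsub>D Quot n\<^esub>"
      have "pairing f ?s n = pairing g ?s n"
        using fun_cong[OF eq, of ?s] single_closed[OF one[OF n]] by (simp add: to_dual_def)
      moreover have "bar D ` \<one>\<^bsub>D Quot n\<^esub> = \<one>\<^bsub>D Quot n\<^esub>"
        using S_in[OF n] by (simp add: Quot_one bar_coset ring_hom_one[OF bar_hom])
      ultimately have "d n \<otimes>\<^bsub>D Quot n\<^esub> f n = d n \<otimes>\<^bsub>D Quot n\<^esub> g n"
        using n res_sum_carrierD(2)[OF f n] res_sum_carrierD(2)[OF g n] by (simp add: pairing_at single_apply)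
      then show "f n = g n"
        using K.m_lcancel[OF _ d_closed[OF S_in[OF n]] res_sum_carrierD(2)[OF f n] res_sum_carrierD(2)[OF g n]]
          d_nonzero[OF S_in[OF n]] by (simp add: Quot_zero)
    qed
  qed
  have "to_dual f \<in> carrier (fdual_res D \<omega> V)" if f: "f \<in> carrier (res_sum D S)" for f
  proof -
    have "{m \<in> \<omega>. \<exists>v\<in>weight_space D V m. to_dual f v \<noteq> (\<lambda>n\<in>\<omega>. n)} \<subseteq> {n \<in> S. f n \<noteq> n}"
    proof clarify
      fix m v assume m: "m \<in> \<omega>" and v: "v \<in> weight_space D V m" and ne: "to_dual f v \<noteq> (\<lambda>n\<in>\<omega>. n)"
      have v': "v \<in> carrier (res_sum D S)" "\<And>n. \<lbrakk>n \<in> S; n \<noteq> m\<rbrakk> \<Longrightarrow> v n = n"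
        using v by (simp_all add: weight_space_V_mod[OF IX Max[OF m]])
      have "\<exists>n\<in>\<omega>. pairing f v n \<noteq> n"
      proof (rule ccontr)
        assume "\<not> ?thesis"
        then have "pairing f v = (\<lambda>n\<in>\<omega>. n)"
          by (intro ext) (auto simp: pairing_def)
        then show False using ne v'(1) by (simp add: to_dual_def)
      qed
      then obtain n where "n \<in> \<omega>" "pairing f v n \<noteq> n" by blast
      then show "m \<in> S \<and> f m \<noteq> m"
        using pairing_zero_iff[OF f v'(1)] v'(2) pairing_at(2) by metis
    qed
    then have "finite {m \<in> \<omega>. \<exists>v\<in>weight_space D V m. to_dual f v \<noteq> (\<lambda>n\<in>\<omega>. n)}"
      using res_sum_carrierD(3)[OF f] finite_subset by blast
    then show ?thesis
      using f unfolding fdual_res_carrier_iff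
      by (auto simp: to_dual_def res_sum_closed(1)[OF _ _ zero_closed] res_sum_closed(2)
          pairing_add_right pairing_smult_right intro: pairing_closed)
  qed
  moreover have "\<phi> \<in> to_dual ` carrier (res_sum D S)" if "\<phi> \<in> carrier (fdual_res D \<omega> V)" for \<phi>
  proof -
    note \<phi> = that[unfolded fdual_res_carrier_iff]
    have "{n \<in> S. \<phi> (single n \<one>\<^bsub>D Quot n\<^esub>) n \<noteq> n} \<subseteq>
      {m \<in> \<omega>. \<exists>v\<in>weight_space D V m. \<phi> v \<noteq> (\<lambda>n\<in>\<omega>. n)}"
    proof clarify
      fix n assume n: "n \<in> S" "\<phi> (single n \<one>\<^bsub>D Quot n\<^esub>) n \<noteq> n"
      have "single n \<one>\<^bsub>D Quot n\<^esub> \<in> weight_space D V n"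
        by (simp add: weight_space_V_mod[OF IX Max[OF S_in[OF n(1)]]] single_closed one n single_apply)
      then show "n \<in> \<omega> \<and> (\<exists>v\<in>weight_space D V n. \<phi> v \<noteq> (\<lambda>n\<in>\<omega>. n))"
        using n S_in[OF n(1)] by (metis restrict_apply')
    qed
    then have fin: "finite {n \<in> S. \<phi> (single n \<one>\<^bsub>D Quot n\<^esub>) n \<noteq> n}"
      using \<phi> finite_subset by blast
    have "\<exists>f\<in>carrier (res_sum D S). \<forall>v\<in>carrier (res_sum D S). \<phi> v = pairing f v"
      by (rule pairing_semilinear_repr) (use \<phi> fin in \<open>auto simp: PiE_iff\<close>)
    then obtain f where f: "f \<in> carrier (res_sum D S)" "\<And>v. v \<in> carrier (res_sum D S) \<Longrightarrow> \<phi> v = pairing f v"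
      by blast
    have "\<phi> = to_dual f"
      using \<phi> f(2) by (intro ext) (auto simp: to_dual_def PiE_iff extensional_def)
    then show ?thesis using f(1) by blast
  qed
  ultimately show "to_dual ` carrier (res_sum D S) = carrier (fdual_res D \<omega> V)" by blast
qed

lemma JX: "JX \<subseteq> inner_breaks D \<omega> S"
  by auto

text \<open>\<open>pairing_X\<close> and \<open>pairing_Y\<close> say that \<open>to_dual\<close>
  carries X and Y with index set \<open>JX\<close> to the operators of the dual. Transport then
  yields both the module structure of the dual and the isomorphism.\<close>

lemma fdual_iso: "left_modules_iso (gwa D) (fdual D \<omega> V) (V_mod D \<omega> S JX)"
  unfolding fdual_def V_mod_def[of D \<omega> S JX]
proof (rule gwa_rep_transport(2)[OF V_rep[OF JX] to_dual_bij])
  have ext: "to_dual f v = pairing f v" if "v \<in> carrier (res_sum D S)" for f v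
    using that by (simp add: to_dual_def)
  show "to_dual \<zero>\<^bsub>res_sum D S\<^esub> = \<zero>\<^bsub>fdual_res D \<omega> V\<^esub>"
  proof -
    have "pairing \<zero>\<^bsub>res_sum D S\<^esub> v = \<zero>\<^bsub>res_sum D \<omega>\<^esub>" if "v \<in> carrier (res_sum D S)" for v
    proof (rule Om.res_sum_eqI[OF pairing_closed[OF res_sum_zero_closed that] Om.res_sum_zero_closed])
      show "pairing \<zero>\<^bsub>res_sum D S\<^esub> v n = \<zero>\<^bsub>res_sum D \<omega>\<^esub> n" if "n \<in> \<omega>" for n
        using pairing_zero_iff[OF res_sum_zero_closed \<open>v \<in> _\<close>, of n] that
        by (cases "n \<in> S") (simp_all add: pairing_at(2) res_sum_simps Om.res_sum_simps)
    qed
    then show ?thesis by (auto simp: to_dual_def fdual_res_def V_mod_simps[OF IX] intro!: restrict_ext)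
  qed
  fix f assume f: "f \<in> carrier (res_sum D S)"
  show "to_dual (V_X D \<omega> S JX f) =
      (\<lambda>v\<in>carrier V. res_sig D \<omega> 1 (to_dual f (gwa_Y D \<odot>\<^bsub>V\<^esub> v)))"
    using f by (auto simp: to_dual_def V_mod_simps[OF IX] V_ops_closed pairing_X intro!: restrict_ext)
  show "to_dual (V_Y D \<omega> S JX f) =
      (\<lambda>v\<in>carrier V. res_sig D \<omega> (- 1) (to_dual f (gwa_X D \<odot>\<^bsub>V\<^esub> v)))"
    using f by (auto simp: to_dual_def V_mod_simps[OF IX] V_ops_closed pairing_Y intro!: restrict_ext)
  show "to_dual (r \<odot>\<^bsub>res_sum D S\<^esub> f) = r \<odot>\<^bsub>fdual_res D \<omega> V\<^esub> to_dual f" if r: "r \<in> carrier D" for r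
    using f r by (auto simp: to_dual_def fdual_res_def V_mod_simps[OF IX] bar_closed res_sum_closed(2)
        pairing_smult_left pairing_smult_right bar_bar intro!: restrict_ext)
  show "to_dual (f \<oplus>\<^bsub>res_sum D S\<^esub> g) = to_dual f \<oplus>\<^bsub>fdual_res D \<omega> V\<^esub> to_dual g"
    if g: "g \<in> carrier (res_sum D S)" for g
    using f g by (auto simp: to_dual_def fdual_res_def V_mod_simps[OF IX] pairing_add_left intro!: restrict_ext)
qed

end

section \<open>Weight decomposition and admissible forms\<close>

context gwa_supportive
begin

lemma single_nonzero: "\<lbrakk>n \<in> S; a \<noteq> n\<rbrakk> \<Longrightarrow> single n a \<noteq> (\<lambda>k\<in>S. k)"
  by (metis restrict_apply' single_apply)

lemma nonzero_component:
  assumes "v \<in> carrier (res_sum D S)" "v \<noteq> (\<lambda>n\<in>S. n)"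
  obtains n where "n \<in> S" "v n \<noteq> n"
proof -
  have "\<exists>n\<in>S. v n \<noteq> n"
  proof (rule ccontr)
    assume "\<not> ?thesis"
    then have "v = (\<lambda>n\<in>S. n)"
      using res_sum_carrierD(1)[OF assms(1)] by (intro extensionalityI[of _ S]) auto
    then show False using assms(2) by simp
  qed
  then show thesis using that by blast
qed

lemma finsum_weights_at:
  assumes "finite A" and "\<And>m. m \<in> A \<Longrightarrow> h m \<in> carrier (res_sum D S)"
    and "\<And>m k. \<lbrakk>m \<in> A; k \<in> S; k \<noteq> m\<rbrakk> \<Longrightarrow> h m k = k" and n: "n \<in> S"
  shows "(\<Oplus>\<^bsub>res_sum D S\<^esub>m\<in>A. h m) n = (if n \<in> A then h n n else n)"
  using assms(1-3)
proof (induction A rule: finite_induct)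
  case empty
  interpret M: module D "res_sum D S" by (rule res_sum_module)
  show ?case using n by (simp add: res_sum_simps)
next
  case (insert m A)
  interpret M: module D "res_sum D S" by (rule res_sum_module)
  interpret K: field "D Quot n" by (rule Quot_field[OF S_in[OF n]])
  have "(\<Oplus>\<^bsub>res_sum D S\<^esub>m\<in>insert m A. h m) = h m \<oplus>\<^bsub>res_sum D S\<^esub> (\<Oplus>\<^bsub>res_sum D S\<^esub>m\<in>A. h m)"
    using insert by (intro M.M.finsum_insert) auto
  then have "(\<Oplus>\<^bsub>res_sum D S\<^esub>m\<in>insert m A. h m) n = h m n \<oplus>\<^bsub>D Quot n\<^esub> (if n \<in> A then h n n else n)"
    using insert n by (simp add: res_sum_simps)
  moreover have "h m n \<in> carrier (D Quot n)" "n \<in> A \<Longrightarrow> h n n \<in> carrier (D Quot n)"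
    using insert n by (auto intro: res_sum_carrierD(2))
  moreover have "n \<noteq> m \<Longrightarrow> h m n = n"
    using insert.prems(2)[of m n] n by auto
  ultimately show ?case using insert.hyps K.l_zero K.r_zero
    by (cases "n = m") (auto simp: Quot_zero)
qed

lemma weight_module_V_mod:
  assumes IX: "IX \<subseteq> inner_breaks D \<omega> S"
  shows "weight_module D (V_mod D \<omega> S IX)" "Supp D (V_mod D \<omega> S IX) \<subseteq> \<omega>"
proof -
  let ?V = "V_mod D \<omega> S IX"
  have S_Max: "n \<in> Max_ideals D" if "n \<in> S" for n
    using orbit_maximal[OF S_in[OF that]] by (simp add: Max_ideals_def)
  \<comment> \<open>Sums depend only on the additive structure, which passes to the A-module
    unchanged.\<close>
  have fs: "finsum ?V = finsum (res_sum D S)"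
    by (intro ext) (simp add: finsum_def finprod_def V_mod_def gwa_module_def)
  note ws = weight_space_V_mod[OF IX] and simps = V_mod_simps(1,2)[OF IX]
  show "weight_module D ?V"
    unfolding weight_module_def
  proof (intro conjI ballI)
    show "left_module (gwa D) ?V"
      unfolding V_mod_def by (rule gwa_rep.left_module_gwa_module[OF V_rep[OF IX]])
    fix v assume "v \<in> carrier ?V"
    then have v: "v \<in> carrier (res_sum D S)" by (simp add: simps)
    let ?Q = "\<lambda>f. f \<in> (\<Pi>\<^sub>E m\<in>Max_ideals D. weight_space D ?V m) \<and>
      finite {m \<in> Max_ideals D. f m \<noteq> \<zero>\<^bsub>?V\<^esub>} \<and> v = (\<Oplus>\<^bsub>?V\<^esub>m\<in>{m \<in> Max_ideals D. f m \<noteq> \<zero>\<^bsub>?V\<^esub>}. f m)"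
    define g where "g = (\<lambda>m\<in>Max_ideals D. if m \<in> S then single m (v m) else (\<lambda>n\<in>S. n))"
    have gS: "g m = single m (v m)" if "m \<in> S" for m using that S_Max by (simp add: g_def)
    have gw: "g m \<in> weight_space D ?V m" if "m \<in> Max_ideals D" for m
      using that res_sum_zero_closed res_sum_carrierD(2)[OF v]
      by (auto simp: ws g_def single_apply res_sum_simps intro: single_closed)
    \<comment> \<open>The index set in the definition of a weight module is thus the support of v,
      which is finite.\<close>
    have gA: "{m \<in> Max_ideals D. g m \<noteq> \<zero>\<^bsub>?V\<^esub>} = {m \<in> S. v m \<noteq> m}"
    proof -
      have "g m \<noteq> \<zero>\<^bsub>?V\<^esub> \<longleftrightarrow> v m \<noteq> m" if "m \<in> S" for m
      proof (cases "v m = m")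
        case True
        then have "single m (v m) = (\<lambda>n\<in>S. n)" by (auto simp: single_def intro!: restrict_ext)
        then show ?thesis using True that by (simp add: gS simps)
      next
        case False
        then show ?thesis using single_nonzero[OF that False] that by (simp add: gS simps)
      qed
      then show ?thesis using S_Max by (auto simp: g_def simps)
    qed
    have Qg: "?Q g"
    proof (intro conjI)
      show "g \<in> (\<Pi>\<^sub>E m\<in>Max_ideals D. weight_space D ?V m)" using gw by (auto simp: g_def)
      show fin: "finite {m \<in> Max_ideals D. g m \<noteq> \<zero>\<^bsub>?V\<^esub>}" unfolding gA by (rule res_sum_carrierD(3)[OF v])
      have gc: "g m \<in> carrier (res_sum D S)" if "m \<in> S" for m
        using that res_sum_carrierD(2)[OF v that] by (simp add: gS single_closed)
      show "v = (\<Oplus>\<^bsub>?V\<^esub>m\<in>{m \<in> Max_ideals D. g m \<noteq> \<zero>\<^bsub>?V\<^esub>}. g m)"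
        unfolding gA fs
      proof (rule res_sum_eqI[OF v])
        interpret M: module D "res_sum D S" by (rule res_sum_module)
        show "(\<Oplus>\<^bsub>res_sum D S\<^esub>m\<in>{m \<in> S. v m \<noteq> m}. g m) \<in> carrier (res_sum D S)"
          using gc by (intro M.M.finsum_closed) auto
        fix n assume n: "n \<in> S"
        have "(\<Oplus>\<^bsub>res_sum D S\<^esub>m\<in>{m \<in> S. v m \<noteq> m}. g m) n = (if n \<in> {m \<in> S. v m \<noteq> m} then g n n else n)"
          by (rule finsum_weights_at[OF res_sum_carrierD(3)[OF v] _ _ n])
            (use gc in blast, simp add: gS single_apply)
        then show "v n = (\<Oplus>\<^bsub>res_sum D S\<^esub>m\<in>{m \<in> S. v m \<noteq> m}. g m) n"
          using n by (auto simp: gS single_apply)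
      qed
    qed
    show "\<exists>!f. ?Q f"
    proof (rule ex1I[of ?Q, OF Qg])
      fix f assume Qf: "?Q f"
      then have f: "f m \<in> weight_space D ?V m" if "m \<in> Max_ideals D" for m
        using that by blast
      have fc: "f m \<in> carrier (res_sum D S)" "\<And>k. \<lbrakk>k \<in> S; k \<noteq> m\<rbrakk> \<Longrightarrow> f m k = k" if "m \<in> Max_ideals D" for m
        using f[OF that] by (simp_all add: ws[OF that])
      \<comment> \<open>Uniqueness: only the summand of weight n reaches the n-component, so v
        determines every summand.\<close>
      have vn: "v n = f n n" if n: "n \<in> S" for n
      proof -
        let ?A = "{m \<in> Max_ideals D. f m \<noteq> \<zero>\<^bsub>?V\<^esub>}"
        have "(\<Oplus>\<^bsub>res_sum D S\<^esub>m\<in>?A. f m) n = (if n \<in> ?A then f n n else n)"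
          by (rule finsum_weights_at[OF _ _ _ n]) (use Qf fc in auto)
        moreover have "v = (\<Oplus>\<^bsub>res_sum D S\<^esub>m\<in>?A. f m)" using Qf by (simp add: fs)
        moreover have "n \<notin> ?A \<Longrightarrow> f n n = n" using n S_Max by (auto simp: simps)
        ultimately show ?thesis by (metis (full_types))
      qed
      show "f = g"
      proof (rule extensionalityI[of _ "Max_ideals D"])
        show "f \<in> extensional (Max_ideals D)" "g \<in> extensional (Max_ideals D)"
          using Qf by (auto simp: PiE_def g_def)
        fix m assume m: "m \<in> Max_ideals D"
        have gm: "g m \<in> carrier (res_sum D S)" "\<And>k. \<lbrakk>k \<in> S; k \<noteq> m\<rbrakk> \<Longrightarrow> g m k = k"
          using gw[OF m] by (simp_all add: ws[OF m])
        show "f m = g m"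
        proof (rule res_sum_eqI[OF fc(1)[OF m] gm(1)])
          fix k assume k: "k \<in> S"
          show "f m k = g m k"
            by (cases "k = m") (use k m fc(2) gm(2) vn in \<open>auto simp: gS single_apply\<close>)
        qed
      qed
    qed
  qed
  show "Supp D ?V \<subseteq> \<omega>"
  proof
    fix m assume "m \<in> Supp D ?V"
    then have m: "m \<in> Max_ideals D" "weight_space D ?V m \<noteq> {\<zero>\<^bsub>?V\<^esub>}" by (auto simp: Supp_def)
    have "m \<in> S"
    proof (rule ccontr)
      assume "m \<notin> S"
      then have "weight_space D ?V m = {\<lambda>n\<in>S. n}"
        using res_sum_zero_closed nonzero_component
        by (auto simp: ws[OF m(1)] res_sum_simps) metis+
      then show False using m(2) by (simp add: simps)
    qed
    then show "m \<in> \<omega>" by (rule S_in)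
  qed
qed

end

lemma additive_map_minus:
  fixes A (structure) and B (structure)
  assumes "abelian_group A" "abelian_group B" and h: "\<And>a. a \<in> carrier A \<Longrightarrow> h a \<in> carrier B"
    and add: "\<And>a b. \<lbrakk>a \<in> carrier A; b \<in> carrier A\<rbrakk> \<Longrightarrow> h (a \<oplus>\<^bsub>A\<^esub> b) = h a \<oplus>\<^bsub>B\<^esub> h b"
  shows "h \<zero>\<^bsub>A\<^esub> = \<zero>\<^bsub>B\<^esub>"
    "\<lbrakk>a \<in> carrier A; b \<in> carrier A\<rbrakk> \<Longrightarrow> h (a \<ominus>\<^bsub>A\<^esub> b) = h a \<ominus>\<^bsub>B\<^esub> h b"
proof -
  interpret abelian_group_hom A B h
    by (rule abelian_group_homI[OF assms(1,2)]) (simp add: group_hom_def group_hom_axioms_def hom_def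
        abelian_group.a_group assms)
  show "h \<zero>\<^bsub>A\<^esub> = \<zero>\<^bsub>B\<^esub>" by simp
  show "\<lbrakk>a \<in> carrier A; b \<in> carrier A\<rbrakk> \<Longrightarrow> h (a \<ominus>\<^bsub>A\<^esub> b) = h a \<ominus>\<^bsub>B\<^esub> h b"
    by (simp add: G.minus_eq H.minus_eq)
qed

section \<open>The pairing as a form when there are no inner breaks\<close>

context gwa_pairing
begin

text \<open>Without inner breaks \<open>IX\<close> and \<open>JX\<close> are both empty, so the two
  modules paired coincide and the adjunctions become those of a form. They are then extended from
  letters to words and from words to homogeneous elements.\<close>

lemma pairing_admissible:
  assumes none: "inner_breaks D \<omega> S = {}"
  shows "admissible_form D \<omega> V pairing"
proof -
  interpret rep: gwa_rep D "res_sum D S" "V_X D \<omega> S IX" "V_Y D \<omega> S IX"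
    by (rule V_rep[OF IX])
  interpret OmM: module D "res_sum D \<omega>" by (rule Om.res_sum_module)
  have JX_IX: "JX = IX" using none IX by auto
  note pX = pairing_X[unfolded JX_IX] and pY = pairing_Y[unfolded JX_IX]
  note cl = res_sum_closed V_ops_closed pairing_closed
  have pr: "pairing (r \<odot>\<^bsub>res_sum D S\<^esub> v) u = pairing v (bar D r \<odot>\<^bsub>res_sum D S\<^esub> u)"
    if "r \<in> carrier D" "v \<in> carrier (res_sum D S)" "u \<in> carrier (res_sum D S)" for r v u
    using that by (simp add: pairing_smult_left pairing_smult_right bar_closed bar_bar)
  have gen: "pairing (gen_action (res_sum D S) (V_X D \<omega> S IX) (V_Y D \<omega> S IX) g v) u =
      res_sig D \<omega> (gen_deg g) (pairing v (gen_action (res_sum D S) (V_X D \<omega> S IX) (V_Y D \<omega> S IX) (gen_star D g) u))"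
    if "g \<in> Coef ` carrier D \<union> {GX, GY}" "v \<in> carrier (res_sum D S)" "u \<in> carrier (res_sum D S)" for g v u
    using that by (auto simp: pX pY pr res_sig_0 cl bar_closed)
  \<comment> \<open>The outermost letter on the left moves over first and becomes the innermost one
    on the right, which accounts for the reversal; the degrees add up through
    \<open>res_sig_add\<close>.\<close>
  have word: "pairing (rep.wact w v) u =
      res_sig D \<omega> (sum_list (map gen_deg w)) (pairing v (rep.wact (rev (map (gen_star D) w)) u))"
    if "w \<in> free_words D" "v \<in> carrier (res_sum D S)" "u \<in> carrier (res_sum D S)" for w v u
    using that
  proof (induction w arbitrary: u)
    case Nil
    then show ?case by (simp add: res_sig_0 cl)
  next
    case (Cons g w)
    then have g: "g \<in> Coef ` carrier D \<union> {GX, GY}" and w: "w \<in> free_words D"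
      by (simp_all add: free_words_simps)
    let ?u = "gen_action (res_sum D S) (V_X D \<omega> S IX) (V_Y D \<omega> S IX) (gen_star D g) u"
    have u: "?u \<in> carrier (res_sum D S)"
      using g Cons.prems(3) by (auto simp: cl bar_closed intro!: rep.Mod.smult_closed)
    have "word (rev (map (gen_star D) w)) \<in> carrier (free_ring D)"
      using free_star_closed[OF gwa_setup_axioms, of "word w"] w by (simp add: free_star_word word_in_free_ring)
    then have w': "rev (map (gen_star D) w) \<in> free_words D" by (simp add: word_in_free_ring)
    have "pairing (rep.wact (g # w) v) u = res_sig D \<omega> (gen_deg g) (pairing (rep.wact w v) ?u)"
      using gen[OF g rep.wact_closed[OF w Cons.prems(2)] Cons.prems(3)] by simp
    also have "\<dots> = res_sig D \<omega> (gen_deg g) (res_sig D \<omega> (sum_list (map gen_deg w))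
        (pairing v (rep.wact (rev (map (gen_star D) w)) ?u)))"
      using Cons.IH[OF w Cons.prems(2) u] by simp
    also have "\<dots> = res_sig D \<omega> (sum_list (map gen_deg (g # w))) (pairing v (rep.wact (rev (map (gen_star D) (g # w))) u))"
      using rep.wact_closed[OF w' u] Cons.prems(2) by (simp add: res_sig_add cl)
    finally show ?case .
  qed
  \<comment> \<open>Homogeneity enters here: all words share the degree k, so a single power of
    \<sigma> serves every term and additivity finishes.\<close>
  have poly: "p \<in> carrier (free_ring D) \<and> (\<forall>v\<in>carrier (res_sum D S). \<forall>u\<in>carrier (res_sum D S).
      pairing (rep.act p v) u = res_sig D \<omega> k (pairing v (rep.act (free_star D p) u)))"
    if "Poly_Mapping.keys p \<subseteq> {w \<in> free_words D. sum_list (map gen_deg w) = k}" for p k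
    using that
  proof (induction rule: frag_induction)
    have l: "pairing \<zero>\<^bsub>res_sum D S\<^esub> u = \<zero>\<^bsub>res_sum D \<omega>\<^esub>" "pairing u \<zero>\<^bsub>res_sum D S\<^esub> = \<zero>\<^bsub>res_sum D \<omega>\<^esub>"
      if "u \<in> carrier (res_sum D S)" for u
      using that by (auto intro!: additive_map_minus(1)[OF rep.Mod.abelian_group_axioms OmM.abelian_group_axioms]
          simp: pairing_closed pairing_add_left pairing_add_right)
    have s: "res_sig D \<omega> k \<zero>\<^bsub>res_sum D \<omega>\<^esub> = \<zero>\<^bsub>res_sum D \<omega>\<^esub>"
      by (rule additive_map_minus(1)[OF OmM.abelian_group_axioms OmM.abelian_group_axioms])
        (simp_all add: res_sig_closed res_sig_plus)
    case zero
    show ?case by (simp add: zero_in_free_ring free_star_zero rep.act_zero l s)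
  next
    case (one w)
    have "word (rev (map (gen_star D) w)) \<in> carrier (free_ring D)"
      using free_star_closed[OF gwa_setup_axioms, of "word w"] one by (simp add: free_star_word word_in_free_ring)
    then show ?case using one word
      by (auto simp: word_in_free_ring free_star_word rep.act_word)
  next
    case (diff p q)
    note st = free_star_closed[OF gwa_setup_axioms]
    have l: "pairing (a \<ominus>\<^bsub>res_sum D S\<^esub> b) u = pairing a u \<ominus>\<^bsub>res_sum D \<omega>\<^esub> pairing b u"
      "pairing u (a \<ominus>\<^bsub>res_sum D S\<^esub> b) = pairing u a \<ominus>\<^bsub>res_sum D \<omega>\<^esub> pairing u b"
      if "u \<in> carrier (res_sum D S)" "a \<in> carrier (res_sum D S)" "b \<in> carrier (res_sum D S)" for u a b
      using that by (auto intro!: additive_map_minus(2)[OF rep.Mod.abelian_group_axioms OmM.abelian_group_axioms]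
          simp: pairing_closed pairing_add_left pairing_add_right)
    have s: "res_sig D \<omega> k (a \<ominus>\<^bsub>res_sum D \<omega>\<^esub> b) = res_sig D \<omega> k a \<ominus>\<^bsub>res_sum D \<omega>\<^esub> res_sig D \<omega> k b"
      if "a \<in> carrier (res_sum D \<omega>)" "b \<in> carrier (res_sum D \<omega>)" for a b
      using that by (intro additive_map_minus(2)[OF OmM.abelian_group_axioms OmM.abelian_group_axioms])
        (simp_all add: res_sig_closed res_sig_plus)
    show ?case using diff
      by (auto simp: free_ring_closed free_star_diff st rep.act_diff rep.act_closed l s pairing_closed)
  qed
  show ?thesis
    unfolding admissible_form_def V_mod_simps[OF IX]
  proof (intro conjI ballI allI)
    fix n a v w assume a: "a \<in> gwa_component D n" and v: "v \<in> carrier (res_sum D S)" and w: "w \<in> carrier (res_sum D S)"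
    then obtain p where p: "a = gwa_class D p" "p \<in> carrier (free_ring D)"
      "\<forall>w\<in>Poly_Mapping.keys p. sum_list (map gen_deg w) = n"
      by (auto simp: gwa_component_def)
    have "Poly_Mapping.keys p \<subseteq> {w \<in> free_words D. sum_list (map gen_deg w) = n}"
      using p(2,3) by (auto simp: free_ring_simps)
    from poly[OF this] v w
    show "pairing (a \<odot>\<^bsub>V\<^esub> v) w = res_sig D \<omega> n (pairing v (gwa_star D a \<odot>\<^bsub>V\<^esub> w))"
      unfolding V_mod_def p(1) rep.gwa_module_smult[OF p(2) v] rep.gwa_module_star_smult[OF p(2) w] by blast
  next
    fix r v w assume "r \<in> carrier D" "v \<in> carrier (res_sum D S)" "w \<in> carrier (res_sum D S)"
    then show "pairing (gwa_coef D r \<odot>\<^bsub>V\<^esub> v) w = r \<odot>\<^bsub>res_sum D \<omega>\<^esub> pairing v w"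
      by (simp add: V_mod_simps[OF IX] pairing_smult_left)
  qed (simp_all add: pairing_closed pairing_add_left pairing_add_right)
qed

lemma pairing_nondegenerate: "nondegenerate_form D \<omega> V pairing"
  unfolding nondegenerate_form_def V_mod_simps[OF IX]
proof (intro ballI impI)
  fix v assume v: "v \<in> carrier (res_sum D S)" "v \<noteq> (\<lambda>n\<in>S. n)"
  obtain n where n: "n \<in> S" "v n \<noteq> n" by (rule nonzero_component[OF v])
  \<comment> \<open>The vector itself is a witness on both sides: the n-component is d(n) times v(n)
    times its conjugate, nonzero in a field.\<close>
  have v': "pairing v v n \<noteq> n" using pairing_zero_iff[OF v(1) v(1) n(1)] n(2) by simp
  then have "pairing v v \<noteq> \<zero>\<^bsub>res_sum D \<omega>\<^esub>"
    using S_in[OF n(1)] by (auto simp: Om.res_sum_simps)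
  then show "\<exists>w1\<in>carrier (res_sum D S). \<exists>w2\<in>carrier (res_sum D S).
      pairing w1 v \<noteq> \<zero>\<^bsub>res_sum D \<omega>\<^esub> \<and> pairing v w2 \<noteq> \<zero>\<^bsub>res_sum D \<omega>\<^esub>"
    using v(1) by blast
qed

lemma pseudo_unitarizable_if_no_inner_breaks:
  "inner_breaks D \<omega> S = {} \<Longrightarrow> pseudo_unitarizable D \<omega> V"
  unfolding pseudo_unitarizable_def
  using weight_module_V_mod[OF IX] pairing_admissible pairing_nondegenerate by blast

end

section \<open>The obstruction to a form at an inner break\<close>

context gwa_supportive
begin

text \<open>The conjugate-linear rule in the right argument is the degree 0 case of adjointness,
  applied to the conjugate scalar; the rules for X and Y are its cases of degree 1 and -1.\<close>

lemma admissible_form_rules: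
  assumes IX: "IX \<subseteq> inner_breaks D \<omega> S" and F: "admissible_form D \<omega> (V_mod D \<omega> S IX) F"
    and v: "v \<in> carrier (res_sum D S)" and w: "w \<in> carrier (res_sum D S)"
  shows "F v w \<in> carrier (res_sum D \<omega>)"
    "r \<in> carrier D \<Longrightarrow> F (r \<odot>\<^bsub>res_sum D S\<^esub> v) w = r \<odot>\<^bsub>res_sum D \<omega>\<^esub> F v w"
    "r \<in> carrier D \<Longrightarrow> F v (r \<odot>\<^bsub>res_sum D S\<^esub> w) = bar D r \<odot>\<^bsub>res_sum D \<omega>\<^esub> F v w"
    "F (V_X D \<omega> S IX v) w = res_sig D \<omega> 1 (F v (V_Y D \<omega> S IX w))"
    "F (V_Y D \<omega> S IX v) w = res_sig D \<omega> (- 1) (F v (V_X D \<omega> S IX w))"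
proof -
  interpret rep: gwa_rep D "res_sum D S" "V_X D \<omega> S IX" "V_Y D \<omega> S IX"
    by (rule V_rep[OF IX])
  note A = F[unfolded admissible_form_def V_mod_simps[OF IX]]
  have cl: "F v w \<in> carrier (res_sum D \<omega>)" if "v \<in> carrier (res_sum D S)" "w \<in> carrier (res_sum D S)" for v w
    using A that by blast
  then show "F v w \<in> carrier (res_sum D \<omega>)" using v w by blast
  have sm: "F (r \<odot>\<^bsub>res_sum D S\<^esub> v) w = r \<odot>\<^bsub>res_sum D \<omega>\<^esub> F v w"
    if "r \<in> carrier D" "v \<in> carrier (res_sum D S)" "w \<in> carrier (res_sum D S)" for r v w
    using A that V_mod_simps(4)[OF IX, of r v] by metis
  then show "r \<in> carrier D \<Longrightarrow> F (r \<odot>\<^bsub>res_sum D S\<^esub> v) w = r \<odot>\<^bsub>res_sum D \<omega>\<^esub> F v w"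
    using v w by blast
  have gen: "F (rep.wact [g] v) w = res_sig D \<omega> (gen_deg g) (F v (rep.wact [gen_star D g] w))"
    if g: "g \<in> Coef ` carrier D \<union> {GX, GY}" for g
  proof -
    have f: "[g] \<in> free_words D" "[gen_star D g] \<in> free_words D"
      using g by (auto simp: free_words_simps bar_closed)
    then have wf: "word [g] \<in> carrier (free_ring D)" by (simp add: word_in_free_ring)
    have "gwa_class D (word [g]) \<in> gwa_component D (gen_deg g)"
      unfolding gwa_component_def using wf by (intro imageI) simp
    then have "F (gwa_class D (word [g]) \<odot>\<^bsub>V_mod D \<omega> S IX\<^esub> v) w =
        res_sig D \<omega> (gen_deg g) (F v (gwa_star D (gwa_class D (word [g])) \<odot>\<^bsub>V_mod D \<omega> S IX\<^esub> w))"
      using A v w by blast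
    then show ?thesis
      unfolding V_mod_def rep.gwa_module_smult[OF wf v] rep.gwa_module_star_smult[OF wf w]
      using f v w by (simp add: free_star_word rep.act_word)
  qed
  show "F (V_X D \<omega> S IX v) w = res_sig D \<omega> 1 (F v (V_Y D \<omega> S IX w))"
    "F (V_Y D \<omega> S IX v) w = res_sig D \<omega> (- 1) (F v (V_X D \<omega> S IX w))"
    using gen[of GX] gen[of GY] by simp_all
  show "r \<in> carrier D \<Longrightarrow> F v (r \<odot>\<^bsub>res_sum D S\<^esub> w) = bar D r \<odot>\<^bsub>res_sum D \<omega>\<^esub> F v w"
    using gen[of "Coef (bar D r)"] sm[of "bar D r" v w] v w cl
    by (simp add: bar_closed bar_bar res_sig_0 res_sum_closed(2))
qed

text \<open>Different weights are orthogonal. The component of the value at m vanishes by locality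
  in the right argument, every other component by locality in the left one.\<close>

lemma admissible_form_weight_vanish:
  assumes IX: "IX \<subseteq> inner_breaks D \<omega> S" and F: "admissible_form D \<omega> (V_mod D \<omega> S IX) F"
    and m: "m \<in> S" and a: "a \<in> carrier (D Quot m)" and w: "w \<in> carrier (res_sum D S)" "w m = m"
  shows "F (single m a) w = (\<lambda>n\<in>\<omega>. n)"
proof -
  note R = admissible_form_rules[OF IX F]
  note e = single_closed[OF a]
  have "F (single m a) w n = n" if n: "n \<in> \<omega>" for n
  proof (cases "n = m")
    case True
    then show ?thesis
      using semilinear_local[of "F (single m a)" w n] R(1)[OF e] R(3)[OF e] w n by blast
  next
    case False
    then show ?thesis
      using twisted_linear_local[of "\<lambda>v. F v w" "\<lambda>r. r" n "single m a"] R(1)[OF _ w(1)] R(2)[OF _ w(1)] e n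
      by (simp add: single_apply)
  qed
  then show ?thesis
    using Om.res_sum_carrierD(1)[OF R(1)[OF e w(1)]] by (intro extensionalityI[of _ \<omega>]) auto
qed

lemma res_sig_zero: "res_sig D \<omega> k (\<lambda>n\<in>\<omega>. n) = (\<lambda>n\<in>\<omega>. n)"
  by (auto simp: res_sig_def orbit_shift orbit_shift_shift orbit_shift_0 intro!: restrict_ext)

text \<open>The radical vector is the image of a unit vector: X of the one at m if m is in
  \<open>IX\<close>, and Y of the one at \<sigma>(m) otherwise. Adjointness moves the operator to
  the other argument, where it becomes the zero arrow, so the result has no component at the weight
  of the unit vector and the form vanishes.\<close>

lemma pseudo_unitarizable_imp_no_inner_breaks:
  assumes IX: "IX \<subseteq> inner_breaks D \<omega> S" and pu: "pseudo_unitarizable D \<omega> (V_mod D \<omega> S IX)"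
  shows "inner_breaks D \<omega> S = {}"
proof (rule ccontr)
  assume "inner_breaks D \<omega> S \<noteq> {}"
  then obtain m where m: "m \<in> S" "telt D \<in> m" "shift D 1 m \<in> S"
    by (auto simp: inner_breaks_def breaks_iff)
  obtain F where F: "admissible_form D \<omega> (V_mod D \<omega> S IX) F" and nd: "nondegenerate_form D \<omega> (V_mod D \<omega> S IX) F"
    using pu by (auto simp: pseudo_unitarizable_def)
  note R = admissible_form_rules[OF IX F] and Z = admissible_form_weight_vanish[OF IX F]
  have nd': "\<exists>w\<in>carrier (res_sum D S). F v w \<noteq> (\<lambda>n\<in>\<omega>. n)"
    if "v \<in> carrier (res_sum D S)" "n \<in> S" "v n \<noteq> n" for v n
  proof -
    have "v \<noteq> (\<lambda>n\<in>S. n)" using that by auto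
    then show ?thesis using nd that(1) unfolding nondegenerate_form_def V_mod_simps[OF IX] Om.res_sum_simps(1) by blast
  qed
  let ?s = "shift D 1 m"
  note one = one_Quot
  show False
  proof (cases "m \<in> IX")
    case True
    let ?e = "single m \<one>\<^bsub>D Quot m\<^esub>"
    note e = single_closed[OF one(1)[OF m(1)]]
    have "V_X D \<omega> S IX ?e ?s = shift D 1 \<one>\<^bsub>D Quot m\<^esub>"
      using m True by (simp add: V_X_apply single_apply)
    then have "V_X D \<omega> S IX ?e ?s \<noteq> ?s"
      using shift_nonzero[OF S_in[OF m(1)] one[OF m(1)]] by simp
    then obtain w where w: "w \<in> carrier (res_sum D S)" "F (V_X D \<omega> S IX ?e) w \<noteq> (\<lambda>n\<in>\<omega>. n)"
      using nd'[OF V_ops_closed(1)[OF e] m(3)] by blast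
    have "V_Y D \<omega> S IX w m = m" using m True by (simp add: V_Y_at)
    then show False
      using w R(4)[OF e w(1)] Z[OF m(1) one(1)[OF m(1)] V_ops_closed(2)[OF w(1)]] by (simp add: res_sig_zero)
  next
    case False
    let ?e = "single ?s \<one>\<^bsub>D Quot ?s\<^esub>"
    note e = single_closed[OF one(1)[OF m(3)]]
    have "V_Y D \<omega> S IX ?e m = shift D (- 1) \<one>\<^bsub>D Quot ?s\<^esub>"
      using m False by (simp add: V_Y_at single_apply)
    then have "V_Y D \<omega> S IX ?e m \<noteq> m"
      using shift_nonzero[OF S_in[OF m(3)] one[OF m(3)], of "- 1"] shift_step[OF m(1)] by simp
    then obtain w where w: "w \<in> carrier (res_sum D S)" "F (V_Y D \<omega> S IX ?e) w \<noteq> (\<lambda>n\<in>\<omega>. n)"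
      using nd'[OF V_ops_closed(2)[OF e] m(1)] by blast
    have "V_X D \<omega> S IX w ?s = ?s" using m False by (simp add: V_X_apply)
    then show False
      using w R(5)[OF e w(1)] Z[OF m(3) one(1)[OF m(3)] V_ops_closed(1)[OF w(1)]] by (simp add: res_sig_zero)
  qed
qed

section \<open>Submodules and simplicity\<close>

text \<open>Vanishing on U is preserved when no nonzero arrow enters U from outside. The n-component
  of Xf comes from the predecessor of n and that of Yf from the successor, so each hypothesis says
  that the source lies in U or the arrow is zero.\<close>

lemma vanishing_submodule:
  assumes IX: "IX \<subseteq> inner_breaks D \<omega> S"
    and X: "\<And>n. \<lbrakk>n \<in> S; n \<in> U\<rbrakk> \<Longrightarrow> shift D (- 1) n \<in> U \<or> telt D \<in> shift D (- 1) n \<and> shift D (- 1) n \<notin> IX"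
    and Y: "\<And>n. \<lbrakk>n \<in> S; n \<in> U\<rbrakk> \<Longrightarrow> shift D 1 n \<in> U \<or> telt D \<in> n \<and> n \<in> IX"
  shows "submodule {f \<in> carrier (res_sum D S). \<forall>n\<in>S \<inter> U. f n = n} (gwa D) (V_mod D \<omega> S IX)"
  unfolding V_mod_def
proof (rule gwa_rep.submodule_gwa_module[OF V_rep[OF IX]])
  let ?H = "{f \<in> carrier (res_sum D S). \<forall>n\<in>S \<inter> U. f n = n}"
  note zero = ring.ring_simprules(2)[OF Quot_ring[OF S_in], unfolded Quot_zero]
  have null: "(n +>\<^bsub>D\<^esub> r) \<otimes>\<^bsub>D Quot n\<^esub> n = n" if "n \<in> S" "r \<in> carrier D" for n r
    using that by (simp add: coset_mult_zero_iff S_in zero)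
  show "?H \<subseteq> carrier (res_sum D S)" by blast
  show "\<zero>\<^bsub>res_sum D S\<^esub> \<in> ?H" using res_sum_zero_closed by (simp add: res_sum_simps)
  show "f \<oplus>\<^bsub>res_sum D S\<^esub> g \<in> ?H" if "f \<in> ?H" "g \<in> ?H" for f g
  proof -
    have "n \<oplus>\<^bsub>D Quot n\<^esub> n = n" if "n \<in> S" for n
      using ring.ring_simprules(8)[OF Quot_ring[OF S_in[OF that]] zero[OF that]] by (simp add: Quot_zero)
    then show ?thesis using that res_sum_closed(1)[OF _ _ zero_closed, of f g] by (simp add: res_sum_simps)
  qed
  show "r \<odot>\<^bsub>res_sum D S\<^esub> f \<in> ?H" if "r \<in> carrier D" "f \<in> ?H" for r f
    using that res_sum_closed(2)[of f f r] null by (simp add: res_sum_simps)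
  show "V_X D \<omega> S IX f \<in> ?H" if f: "f \<in> ?H" for f
  proof -
    have "V_X D \<omega> S IX f n = n" if n: "n \<in> S" "n \<in> U" for n
      using X[OF n] f n shift_step(1)[OF n(1)] null[of "shift D (- 1) n"] telt_closed
      by (auto simp: V_X_at Let_def)
    then show ?thesis using f V_ops_closed(1) by auto
  qed
  show "V_Y D \<omega> S IX f \<in> ?H" if f: "f \<in> ?H" for f
  proof -
    have "V_Y D \<omega> S IX f n = n" if n: "n \<in> S" "n \<in> U" for n
      using Y[OF n] f n shift_step(2)[OF n(1)] by (auto simp: V_Y_at)
    then show ?thesis using f V_ops_closed(2) by auto
  qed
qed

lemma simple_imp_no_inner_breaks:
  assumes IX: "IX \<subseteq> inner_breaks D \<omega> S" and simple: "simple_left_module (gwa D) (V_mod D \<omega> S IX)"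
  shows "inner_breaks D \<omega> S = {}"
proof (rule ccontr)
  assume "inner_breaks D \<omega> S \<noteq> {}"
  then obtain m where m: "m \<in> S" "telt D \<in> m" "shift D 1 m \<in> S"
    by (auto simp: inner_breaks_def breaks_iff)
  let ?s = "shift D 1 m"
  have mw: "m \<in> \<omega>" by (rule S_in[OF m(1)])
  \<comment> \<open>U is the half of the orbit that the zero arrow would enter. For m in
    \<open>IX\<close> this is Y from \<sigma>(m) to m, so U is everything up to m; otherwise it is X
    from m to \<sigma>(m), so U starts at \<sigma>(m).\<close>
  define U where "U = (if m \<in> IX then {shift D (- int k) m |k. True} else {shift D (int k + 1) m |k. True})"
  \<comment> \<open>If S has points both in U and outside it, the submodule is neither zero nor
    everything: it contains the unit vector at n' but not the one at n.\<close>
  have no: False if "n \<in> S" "n \<in> U" "n' \<in> S" "n' \<notin> U"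
    "submodule {f \<in> carrier (res_sum D S). \<forall>n\<in>S \<inter> U. f n = n} (gwa D) (V_mod D \<omega> S IX)" for n n'
  proof -
    let ?H = "{f \<in> carrier (res_sum D S). \<forall>n\<in>S \<inter> U. f n = n}"
    have "?H = {\<lambda>n\<in>S. n} \<or> ?H = carrier (res_sum D S)"
      using simple that(5) unfolding simple_left_module_def V_mod_simps[OF IX] by blast
    moreover have "single n' \<one>\<^bsub>D Quot n'\<^esub> \<in> ?H"
      using that by (auto simp: single_apply single_closed one_Quot)
    moreover have "single n' \<one>\<^bsub>D Quot n'\<^esub> \<noteq> (\<lambda>n\<in>S. n)"
      by (rule single_nonzero[OF that(3) one_Quot(2)[OF that(3)]])
    moreover have "single n \<one>\<^bsub>D Quot n\<^esub> \<in> carrier (res_sum D S) - ?H"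
      using that one_Quot(2)[OF that(1)] by (auto simp: single_apply single_closed one_Quot)
    ultimately show False by blast
  qed
  show False
  proof (cases "m \<in> IX")
    case True
    have U: "n \<in> U \<longleftrightarrow> (\<exists>k. n = shift D (- int k) m)" for n using True by (simp add: U_def)
    have mU: "m \<in> U" unfolding U using mw by (intro exI[of _ 0]) (simp add: orbit_shift_0)
    have sU: "?s \<notin> U"
    proof
      assume "?s \<in> U"
      then obtain k where "?s = shift D (- int k) m" by (auto simp: U)
      from orbit_shift_inj[OF mw this] show False by simp
    qed
    have "shift D (- 1) n \<in> U" if nU: "n \<in> U" for n
    proof -
      obtain k where "n = shift D (- int k) m" using nU by (auto simp: U)
      then show ?thesis unfolding U using mw by (intro exI[of _ "Suc k"]) (simp add: orbit_shift_shift algebra_simps)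
    qed
    moreover have "shift D 1 n \<in> U \<or> telt D \<in> n \<and> n \<in> IX" if nU: "n \<in> U" for n
    proof -
      obtain k where k: "n = shift D (- int k) m" using nU by (auto simp: U)
      show ?thesis
      proof (cases k)
        case 0
        then show ?thesis using k True m mw by (simp add: orbit_shift_0)
      next
        case (Suc j)
        then have "shift D 1 n = shift D (- int j) m" using k mw by (simp add: orbit_shift_shift)
        then show ?thesis unfolding U by blast
      qed
    qed
    ultimately show False using no[OF m(1) mU m(3) sU] vanishing_submodule[OF IX, of U] by blast
  next
    case False
    have U: "n \<in> U \<longleftrightarrow> (\<exists>k. n = shift D (int k + 1) m)" for n using False by (simp add: U_def)
    have sU: "?s \<in> U" unfolding U by (intro exI[of _ 0]) simp
    have mU: "m \<notin> U"
    proof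
      assume "m \<in> U"
      then obtain k where "m = shift D (int k + 1) m" by (auto simp: U)
      then have "shift D 0 m = shift D (int k + 1) m" using mw by (simp add: orbit_shift_0)
      from orbit_shift_inj[OF mw this] show False by simp
    qed
    have "shift D 1 n \<in> U" if nU: "n \<in> U" for n
    proof -
      obtain k where "n = shift D (int k + 1) m" using nU by (auto simp: U)
      then show ?thesis unfolding U using mw by (intro exI[of _ "Suc k"]) (simp add: orbit_shift_shift algebra_simps)
    qed
    moreover have "shift D (- 1) n \<in> U \<or> telt D \<in> shift D (- 1) n \<and> shift D (- 1) n \<notin> IX" if nU: "n \<in> U" for n
    proof -
      obtain k where k: "n = shift D (int k + 1) m" using nU by (auto simp: U)
      show ?thesis
      proof (cases k)
        case 0
        then show ?thesis using k False m mw by (simp add: orbit_shift_shift orbit_shift_0)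
      next
        case (Suc j)
        then have "shift D (- 1) n = shift D (int j + 1) m" using k mw by (simp add: orbit_shift_shift add.commute)
        then show ?thesis unfolding U by blast
      qed
    qed
    ultimately show False using no[OF m(3) sU m(1) mU] vanishing_submodule[OF IX, of U] by blast
  qed
qed

lemma interval_between:
  assumes "n \<in> S" "shift D i n \<in> S" "0 \<le> j \<and> j \<le> i \<or> i \<le> j \<and> j \<le> 0"
  shows "shift D j n \<in> S"
proof -
  have n: "n \<in> \<omega>" by (rule S_in[OF assms(1)])
  have int: "\<And>a b c. \<lbrakk>a \<in> S; b \<in> S; c \<in> \<omega>; orbit_less D a c; orbit_less D c b\<rbrakk> \<Longrightarrow> c \<in> S"
    using supp unfolding supportive_def orbit_interval_def by blast
  have less: "orbit_less D (shift D a n) (shift D b n)" if "a < b" for a b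
    unfolding orbit_less_def using that n by (intro exI[of _ "b - a"]) (simp add: orbit_shift_shift)
  have n0: "shift D 0 n = n" by (rule orbit_shift_0[OF n])
  consider "j = 0" | "j = i" | "0 < j \<and> j < i" | "i < j \<and> j < 0" using assms(3) by linarith
  then show ?thesis
  proof cases
    case 3
    then show ?thesis using int[OF assms(1,2) orbit_shift[OF n]] less[of 0 j] less[of j i] by (simp add: n0)
  next
    case 4
    then show ?thesis using int[OF assms(2,1) orbit_shift[OF n]] less[of i j] less[of j 0] by (simp add: n0)
  qed (use assms n0 in auto)
qed

text \<open>Between neighbours in S both arrows are then nonzero. A nonzero vector of a submodule
  yields a unit vector by separation, X and Y spread it over the whole interval, and finite sums
  exhaust V.\<close>

lemma no_inner_breaks_imp_simple:
  assumes none: "inner_breaks D \<omega> S = {}"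
  shows "simple_left_module (gwa D) (V_mod D \<omega> S {})"
proof -
  let ?V = "V_mod D \<omega> S {}"
  have IX: "{} \<subseteq> inner_breaks D \<omega> S" by simp
  note VS = V_mod_simps[OF IX]
  interpret M: module D "res_sum D S" by (rule res_sum_module)
  have unbroken: "telt D \<notin> n" if "n \<in> S" "shift D 1 n \<in> S" for n
    using none that by (auto simp: inner_breaks_def breaks_iff S_in)
  have full: "H = carrier (res_sum D S)" if sub: "submodule H (gwa D) ?V" and ne: "H \<noteq> {\<lambda>n\<in>S. n}" for H
  proof -
    interpret H: submodule H "gwa D" ?V by (rule sub)
    have Hc: "H \<subseteq> carrier (res_sum D S)" using H.subset by (simp add: VS)
    have H0: "(\<lambda>n\<in>S. n) \<in> H" using H.one_closed by (simp add: VS)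
    have Hadd: "f \<oplus>\<^bsub>res_sum D S\<^esub> g \<in> H" if "f \<in> H" "g \<in> H" for f g
      using H.m_closed[OF that] by (simp add: VS)
    have gens: "gwa_coef D r \<in> carrier (gwa D)" "gwa_X D \<in> carrier (gwa D)" "gwa_Y D \<in> carrier (gwa D)"
      if "r \<in> carrier D" for r
      using that by (auto simp: carrier_gwa word_in_free_ring free_words_simps intro!: imageI)
    have Hr: "r \<odot>\<^bsub>res_sum D S\<^esub> f \<in> H" if "r \<in> carrier D" "f \<in> H" for r f
      using H.smult_closed[OF gens(1)[OF that(1)] that(2)] that Hc by (auto simp: VS subset_iff)
    have HX: "V_X D \<omega> S {} f \<in> H" if "f \<in> H" for f
      using H.smult_closed[OF gens(2)[OF zero_closed] that] that Hc by (auto simp: VS subset_iff)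
    have HY: "V_Y D \<omega> S {} f \<in> H" if "f \<in> H" for f
      using H.smult_closed[OF gens(3)[OF zero_closed] that] that Hc by (auto simp: VS subset_iff)
    \<comment> \<open>One scalar r kills all components except that at n and keeps this one nonzero;
      a second scalar s, lifting a quotient in the field R/n, moves it to any prescribed a.\<close>
    have spread: "single n a \<in> H"
      if f: "f \<in> H" "f n \<noteq> n" and n: "n \<in> S" and a: "a \<in> carrier (D Quot n)" for f n a
    proof -
      interpret K: field "D Quot n" by (rule Quot_field[OF S_in[OF n]])
      have fc: "f \<in> carrier (res_sum D S)" using f Hc by auto
      let ?F = "{k \<in> S. f k \<noteq> k} - {n}"
      obtain r where r: "r \<in> carrier D" "r \<notin> n" "\<forall>k\<in>?F. r \<in> k"
        using ideals_separate[of ?F n] res_sum_carrierD(3)[OF fc] S_orbit S_in[OF n] by blast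
      let ?c = "(n +>\<^bsub>D\<^esub> r) \<otimes>\<^bsub>D Quot n\<^esub> f n"
      have fn: "f n \<in> carrier (D Quot n)" by (rule res_sum_carrierD(2)[OF fc n])
      have c: "?c \<in> carrier (D Quot n)" "?c \<noteq> n"
        using r f(2) fn coset_mult_zero_iff[OF S_in[OF n] r(1) fn] by (auto simp: coset_in_carrier)
      have "r \<odot>\<^bsub>res_sum D S\<^esub> f = single n ?c"
      proof (rule res_sum_eqI)
        fix k assume k: "k \<in> S"
        show "(r \<odot>\<^bsub>res_sum D S\<^esub> f) k = single n ?c k"
        proof (cases "k = n")
          case False
          then show ?thesis
            using k r coset_mult_zero_iff[OF S_in[OF k] r(1) res_sum_carrierD(2)[OF fc k]]
            by (auto simp: single_apply res_sum_simps)
        qed (use k in \<open>simp add: single_apply res_sum_simps\<close>)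
      qed (use r fc c in \<open>auto intro: single_closed\<close>)
      then have cH: "single n ?c \<in> H" using Hr[OF r(1) f(1)] by simp
      have u: "?c \<in> Units (D Quot n)" using c by (simp add: K.field_Units Quot_zero)
      obtain s where s: "s \<in> carrier D" "a \<otimes>\<^bsub>D Quot n\<^esub> inv\<^bsub>D Quot n\<^esub> ?c = n +>\<^bsub>D\<^esub> s"
        using K.m_closed[OF a K.Units_inv_closed[OF u]] by (auto simp: coset_carrier_iff)
      have "(n +>\<^bsub>D\<^esub> s) \<otimes>\<^bsub>D Quot n\<^esub> ?c = a"
        unfolding s(2)[symmetric] using u a by (simp only: K.m_assoc[OF a K.Units_inv_closed[OF u] c(1)] K.Units_l_inv[OF u] K.r_one)
      then have "s \<odot>\<^bsub>res_sum D S\<^esub> single n ?c = single n a"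
        using single_smult[OF n s(1) c(1)] by simp
      then show ?thesis using Hr[OF s(1) cH] by simp
    qed
    have "H \<noteq> {\<lambda>n\<in>S. n}" by (rule ne)
    then obtain f where f: "f \<in> H" "f \<noteq> (\<lambda>n\<in>S. n)" using H0 by blast
    obtain m where m: "m \<in> S" "f m \<noteq> m" using nonzero_component[OF _ f(2)] f(1) Hc by blast
    let ?good = "\<lambda>n. single n \<one>\<^bsub>D Quot n\<^esub> \<in> H"
    have good_m: "?good m" by (rule spread[OF f(1) m(2,1) one_Quot(1)[OF m(1)]])
    have up: "?good (shift D 1 n)" if "n \<in> S" "shift D 1 n \<in> S" "?good n" for n
    proof (rule spread[OF HX[OF that(3)] _ that(2) one_Quot(1)[OF that(2)]])
      have t: "telt D \<notin> n" by (rule unbroken[OF that(1,2)])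
      interpret K: field "D Quot n" by (rule Quot_field[OF S_in[OF that(1)]])
      have "(n +>\<^bsub>D\<^esub> telt D) \<otimes>\<^bsub>D Quot n\<^esub> \<one>\<^bsub>D Quot n\<^esub> \<noteq> n"
        using t coset_mult_zero_iff[OF S_in[OF that(1)] telt_closed K.one_closed] one_Quot(2)[OF that(1)] by simp
      from shift_nonzero[OF S_in[OF that(1)] _ this, of 1]
      show "V_X D \<omega> S {} (single n \<one>\<^bsub>D Quot n\<^esub>) (shift D 1 n) \<noteq> shift D 1 n"
        using that t by (simp add: V_X_apply single_apply coset_in_carrier telt_closed)
    qed
    have down: "?good n" if "n \<in> S" "shift D 1 n \<in> S" "?good (shift D 1 n)" for n
    proof (rule spread[OF HY[OF that(3)] _ that(1) one_Quot(1)[OF that(1)]])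
      show "V_Y D \<omega> S {} (single (shift D 1 n) \<one>\<^bsub>D Quot shift D 1 n\<^esub>) n \<noteq> n"
        using shift_nonzero[OF S_in[OF that(2)] one_Quot[OF that(2)], of "- 1"] that
        by (simp add: V_Y_at single_apply shift_step)
    qed
    have mw: "m \<in> \<omega>" by (rule S_in[OF m(1)])
    \<comment> \<open>The claim is conditional because S may end. Convexity of S puts the previous
      point, closer to m, in S whenever the current one is.\<close>
    have good: "shift D k m \<in> S \<longrightarrow> ?good (shift D k m)" for k
    proof (induction k rule: int_induct[where k = 0])
      case base
      then show ?case using good_m mw by (simp add: orbit_shift_0)
    next
      case (step1 k)
      show ?case
      proof
        assume S1: "shift D (k + 1) m \<in> S"
        have "shift D k m \<in> S" by (rule interval_between[OF m(1) S1]) (use step1 in auto)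
        moreover have "shift D (k + 1) m = shift D 1 (shift D k m)" using mw by (simp add: orbit_shift_shift add.commute)
        ultimately show "?good (shift D (k + 1) m)" using up step1 S1 by simp
      qed
    next
      case (step2 k)
      show ?case
      proof
        assume S1: "shift D (k - 1) m \<in> S"
        have "shift D k m \<in> S" by (rule interval_between[OF m(1) S1]) (use step2 in auto)
        moreover have "shift D k m = shift D 1 (shift D (k - 1) m)" using mw by (simp add: orbit_shift_shift)
        ultimately show "?good (shift D (k - 1) m)" using down[OF S1] step2 by simp
      qed
    qed
    have good_all: "single n a \<in> H" if n: "n \<in> S" and a: "a \<in> carrier (D Quot n)" for n a
    proof -
      obtain k where "n = shift D k m" using orbit_range[OF mw] S_in[OF n] by auto
      then have "?good n" using good n by simp
      moreover have "single n \<one>\<^bsub>D Quot n\<^esub> n \<noteq> n" using n by (simp add: single_apply one_Quot)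
      ultimately show ?thesis using spread n a by blast
    qed
    \<comment> \<open>Induction on a finite set containing the support: each step removes one
      component and restores it as a \<open>single\<close> vector of H.\<close>
    have "v \<in> H" if "v \<in> carrier (res_sum D S)" "{n \<in> S. v n \<noteq> n} \<subseteq> F" "finite F" for v F
      using that(3,1,2)
    proof (induction F arbitrary: v rule: finite_induct)
      case empty
      then have "v = (\<lambda>n\<in>S. n)" using res_sum_carrierD(1)[OF empty(1)] by (intro extensionalityI[of _ S]) auto
      then show ?case using H0 by (simp only:)
    next
      case (insert k F)
      note v = insert.prems(1)
      show ?case
      proof (cases "k \<in> S")
        case False
        then show ?thesis using insert by blast
      next
        case k: True
        note K = ring.ring_simprules(2,8,15)[OF Quot_ring[OF S_in], unfolded Quot_zero]
        define u where "u = (\<lambda>n\<in>S. if n = k then n else v n)"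
        have u: "u \<in> carrier (res_sum D S)"
          unfolding u_def
        proof (rule res_sum_restrictI)
          show "finite {n \<in> S. (if n = k then n else v n) \<noteq> n}"
            by (rule finite_subset[OF _ res_sum_carrierD(3)[OF v]]) auto
        qed (use res_sum_carrierD(2)[OF v] K(1) in auto)
        have "u \<in> H" by (rule insert.IH[OF u]) (use insert.prems(2) in \<open>auto simp: u_def\<close>)
        moreover have vk: "v k \<in> carrier (D Quot k)" by (rule res_sum_carrierD(2)[OF v k])
        moreover have "v = u \<oplus>\<^bsub>res_sum D S\<^esub> single k (v k)"
        proof (rule res_sum_eqI[OF v res_sum_closed(1)[OF u single_closed[OF vk] zero_closed]])
          fix n assume n: "n \<in> S"
          then show "v n = (u \<oplus>\<^bsub>res_sum D S\<^esub> single k (v k)) n"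
            using res_sum_carrierD(2)[OF v n] vk k
            by (cases "n = k") (simp_all add: res_sum_simps u_def single_apply K(2,3))
        qed
        ultimately show ?thesis using Hadd good_all[OF k vk] by metis
      qed
    qed
    then have "carrier (res_sum D S) \<subseteq> H" using res_sum_carrierD(3) by blast
    then show ?thesis using Hc by blast
  qed
  obtain n where n: "n \<in> S" using supp by (auto simp: supportive_def)
  have "carrier (res_sum D S) \<noteq> {\<lambda>n\<in>S. n}"
    using single_closed[OF one_Quot(1)[OF n]] single_nonzero[OF n one_Quot(2)[OF n]] by blast
  then show ?thesis
    unfolding simple_left_module_def VS
    using full gwa_rep.left_module_gwa_module[OF V_rep[OF IX]] by (auto simp: V_mod_def)
qed

end

theorem theorem5p3:
  fixes D :: "'a gwa_datum" and \<omega> S I\<^sub>X :: "'a set set"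
  assumes "gwa_setup D"
    and "\<omega> \<in> gwa_orbits D" and "infinite \<omega>" and "real_orbit D \<omega>"
    and "breaks D \<omega> \<noteq> {}"
    and "supportive D \<omega> S"
    and "I\<^sub>X \<subseteq> inner_breaks D \<omega> S"
  defines "V \<equiv> V_mod D \<omega> S I\<^sub>X"
  shows "left_modules_iso (gwa D) (fdual D \<omega> V) (V_mod D \<omega> S (inner_breaks D \<omega> S - I\<^sub>X))
    \<and> (pseudo_unitarizable D \<omega> V \<longleftrightarrow> inner_breaks D \<omega> S = {})
    \<and> (inner_breaks D \<omega> S = {} \<longleftrightarrow> simple_left_module (gwa D) V)"
proof -
  interpret gwa_setup D by fact
  interpret gwa_orbit D \<omega> by unfold_locales fact+
  have "S \<subseteq> \<omega>"
    using \<open>supportive D \<omega> S\<close> by (simp add: supportive_def orbit_interval_def)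
  then interpret gwa_supportive D \<omega> S
    by unfold_locales (simp_all only: \<open>supportive D \<omega> S\<close>)
  obtain d where d: "\<And>n. n \<in> \<omega> \<Longrightarrow> d n \<in> carrier (D Quot n)" "\<And>n. n \<in> \<omega> \<Longrightarrow> d n \<noteq> n"
    "\<And>n. \<lbrakk>n \<in> \<omega>; telt D \<notin> n\<rbrakk> \<Longrightarrow>
      shift D 1 (d n) = d (shift D 1 n) \<otimes>\<^bsub>D Quot shift D 1 n\<^esub> (shift D 1 n +>\<^bsub>D\<^esub> sig D (telt D))"
    "\<And>n. \<lbrakk>n \<in> \<omega>; telt D \<in> n\<rbrakk> \<Longrightarrow> shift D 1 (d n) = d (shift D 1 n)"
    by (rule scaling_exists) blast
  interpret gwa_pairing D \<omega> S d I\<^sub>X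
    by unfold_locales (use d assms(7) in auto)
  \<comment> \<open>Simplicity was shown for the empty index set. Without inner breaks
    \<open>I\<^sub>X\<close> is empty, so this is the module in question.\<close>
  show ?thesis
    unfolding V_def
    using fdual_iso pseudo_unitarizable_if_no_inner_breaks
      pseudo_unitarizable_imp_no_inner_breaks[OF assms(7)] simple_imp_no_inner_breaks[OF assms(7)]
      no_inner_breaks_imp_simple assms(7) by auto
qed

end
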